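(* Let $(X,d,\mu)$ be an infinite volume $\mathrm{CD}(k,n)$-space, with nonzero Cheeger isoperimetric constant, such that $$\mathcal V(X)=\inf_{x\in X}\mu(B(x,1))>0 .$$ Denote by $\Phi$ the isoperimetric profile of $(X,d,\mu)$. Let $m\ge 2$ be an integer such that $$l_\infty^{(m)}=\liminf_{t\to 0}\frac{1}{\omega_m}\frac{\Phi(t)^m}{m^m t^{m-1}}>0 .$$ Then for any $\alpha>0$ with $\alpha\le m\,(l_\infty^{(m)}\,\omega_{m-1})^{\frac1{m-1}}$ there is a constant $C>0$ such that for any $u\in W^{1,m}(X)$ satisfying $\|\mathrm{lip}(u)\|_m\le 1$, $$\int_X\Big(\exp\big(\alpha |u|^{\frac m{m-1}}\big)-P_m\big(\alpha |u|^{\frac m{m-1}}\big)\Big)\,d\mu\le C .$$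
   Context: A metric measure space $(X,d,\mu)$ is a complete separable metric space $(X,d)$ with a nonzero nonnegative Borel measure $\mu$, finite on balls, with support $X$. For $f:X\to\mathbb R$, the slope is $\mathrm{lip}(f)(x)=\limsup_{y\to x}|f(x)-f(y)|/d(x,y)$. For $p\ge1$ and $f$ measurable, the $p$-Cheeger energy is $\mathrm{Ch}_p(f)=\int_X\mathrm{lip}(f)^p\,d\mu$, and $W^{1,p}(X)=\{f\in L^p(X,\mu):\mathrm{Ch}_p(f)<\infty\}$; $\|\mathrm{lip}(f)\|_p=\mathrm{Ch}_p(f)^{1/p}$ is the $L^p$-norm of the slope. The perimeter of a measurable $A\subset X$ is $\mathrm{Per}(A)=\inf\{\liminf_i\int_X\mathrm{lip}(f_i)\,d\mu:\ f_i\text{ locally Lipschitz},\ f_i\to\chi_A\text{ in }L^1_{\mathrm{loc}}(X)\}$. The isoperimetric profile is $\Phi(t)=\inf\{\mathrm{Per}(A): A\subset X,\ \overline A\text{ compact},\ \mu(A)=t\}$, $0\le t\le\mu(X)$. The Cheeger constant is $h(X)=\inf\{\mathrm{Per}(A)/\mu(A): A\subset X,\ \overline A\text{ compact},\ 2\mu(A)\le\mu(X)\}$ (over sets with $\mu(A)>0$). $\mathrm{CD}(k,n)$ ($k\in\mathbb R$, $n>1$) is the curvature-dimension condition of Sturm and Lott–Villani; "$\mathrm{CD}(k,n)$-space" always means an essentially non-branching one. $\omega_q=\pi^{q/2}/\int_0^\infty t^{q/2}e^{-t}dt$ is the volume of the unit ball in $\mathbb R^q$, and $P_m(t)=\sum_{j=0}^{m-2}t^j/j!$.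 If $l_\infty^{(m)}=+\infty$ the condition on $\alpha$ is void.
   Formalization: Ch_p(f) (hence W^{1,m} and the norm of lip(u)) is taken as the L^p-relaxation of the integral of lip^p from locally Lipschitz functions, not as that integral for every measurable f; with the literal formula, multiples of the indicator of a ball in the hyperbolic plane refute the claim. *)

theory Defs
  imports "HOL-Probability.Probability"
begin

section \<open>Metric measure spaces\<close>

text \<open>
  The complete separable metric space is the type \<open>'a\<close> itself (class \<open>polish_space\<close>), so a metric
  measure space is given by its measure. The last conjunct says that the support is the whole space.
\<close>

definition metric_measure_space :: "'a::polish_space measure \<Rightarrow> bool" where
  "metric_measure_space M \<longleftrightarrow>
     sets M = sets borel \<and>
     emeasure M UNIV \<noteq> 0 \<and>
     (\<forall>x r. emeasure M (ball x r) < \<infinity>) \<and>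
     (\<forall>x. \<forall>r>0. emeasure M (ball x r) > 0)"

section \<open>Slope, Sobolev functions, perimeter\<close>

text \<open>Only used with exponent \<open>p > 0\<close>.\<close>

definition ennreal_powr :: "ennreal \<Rightarrow> real \<Rightarrow> ennreal" where
  "ennreal_powr x p = (if x = \<infinity> then \<infinity> else ennreal (enn2real x powr p))"

text \<open>The slope takes values in \<open>[0, \<infinity>]\<close>; at an isolated point it is \<open>0\<close>, since there \<open>at x = bot\<close>.\<close>

definition lip :: "('a::metric_space \<Rightarrow> real) \<Rightarrow> 'a \<Rightarrow> ennreal" where
  "lip f x = Limsup (at x) (\<lambda>y. ennreal (\<bar>f x - f y\<bar> / dist x y))"

definition locally_lipschitz :: "('a::metric_space \<Rightarrow> real) \<Rightarrow> bool" where
  "locally_lipschitz f \<longleftrightarrow> (\<forall>x. \<exists>r>0. \<exists>L. L-lipschitz_on (ball x r) f)"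

definition slope_integral :: "'a::metric_space measure \<Rightarrow> real \<Rightarrow> ('a \<Rightarrow> real) \<Rightarrow> ennreal" where
  "slope_integral M p f = (\<integral>\<^sup>+ x. ennreal_powr (lip f x) p \<partial>M)"

text \<open>
  The formula \<open>Ch\<^sub>p f = \<integral> lip(f)\<^sup>p d\<mu>\<close> cannot be applied verbatim to arbitrary measurable functions: the
  indicator of a ball with negligible boundary sphere has slope \<open>0\<close> almost everywhere, so all its
  multiples would lie in \<open>W\<^sup>1\<^sup>,\<^sup>p\<close> with zero energy and no Moser-Trudinger inequality could hold (the
  hyperbolic plane with \<open>m = 2\<close> is a counterexample). As usual, and exactly as for the perimeter below,
  the formula is therefore used on locally Lipschitz functions and extended to the other functions by
  lower semicontinuous relaxation, here with respect to convergence in \<open>L\<^sup>p\<close>.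
\<close>

definition cheeger_energy :: "'a::metric_space measure \<Rightarrow> real \<Rightarrow> ('a \<Rightarrow> real) \<Rightarrow> ennreal" where
  "cheeger_energy M p f =
     Inf {liminf (\<lambda>i. slope_integral M p (g i)) | g.
            (\<forall>i. locally_lipschitz (g i)) \<and>
            (\<lambda>i. \<integral>\<^sup>+ x. ennreal (\<bar>g i x - f x\<bar> powr p) \<partial>M) \<longlonglongrightarrow> 0}"

lemma cheeger_energy_le_slope_integral:
  assumes "locally_lipschitz f"
  shows "cheeger_energy M p f \<le> slope_integral M p f"
  unfolding cheeger_energy_def
  by (rule Inf_lower, rule CollectI, rule exI[of _ "\<lambda>_. f"]) (simp add: assms Liminf_const)

text \<open>The \<open>L\<^sup>p\<close> norm of the slope.\<close>

definition slope_norm :: "'a::metric_space measure \<Rightarrow> real \<Rightarrow> ('a \<Rightarrow> real) \<Rightarrow> ennreal" where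
  "slope_norm M p f = ennreal_powr (cheeger_energy M p f) (1 / p)"

definition sobolev_W1 :: "'a::metric_space measure \<Rightarrow> real \<Rightarrow> ('a \<Rightarrow> real) set" where
  "sobolev_W1 M p =
     {f \<in> borel_measurable M. (\<integral>\<^sup>+ x. ennreal (\<bar>f x\<bar> powr p) \<partial>M) < \<infinity> \<and> cheeger_energy M p f < \<infinity>}"

text \<open>Convergence in \<open>L\<^sup>1\<^sub>l\<^sub>o\<^sub>c\<close> is \<open>L\<^sup>1\<close> convergence on every compact set.\<close>

definition perimeter :: "'a::metric_space measure \<Rightarrow> 'a set \<Rightarrow> ennreal" where
  "perimeter M A =
     Inf {liminf (\<lambda>i. \<integral>\<^sup>+ x. lip (f i) x \<partial>M) | f.
            (\<forall>i. locally_lipschitz (f i)) \<and>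
            (\<forall>K. compact K \<longrightarrow>
               (\<lambda>i. \<integral>\<^sup>+ x\<in>K. ennreal \<bar>f i x - indicator A x\<bar> \<partial>M) \<longlonglongrightarrow> 0)}"

definition isoperimetric_profile :: "'a::metric_space measure \<Rightarrow> real \<Rightarrow> ennreal" where
  "isoperimetric_profile M t =
     Inf {perimeter M A | A. A \<in> sets M \<and> compact (closure A) \<and> emeasure M A = ennreal t}"

definition cheeger_constant :: "'a::metric_space measure \<Rightarrow> ennreal" where
  "cheeger_constant M =
     Inf {perimeter M A / emeasure M A | A.
            A \<in> sets M \<and> compact (closure A) \<and> emeasure M A > 0 \<and>
            2 * emeasure M A \<le> emeasure M UNIV}"

section \<open>The curvature-dimension condition\<close>

definition P2 :: "'a::polish_space measure set" where
  "P2 = {\<nu>. sets \<nu> = sets borel \<and> prob_space \<nu> \<and>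
            (\<exists>x0. (\<integral>\<^sup>+ x. ennreal ((dist x x0)\<^sup>2) \<partial>\<nu>) < \<infinity>)}"

definition P2_ac :: "'a::polish_space measure \<Rightarrow> 'a measure set" where
  "P2_ac M = {\<nu> \<in> P2. absolutely_continuous M \<nu>}"

definition couplings :: "'a::polish_space measure \<Rightarrow> 'a measure \<Rightarrow> ('a \<times> 'a) measure set" where
  "couplings \<nu>0 \<nu>1 =
     {q. sets q = sets (borel \<Otimes>\<^sub>M borel) \<and> distr q borel fst = \<nu>0 \<and> distr q borel snd = \<nu>1}"

definition transport_cost :: "('a::polish_space \<times> 'a) measure \<Rightarrow> ennreal" where
  "transport_cost q = (\<integral>\<^sup>+ z. ennreal ((dist (fst z) (snd z))\<^sup>2) \<partial>q)"

definition optimal_couplings :: "'a::polish_space measure \<Rightarrow> 'a measure \<Rightarrow> ('a \<times> 'a) measure set" where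
  "optimal_couplings \<nu>0 \<nu>1 =
     {q \<in> couplings \<nu>0 \<nu>1. \<forall>q' \<in> couplings \<nu>0 \<nu>1. transport_cost q \<le> transport_cost q'}"

text \<open>The infimum is finite for measures in \<open>P2\<close>, so passing to the reals loses nothing there.\<close>

definition W2 :: "'a::polish_space measure \<Rightarrow> 'a measure \<Rightarrow> real" where
  "W2 \<nu>0 \<nu>1 = sqrt (enn2real (INF q \<in> couplings \<nu>0 \<nu>1. transport_cost q))"

text \<open>
  The distortion coefficients \<open>\<tau>\<^sub>K\<^sub>,\<^sub>N\<^sup>t(\<theta>)\<close> of Sturm, for \<open>N > 1\<close>.
\<close>

definition tau :: "real \<Rightarrow> real \<Rightarrow> real \<Rightarrow> real \<Rightarrow> ennreal" where
  "tau K N t \<theta> =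
     (if K * \<theta>\<^sup>2 \<ge> (N - 1) * pi\<^sup>2 then \<infinity>
      else if K * \<theta>\<^sup>2 > 0 then
        ennreal (t powr (1 / N) *
          (sin (t * \<theta> * sqrt (K / (N - 1))) / sin (\<theta> * sqrt (K / (N - 1)))) powr (1 - 1 / N))
      else if K * \<theta>\<^sup>2 = 0 then ennreal t
      else
        ennreal (t powr (1 / N) *
          (sinh (t * \<theta> * sqrt (- K / (N - 1))) / sinh (\<theta> * sqrt (- K / (N - 1)))) powr (1 - 1 / N)))"

text \<open>The density of \<open>\<nu>\<close> with respect to \<open>M\<close>, which is finite almost everywhere if \<open>\<nu> \<in> P2_ac M\<close>.\<close>

definition dens :: "'a measure \<Rightarrow> 'a measure \<Rightarrow> 'a \<Rightarrow> real" where
  "dens M \<nu> x = enn2real (RN_deriv M \<nu> x)"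

text \<open>
  Sturm's condition \<open>CD(K, N)\<close>, for \<open>N > 1\<close>: along some geodesic \<open>\<Gamma>\<close> of absolutely continuous measures
  the Renyi entropies \<open>S\<^sub>N\<^sub>'(\<nu>) = - \<integral> \<rho>\<^sup>1\<^sup>-\<^sup>1\<^sup>/\<^sup>N\<^sup>' dM\<close> satisfy the distorted convexity inequality for all
  \<open>N' \<ge> N\<close>. Both sides are written with the opposite sign, so that they are integrals of nonnegative
  functions with values in \<open>[0, \<infinity>]\<close>.
\<close>

definition curvature_dimension :: "real \<Rightarrow> real \<Rightarrow> 'a::polish_space measure \<Rightarrow> bool" where
  "curvature_dimension K N M \<longleftrightarrow>
     (\<forall>\<nu>0 \<in> P2_ac M. \<forall>\<nu>1 \<in> P2_ac M.
        \<exists>q \<in> optimal_couplings \<nu>0 \<nu>1. \<exists>\<Gamma> :: real \<Rightarrow> 'a measure.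
          (\<forall>t\<in>{0..1}. \<Gamma> t \<in> P2_ac M) \<and> \<Gamma> 0 = \<nu>0 \<and> \<Gamma> 1 = \<nu>1 \<and>
          (\<forall>s\<in>{0..1}. \<forall>t\<in>{0..1}. W2 (\<Gamma> s) (\<Gamma> t) = \<bar>s - t\<bar> * W2 \<nu>0 \<nu>1) \<and>
          (\<forall>t\<in>{0..1}. \<forall>N'\<ge>N.
             (\<integral>\<^sup>+ x. ennreal (dens M (\<Gamma> t) x powr (1 - 1 / N')) \<partial>M) \<ge>
             (\<integral>\<^sup>+ z. tau K N' (1 - t) (dist (fst z) (snd z)) * ennreal (dens M \<nu>0 (fst z) powr (- 1 / N'))
                   + tau K N' t (dist (fst z) (snd z)) * ennreal (dens M \<nu>1 (snd z) powr (- 1 / N')) \<partial>q)))"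

text \<open>Constant speed geodesics parametrised by \<open>[0, 1]\<close>, as extensional functions.\<close>

definition geodesics :: "(real \<Rightarrow> 'a::metric_space) set" where
  "geodesics = {\<gamma> \<in> {0..1} \<rightarrow>\<^sub>E UNIV.
     \<forall>s\<in>{0..1}. \<forall>t\<in>{0..1}. dist (\<gamma> s) (\<gamma> t) = \<bar>s - t\<bar> * dist (\<gamma> 0) (\<gamma> 1)}"

text \<open>
  As the space is separable, the Borel sets of the uniform distance on \<open>geodesics\<close> are generated by
  the evaluation maps, that is, they form the trace of the product sigma-algebra.
\<close>

definition geodesic_space :: "(real \<Rightarrow> 'a::polish_space) measure" where
  "geodesic_space = restrict_space (\<Pi>\<^sub>M t\<in>{0..1}. borel) geodesics"

definition opt_geo :: "'a::polish_space measure \<Rightarrow> 'a measure \<Rightarrow> (real \<Rightarrow> 'a) measure set" where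
  "opt_geo \<nu>0 \<nu>1 =
     {\<eta>. sets \<eta> = sets geodesic_space \<and> prob_space \<eta> \<and>
         distr \<eta> (borel \<Otimes>\<^sub>M borel) (\<lambda>\<gamma>. (\<gamma> 0, \<gamma> 1)) \<in> optimal_couplings \<nu>0 \<nu>1}"

definition non_branching :: "(real \<Rightarrow> 'a) set \<Rightarrow> bool" where
  "non_branching G \<longleftrightarrow>
     (\<forall>\<gamma>\<in>G. \<forall>\<gamma>'\<in>G. (\<exists>t. 0 < t \<and> t < 1 \<and> (\<forall>s\<in>{0..t}. \<gamma> s = \<gamma>' s)) \<longrightarrow> \<gamma> = \<gamma>')"

definition essentially_non_branching :: "'a::polish_space measure \<Rightarrow> bool" where
  "essentially_non_branching M \<longleftrightarrow>
     (\<forall>\<nu>0 \<in> P2_ac M. \<forall>\<nu>1 \<in> P2_ac M. \<forall>\<eta> \<in> opt_geo \<nu>0 \<nu>1.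
        \<exists>G \<subseteq> geodesics. non_branching G \<and> (AE \<gamma> in \<eta>. \<gamma> \<in> G))"

definition CD_space :: "real \<Rightarrow> real \<Rightarrow> 'a::polish_space measure \<Rightarrow> bool" where
  "CD_space k n M \<longleftrightarrow>
     metric_measure_space M \<and> curvature_dimension k n M \<and> essentially_non_branching M"

section \<open>Quantities in the Moser-Trudinger inequality\<close>

text \<open>The volume \<open>\<omega>\<^sub>q\<close> of the unit ball is the library constant \<open>unit_ball_vol q\<close>.\<close>

definition l_infty :: "'a::metric_space measure \<Rightarrow> nat \<Rightarrow> ennreal" where
  "l_infty M m =
     Liminf (at_right 0) (\<lambda>t. ennreal (1 / unit_ball_vol (real m)) *
       (isoperimetric_profile M t ^ m / ennreal (real m ^ m * t ^ (m - 1))))"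

definition P_poly :: "nat \<Rightarrow> real \<Rightarrow> real" where
  "P_poly m t = (\<Sum>j=0..m - 2. t ^ j / fact j)"

end

theory Submission
  imports Defs
begin

text \<open>
  The bound on \<open>\<alpha>\<close> is strictly subcritical, since \<open>\<omega>\<^sub>m\<^sub>-\<^sub>1 < m \<omega>\<^sub>m\<close>. So near \<open>0\<close> the profile satisfies
  \<open>\<Phi>(t)\<^sup>m \<ge> (B t)\<^sup>m\<^sup>-\<^sup>1\<close> with \<open>B > \<alpha>\<close>, while the Cheeger constant gives \<open>Per(A) \<ge> h \<mu>(A)\<close> for all \<open>A\<close>
  with compact closure. For \<open>g \<ge> 0\<close> locally Lipschitz with compact support, the coarea inequality with
  weight \<open>m r\<^sup>m\<^sup>-\<^sup>1\<close> and the linear bound control \<open>\<integral> g\<^sup>m\<close>; on thin slabs \<open>{s < g < t}\<close> the coarea inequality and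
  the profile bound give \<open>(t - s)\<^sup>m (B \<lambda>(t))\<^sup>m\<^sup>-\<^sup>1 \<le> (\<lambda>(s) - \<lambda>(t))\<^sup>m\<^sup>-\<^sup>1 \<integral> lip(g)\<^sup>m\<close> for the distribution function
  \<open>\<lambda>\<close> of \<open>g\<close>. Multiplying over ever thinner slabs yields \<open>\<lambda>(s) \<le> C exp(- \<beta> (s - s\<^sub>0)\<^sup>q)\<close> with \<open>q = m / (m - 1)\<close> and
  some \<open>\<beta> > \<alpha>\<close>, which makes the exponential integrable.

  General functions are reached by cutoffs, which requires bounded sets to be relatively compact. This is
  where the curvature-dimension condition enters: transporting a fixed ball almost all the way to a small
  ball bounds the measure of the latter from below, so that a bounded set contains no infinite separated
  subset.
\<close>

section \<open>Slopes of locally Lipschitz functions\<close>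

text \<open>Since m \<omega>_m is the area of the unit sphere, the choice B = m (l m
  \<omega>_m)^(1/(m-1)) is the classical Moser exponent rescaled by l. The hypothesis has
  \<omega>_(m-1) in place of m \<omega>_m, and the gap between \<alpha> and B is spent three times:
  l lies below the liminf, the energy bound for test functions is relaxed from 1 to some A > 1 under
  which relaxation and cutoffs fit, and the decay rate \<beta> = B A^(-1/(m-1)) still exceeds
  \<alpha>, so that a plain sum over unit layers converges. With \<beta> = \<alpha> the terms of
  that sum would not even tend to 0. The profile bound holds for small masses only, so the decay
  needs a starting level \<open>s0\<close> whose superlevel set has small mass. The Cheeger constant
  provides it: it bounds the integral of g^m, and \<open>s0\<close> then depends on the constants
  alone. Thin slabs stand in for a derivative of the distribution function, which may jump; k equal
  slabs contribute a factor (1 + Q/k)^k, which tends to exp Q.\<close>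

lemma lip_le_affine:
  fixes f g :: "'a::metric_space \<Rightarrow> real"
  assumes ev: "eventually (\<lambda>y. \<bar>f x - f y\<bar> \<le> a * \<bar>g x - g y\<bar> + c * dist x y) (at x)"
    and a: "a \<ge> 0" and c: "c \<ge> 0"
  shows "lip f x \<le> ennreal a * lip g x + ennreal c"
proof (cases "at x = bot")
  case True
  then show ?thesis by (simp add: lip_def)
next
  case False
  let ?q = "\<lambda>y. ennreal (\<bar>g x - g y\<bar> / dist x y)"
  let ?h = "\<lambda>z. ennreal a * z + ennreal c"
  have "lip f x \<le> Limsup (at x) (\<lambda>y. ?h (?q y))"
    unfolding lip_def
  proof (rule Limsup_mono)
    have "eventually (\<lambda>y. y \<noteq> x) (at x)" by (simp add: eventually_at_filter)
    then show "\<forall>\<^sub>F y in at x. ennreal (\<bar>f x - f y\<bar> / dist x y) \<le> ?h (?q y)"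
      using ev
    proof eventually_elim
      case (elim y)
      then have "\<bar>f x - f y\<bar> / dist x y \<le> (a * \<bar>g x - g y\<bar> + c * dist x y) / dist x y"
        by (intro divide_right_mono) auto
      also have "\<dots> = a * (\<bar>g x - g y\<bar> / dist x y) + c" using elim by (simp add: add_divide_distrib)
      finally have "ennreal (\<bar>f x - f y\<bar> / dist x y) \<le> ennreal (a * (\<bar>g x - g y\<bar> / dist x y) + c)"
        by (rule ennreal_leI)
      also have "\<dots> = ?h (?q y)"
        using a c ennreal_mult[of a "\<bar>g x - g y\<bar> / dist x y"] by (simp add: ennreal_plus)
      finally show ?case .
    qed
  qed
  \<comment> \<open>A continuous monotone map commutes with \<open>Limsup\<close> along a proper
    filter, which is why isolated points were split off.\<close>
  also have "\<dots> = ?h (Limsup (at x) ?q)"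
  proof (rule Limsup_compose_continuous_mono)
    show "continuous_on UNIV ?h"
      by (intro continuous_on_add_ennreal ennreal_continuous_on_cmult continuous_on_const continuous_on_id) auto
    show "mono ?h" by (intro monoI add_mono mult_left_mono) auto
  qed (use False in auto)
  finally show ?thesis by (simp add: lip_def)
qed

lemma locally_lipschitzE:
  assumes "locally_lipschitz f"
  obtains r L where "r > 0" "L \<ge> 0" "\<And>y z. y \<in> ball x r \<Longrightarrow> z \<in> ball x r \<Longrightarrow> \<bar>f y - f z\<bar> \<le> L * dist y z"
proof -
  obtain r L where "r > 0" "L-lipschitz_on (ball x r) f" using assms unfolding locally_lipschitz_def by blast
  then show thesis using that[of r L] by (auto simp: lipschitz_on_def dist_real_def)
qed

lemma locally_lipschitzI:
  assumes "\<And>x. \<exists>r>0. \<exists>L. \<forall>y\<in>ball x r. \<forall>z\<in>ball x r. \<bar>f y - f z\<bar> \<le> L * dist y z"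
  shows "locally_lipschitz f"
  unfolding locally_lipschitz_def
proof
  fix x
  obtain r L where r: "r > 0" and L: "\<forall>y\<in>ball x r. \<forall>z\<in>ball x r. \<bar>f y - f z\<bar> \<le> L * dist y z"
    using assms by blast
  have "\<bar>L\<bar>-lipschitz_on (ball x r) f"
  proof (rule lipschitz_onI)
    fix y z assume "y \<in> ball x r" "z \<in> ball x r"
    then have "\<bar>f y - f z\<bar> \<le> L * dist y z" using L by blast
    also have "\<dots> \<le> \<bar>L\<bar> * dist y z" by (intro mult_right_mono) auto
    finally show "dist (f y) (f z) \<le> \<bar>L\<bar> * dist y z" by (simp add: dist_real_def)
  qed auto
  then show "\<exists>r>0. \<exists>L. L-lipschitz_on (ball x r) f" using r by blast
qed

lemma locally_lipschitz_continuous: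
  assumes "locally_lipschitz f"
  shows "continuous_on UNIV f"
proof -
  have "isCont f x" for x
  proof -
    obtain r L where r: "r > 0" "L-lipschitz_on (ball x r) f" using assms unfolding locally_lipschitz_def by blast
    then have "continuous_on (ball x r) f" by (intro lipschitz_on_continuous_on)
    then show ?thesis using r(1) by (simp add: continuous_on_eq_continuous_at)
  qed
  then show ?thesis by (simp add: continuous_at_imp_continuous_on)
qed

lemma lip_finite:
  assumes "locally_lipschitz f"
  shows "lip f x < \<infinity>"
proof -
  obtain r L where r: "r > 0" "L \<ge> 0" "\<And>y z. y \<in> ball x r \<Longrightarrow> z \<in> ball x r \<Longrightarrow> \<bar>f y - f z\<bar> \<le> L * dist y z"
    using locally_lipschitzE[OF assms, of x] by blast
  have "eventually (\<lambda>y. y \<in> ball x r) (at x)" using r(1) by (intro eventually_at_in_open') auto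
  then have "eventually (\<lambda>y. \<bar>f x - f y\<bar> \<le> 0 * \<bar>(0::real) - 0\<bar> + L * dist x y) (at x)"
    by eventually_elim (use r in auto)
  from lip_le_affine[OF this] r(2) have "lip f x \<le> ennreal L" by simp
  then show ?thesis by (rule le_less_trans) simp
qed

text \<open>The supremum of the difference quotient over a punctured ball of radius 1/(n+1) is lower
  semicontinuous in the centre: for each fixed \<open>y\<close>, the centres at which
  \<open>y\<close> witnesses a value above \<open>c\<close> form an open set, and any union of these
  is open. The slope is the infimum of countably many such functions.\<close>

lemma lip_measurable:
  fixes f :: "'a::metric_space \<Rightarrow> real"
  assumes f: "continuous_on UNIV f"
  shows "lip f \<in> borel_measurable borel"
proof -
  define s where "s n x = (SUP y\<in>ball x (inverse (Suc n)) - {x}. ennreal (\<bar>f x - f y\<bar> / dist x y))" for n x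
  have "s n \<in> borel_measurable borel" for n
  proof (rule borel_measurableI_greater)
    fix c :: ennreal
    let ?U = "\<lambda>y. {x. dist x y < inverse (Suc n) \<and> x \<noteq> y} \<inter> {x. x \<noteq> y \<and> c < ennreal (\<bar>f x - f y\<bar> / dist x y)}"
    have "open (?U y)" for y
    proof (intro open_Int)
      show "open {x. dist x y < inverse (Suc n) \<and> x \<noteq> y}"
        by (intro open_Collect_conj open_Collect_less open_Collect_neq continuous_intros)
      have "open {x \<in> - {y}. c < ennreal (\<bar>f x - f y\<bar> / dist x y)}"
      proof -
        have "continuous_on (- {y}) (\<lambda>x. ennreal (\<bar>f x - f y\<bar> / dist x y))"
          by (intro continuous_on_ennreal continuous_intros continuous_on_subset[OF f]) auto
        then have "open ((\<lambda>x. ennreal (\<bar>f x - f y\<bar> / dist x y)) -` {c<..} \<inter> - {y})"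
          by (subst Int_commute) (intro continuous_open_preimage, auto)
        then show ?thesis by (simp add: vimage_def Int_def conj_commute)
      qed
      then show "open {x. x \<noteq> y \<and> c < ennreal (\<bar>f x - f y\<bar> / dist x y)}" by simp
    qed
    moreover have "{x. c < s n x} = (\<Union>y. ?U y)"
      unfolding s_def less_SUP_iff by (auto simp: dist_commute)
    ultimately have "open {x. c < s n x}" by (metis (no_types, lifting) open_UN)
    then show "{x \<in> space borel. c < s n x} \<in> sets borel" by simp
  qed
  note [measurable] = this
  have "lip f x = (INF n. s n x)" for x
  proof (rule antisym)
    show "lip f x \<le> (INF n. s n x)"
    proof (rule INF_greatest)
      fix n
      have "eventually (\<lambda>y. y \<in> ball x (inverse (Suc n)) - {x}) (at x)"
        by (intro eventually_at_in_open) auto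
      then have "eventually (\<lambda>y. ennreal (\<bar>f x - f y\<bar> / dist x y) \<le> s n x) (at x)"
        unfolding s_def by eventually_elim (rule SUP_upper)
      then show "lip f x \<le> s n x" unfolding lip_def by (rule Limsup_bounded)
    qed
    show "(INF n. s n x) \<le> lip f x"
      unfolding lip_def Limsup_def
    proof (rule INF_greatest)
      fix P assume "P \<in> {P. eventually P (at x)}"
      then obtain d where d: "d > 0" "\<And>y. y \<noteq> x \<Longrightarrow> dist y x < d \<Longrightarrow> P y" by (auto simp: eventually_at)
      obtain n where "inverse (real (Suc n)) < d" using reals_Archimedean[OF d(1)] by blast
      then have "s n x \<le> Sup ((\<lambda>y. ennreal (\<bar>f x - f y\<bar> / dist x y)) ` Collect P)"
        unfolding s_def using d(2) by (intro SUP_subset_mono) (auto simp: dist_commute)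
      then show "(INF n. s n x) \<le> Sup ((\<lambda>y. ennreal (\<bar>f x - f y\<bar> / dist x y)) ` Collect P)"
        by (rule INF_lower2[OF UNIV_I])
    qed
  qed
  then have "lip f = (\<lambda>x. INF n. s n x)" by blast
  then show ?thesis by simp
qed

lemma ennreal_powr_of_nat:
  assumes "m > 0"
  shows "ennreal_powr x (real m) = x ^ m"
proof (cases x)
  case (real r)
  then show ?thesis using assms
    by (cases "r = 0") (auto simp: ennreal_powr_def powr_realpow ennreal_power)
qed (use assms in \<open>auto simp: ennreal_powr_def\<close>)

text \<open>A linear step from 0 at \<open>r\<close> to 1 at \<open>r + 1 / N\<close>. It vanishes
  at \<open>r\<close> itself, so \<open>ramp N r (g x)\<close> approximates the indicator of the
  strict superlevel set.\<close>

definition ramp :: "real \<Rightarrow> real \<Rightarrow> real \<Rightarrow> real" where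
  "ramp N r s = max 0 (min 1 (N * (s - r)))"

lemma ramp_lipschitz: "N > 0 \<Longrightarrow> \<bar>ramp N r s - ramp N r t\<bar> \<le> N * \<bar>s - t\<bar>"
proof -
  assume N: "N > 0"
  have "\<bar>ramp N r s - ramp N r t\<bar> \<le> \<bar>N * (s - r) - N * (t - r)\<bar>" unfolding ramp_def by linarith
  also have "N * (s - r) - N * (t - r) = N * (s - t)" by (simp add: algebra_simps)
  finally show ?thesis using N by (simp add: abs_mult)
qed

text \<open>Off the closed band the ramp is constant near \<open>x\<close> by continuity of
  \<open>g\<close>, so its slope vanishes. The endpoints belong to the band because the ramp need
  not be locally constant there.\<close>

lemma lip_ramp_le:
  assumes g: "continuous_on UNIV g" and N: "N > 0"
  shows "lip (\<lambda>x. ramp N r (g x)) x \<le> ennreal N * lip g x * indicator {x. r \<le> g x \<and> g x \<le> r + 1 / N} x"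
proof (cases "r \<le> g x \<and> g x \<le> r + 1 / N")
  case True
  have "lip (\<lambda>x. ramp N r (g x)) x \<le> ennreal N * lip g x + ennreal 0"
    using ramp_lipschitz[OF N] N by (intro lip_le_affine always_eventually) auto
  then show ?thesis using True by simp
next
  case False
  have "isCont g x" using g by (simp add: continuous_on_eq_continuous_at)
  then have lim: "(g \<longlongrightarrow> g x) (at x)" by (simp add: isCont_def)
  have "eventually (\<lambda>y. ramp N r (g y) = ramp N r (g x)) (at x)"
  proof (cases "g x < r")
    case True
    then have "eventually (\<lambda>y. g y < r) (at x)" using lim by (simp add: order_tendstoD)
    then show ?thesis
    proof eventually_elim
      case (elim y)
      then have "N * (g y - r) \<le> 0" "N * (g x - r) \<le> 0" using True N by (auto simp: mult_le_0_iff)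
      then show ?case by (simp add: ramp_def)
    qed
  next
    case F: False
    then have gt: "g x > r + 1 / N" using False by auto
    then have "eventually (\<lambda>y. g y > r + 1 / N) (at x)" using lim by (simp add: order_tendstoD)
    then show ?thesis
    proof eventually_elim
      case (elim y)
      then have "N * (g y - r) \<ge> 1" "N * (g x - r) \<ge> 1" using gt N by (auto simp: field_simps)
      then show ?case by (simp add: ramp_def)
    qed
  qed
  then have "eventually (\<lambda>y. \<bar>ramp N r (g x) - ramp N r (g y)\<bar> \<le> 0 * \<bar>g x - g y\<bar> + 0 * dist x y) (at x)"
    by eventually_elim auto
  from lip_le_affine[OF this] have "lip (\<lambda>x. ramp N r (g x)) x = 0" by simp
  then show ?thesis by simp
qed

lemma locally_lipschitz_ramp:
  assumes "locally_lipschitz g" "N > 0"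
  shows "locally_lipschitz (\<lambda>x. ramp N r (g x))"
proof (rule locally_lipschitzI)
  fix x
  obtain d L where d: "d > 0" "L \<ge> 0" "\<And>y z. y \<in> ball x d \<Longrightarrow> z \<in> ball x d \<Longrightarrow> \<bar>g y - g z\<bar> \<le> L * dist y z"
    using locally_lipschitzE[OF assms(1), of x] by blast
  have "\<bar>ramp N r (g y) - ramp N r (g z)\<bar> \<le> (N * L) * dist y z" if "y \<in> ball x d" "z \<in> ball x d" for y z
  proof -
    have "\<bar>ramp N r (g y) - ramp N r (g z)\<bar> \<le> N * \<bar>g y - g z\<bar>" by (rule ramp_lipschitz[OF assms(2)])
    also have "\<dots> \<le> N * (L * dist y z)" using d(3)[OF that] assms(2) by simp
    finally show ?thesis by simp
  qed
  then show "\<exists>d>0. \<exists>L. \<forall>y\<in>ball x d. \<forall>z\<in>ball x d. \<bar>ramp N r (g y) - ramp N r (g z)\<bar> \<le> L * dist y z"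
    using d(1) by blast
qed

lemma ramp_tendsto_indicator:
  "(\<lambda>n. ramp (real (Suc n)) r s) \<longlonglongrightarrow> (if s > r then 1 else 0)"
proof (cases "s > r")
  case False
  then have "real (Suc n) * (s - r) \<le> 0" for n by (intro mult_nonneg_nonpos) auto
  then have "ramp (real (Suc n)) r s = 0" for n
    unfolding ramp_def by (smt (verit, best))
  then show ?thesis using False by simp
next
  case True
  obtain k where k: "1 / (s - r) < real k" using reals_Archimedean2 by blast
  have "ramp (real (Suc n)) r s = 1" if "n \<ge> k" for n
  proof -
    have "1 / (s - r) \<le> real (Suc n)" using k that by linarith
    then have "1 \<le> real (Suc n) * (s - r)" using True by (simp add: field_simps)
    then show ?thesis by (simp add: ramp_def)
  qed
  then have "eventually (\<lambda>n. ramp (real (Suc n)) r s = 1) sequentially" by (auto simp: eventually_sequentially)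
  then show ?thesis using True by (simp add: tendsto_eventually)
qed

section \<open>Couplings and Wasserstein geodesics\<close>

text \<open>The index is that of the first point of a dense sequence within \<open>d/2\<close>. Its
  fibres are the cells along which couplings are glued below.\<close>

lemma ex_fine_index:
  fixes d :: real
  assumes "d > 0"
  obtains j :: "'a::polish_space \<Rightarrow> nat"
  where "j \<in> measurable borel (count_space UNIV)" "\<And>x y. j x = j y \<Longrightarrow> dist x y < d"
proof -
  obtain D :: "'a set" where D: "countable D" "\<And>X. open X \<Longrightarrow> X \<noteq> {} \<Longrightarrow> \<exists>y\<in>D. y \<in> X"
    by (rule countable_dense_setE) blast
  define e where "e = from_nat_into D"
  define j where "j x = (LEAST n. dist x (e n) < d/2)" for x
  have ex: "\<exists>n. dist x (e n) < d/2" for x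
  proof -
    obtain y where "y \<in> D" "y \<in> ball x (d/2)" using D(2)[of "ball x (d/2)"] assms by auto
    then show ?thesis using from_nat_into_surj[OF D(1)] unfolding e_def by (metis mem_ball)
  qed
  have near: "dist x (e (j x)) < d/2" for x unfolding j_def by (rule LeastI_ex[OF ex])
  show thesis
  proof
    show "j \<in> measurable borel (count_space UNIV)" unfolding j_def[abs_def] by measurable
    fix x y assume "j x = j y"
    then show "dist x y < d" using near[of x] near[of y] by (metis dist_triangle_half_l)
  qed
qed

lemma couplingsD:
  assumes "q \<in> couplings \<nu>0 \<nu>1"
  shows "sets q = sets (borel \<Otimes>\<^sub>M borel)" "distr q borel fst = \<nu>0" "distr q borel snd = \<nu>1"
  using assms by (auto simp: couplings_def)

lemma prob_space_coupling:
  assumes "q \<in> couplings \<nu>0 \<nu>1" "prob_space \<nu>0"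
  shows "prob_space q"
proof -
  have [measurable_cong]: "sets q = sets (borel \<Otimes>\<^sub>M borel)" using couplingsD(1)[OF assms(1)] .
  show ?thesis
    using prob_space_distrD[of fst q borel] couplingsD(2)[OF assms(1)] assms(2) by simp
qed

lemma
  assumes q: "q \<in> couplings \<nu>0 \<nu>1" and f [measurable]: "f \<in> borel_measurable borel"
  shows nn_integral_coupling_fst: "(\<integral>\<^sup>+ z. f (fst z) \<partial>q) = (\<integral>\<^sup>+ x. f x \<partial>\<nu>0)"
    and nn_integral_coupling_snd: "(\<integral>\<^sup>+ z. f (snd z) \<partial>q) = (\<integral>\<^sup>+ x. f x \<partial>\<nu>1)"
proof -
  have [measurable_cong]: "sets q = sets (borel \<Otimes>\<^sub>M borel)" using couplingsD(1)[OF q] .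
  show "(\<integral>\<^sup>+ z. f (fst z) \<partial>q) = (\<integral>\<^sup>+ x. f x \<partial>\<nu>0)"
    unfolding couplingsD(2)[OF q, symmetric] by (subst nn_integral_distr) auto
  show "(\<integral>\<^sup>+ z. f (snd z) \<partial>q) = (\<integral>\<^sup>+ x. f x \<partial>\<nu>1)"
    unfolding couplingsD(3)[OF q, symmetric] by (subst nn_integral_distr) auto
qed

lemma
  assumes q: "q \<in> couplings \<nu>0 \<nu>1" and P: "Measurable.pred borel P"
  shows AE_coupling_fst: "(AE z in q. P (fst z)) \<longleftrightarrow> (AE x in \<nu>0. P x)"
    and AE_coupling_snd: "(AE z in q. P (snd z)) \<longleftrightarrow> (AE x in \<nu>1. P x)"
proof -
  have s [measurable_cong]: "sets q = sets (borel \<Otimes>\<^sub>M borel)" using couplingsD(1)[OF q] .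
  have P': "{x \<in> space borel. P x} \<in> sets borel" using P by simp
  show "(AE z in q. P (fst z)) \<longleftrightarrow> (AE x in \<nu>0. P x)"
    unfolding couplingsD(2)[OF q, symmetric] using P' by (subst AE_distr_iff) auto
  show "(AE z in q. P (snd z)) \<longleftrightarrow> (AE x in \<nu>1. P x)"
    unfolding couplingsD(3)[OF q, symmetric] using P' by (subst AE_distr_iff) auto
qed

text \<open>
  An approximate gluing of two couplings along their common marginal \<open>g\<close>: the two middle points are
  only required to lie in the same cell of a countable partition, so that no disintegration is needed.
\<close>

definition glue :: "('a::polish_space \<Rightarrow> nat) \<Rightarrow> 'a measure \<Rightarrow> ('a \<times> 'a) measure \<Rightarrow> ('a \<times> 'a) measure
    \<Rightarrow> (('a \<times> 'a) \<times> ('a \<times> 'a)) measure" where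
  "glue j g q1 q2 = density (q1 \<Otimes>\<^sub>M q2)
     (\<lambda>z. if j (snd (fst z)) = j (fst (snd z)) then inverse (emeasure g (j -` {j (snd (fst z))})) else 0)"

context
  fixes j :: "'a::polish_space \<Rightarrow> nat" and g \<nu>0 \<nu>1 :: "'a measure" and q1 q2
  assumes q1: "q1 \<in> couplings \<nu>0 g" and q2: "q2 \<in> couplings g \<nu>1"
    and g: "prob_space g" "sets g = sets borel" and \<nu>0: "prob_space \<nu>0"
    and j [measurable]: "j \<in> measurable borel (count_space UNIV)"
begin

interpretation g: prob_space g by fact
interpretation q1: prob_space q1 using prob_space_coupling[OF q1 \<nu>0] .
interpretation q2: prob_space q2 using prob_space_coupling[OF q2 g(1)] .
interpretation pair_sigma_finite q1 q2 ..

lemma q12_sets [measurable_cong]: "sets q1 = sets (borel \<Otimes>\<^sub>M borel)" "sets q2 = sets (borel \<Otimes>\<^sub>M borel)"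
  "sets g = sets borel"
  using couplingsD(1)[OF q1] couplingsD(1)[OF q2] g(2) by auto

lemma sets_glue: "sets (glue j g q1 q2) = sets ((borel \<Otimes>\<^sub>M borel) \<Otimes>\<^sub>M (borel \<Otimes>\<^sub>M borel))"
  unfolding glue_def sets_density by (rule sets_pair_measure_cong) (auto simp: q12_sets)

text \<open>On a cell of mass 0 the weight in \<open>glue\<close> is \<infinity> and its product
  with the mass is 0, so the normalisation fails there. There are countably many cells, hence the
  null ones are jointly negligible.\<close>

lemma AE_cell_pos: "AE y in g. emeasure g (j -` {j y}) * inverse (emeasure g (j -` {j y})) = 1"
proof -
  have vim: "j -` {n} \<in> sets g" for n
    using measurable_sets[OF j, of "{n}"] g(2) by simp
  have "AE y in g. \<forall>n. emeasure g (j -` {n}) = 0 \<longrightarrow> j y \<noteq> n"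
    unfolding AE_all_countable
  proof
    fix n
    show "AE y in g. emeasure g (j -` {n}) = 0 \<longrightarrow> j y \<noteq> n"
    proof (cases "emeasure g (j -` {n}) = 0")
      case True
      then have "j -` {n} \<in> null_sets g" using vim by auto
      then have "AE y in g. y \<notin> j -` {n}" by (rule AE_not_in)
      then show ?thesis by eventually_elim auto
    qed auto
  qed
  then show ?thesis
  proof eventually_elim
    case (elim y)
    then have "emeasure g (j -` {j y}) \<noteq> 0" by blast
    then show ?case
      using g.emeasure_finite[of "j -` {j y}"]
      by (metis ennreal_divide_self divide_ennreal_def less_top top.not_eq_extremum)
  qed
qed

lemma glue_density_measurable [measurable]:
  "(\<lambda>z. if j (snd (fst z)) = j (fst (snd z)) then inverse (emeasure g (j -` {j (snd (fst z))})) else 0)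
     \<in> borel_measurable (q1 \<Otimes>\<^sub>M q2)"
proof -
  define w where "w n = inverse (emeasure g (j -` {n}))" for n
  have [measurable]: "w \<in> measurable (count_space UNIV) borel" by simp
  have a: "(\<lambda>z. snd (fst z)) \<in> measurable (q1 \<Otimes>\<^sub>M q2) borel"
    and b: "(\<lambda>z. fst (snd z)) \<in> measurable (q1 \<Otimes>\<^sub>M q2) borel" by measurable
  have [measurable]: "(\<lambda>z. real (j (snd (fst z)))) \<in> borel_measurable (q1 \<Otimes>\<^sub>M q2)"
    by (rule measurable_compose[OF measurable_compose[OF a j]]) simp
  have [measurable]: "(\<lambda>z. real (j (fst (snd z)))) \<in> borel_measurable (q1 \<Otimes>\<^sub>M q2)"
    by (rule measurable_compose[OF measurable_compose[OF b j]]) simp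
  have [measurable]: "(\<lambda>z. w (j (snd (fst z)))) \<in> borel_measurable (q1 \<Otimes>\<^sub>M q2)"
    by (rule measurable_compose[OF measurable_compose[OF a j]]) simp
  have "(\<lambda>z. if real (j (snd (fst z))) = real (j (fst (snd z))) then w (j (snd (fst z))) else 0)
     \<in> borel_measurable (q1 \<Otimes>\<^sub>M q2)" by measurable
  then have "(\<lambda>z. if j (snd (fst z)) = j (fst (snd z)) then w (j (snd (fst z))) else 0)
     \<in> borel_measurable (q1 \<Otimes>\<^sub>M q2)" by simp
  then show ?thesis unfolding w_def .
qed

lemma cell_mass_snd: "(\<integral>\<^sup>+ r. (if n = j (fst r) then c else 0) \<partial>q2) = c * emeasure g (j -` {n})"
proof -
  have vim: "j -` {n} \<in> sets borel"
    using measurable_sets[OF j, of "{n}"] by simp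
  have "(\<integral>\<^sup>+ r. (if n = j (fst r) then c else 0) \<partial>q2) = (\<integral>\<^sup>+ y. (if n = j y then c else 0) \<partial>g)"
    by (rule nn_integral_coupling_fst[OF q2]) measurable
  also have "\<dots> = (\<integral>\<^sup>+ y. c * indicator (j -` {n}) y \<partial>g)"
    by (rule nn_integral_cong) (auto simp: indicator_def)
  also have "\<dots> = c * emeasure g (j -` {n})"
    using vim g(2) by (simp add: nn_integral_cmult_indicator)
  finally show ?thesis .
qed

lemma cell_mass_fst: "(\<integral>\<^sup>+ p. (if j (snd p) = n then c else 0) \<partial>q1) = c * emeasure g (j -` {n})"
proof -
  have vim: "j -` {n} \<in> sets borel"
    using measurable_sets[OF j, of "{n}"] by simp
  have "(\<integral>\<^sup>+ r. (if j (snd r) = n then c else 0) \<partial>q1) = (\<integral>\<^sup>+ y. (if j y = n then c else 0) \<partial>g)"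
    by (rule nn_integral_coupling_snd[OF q1]) measurable
  also have "\<dots> = (\<integral>\<^sup>+ y. c * indicator (j -` {n}) y \<partial>g)"
    by (rule nn_integral_cong) (auto simp: indicator_def)
  also have "\<dots> = c * emeasure g (j -` {n})"
    using vim g(2) by (simp add: nn_integral_cmult_indicator)
  finally show ?thesis .
qed

text \<open>For a fixed first pair, integrating the weight over \<open>q2\<close> gives the
  \<open>g\<close>-mass of a cell times its inverse, because the first marginal of \<open>q2\<close>
  is \<open>g\<close>. So the gluing keeps \<open>q1\<close> as its first marginal, and by symmetry
  \<open>q2\<close> as its second.\<close>

lemma nn_integral_glue_fst:
  assumes f [measurable]: "f \<in> borel_measurable (borel \<Otimes>\<^sub>M borel)"
  shows "(\<integral>\<^sup>+ z. f (fst z) \<partial>glue j g q1 q2) = (\<integral>\<^sup>+ p. f p \<partial>q1)"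
proof -
  let ?m = "\<lambda>n. emeasure g (j -` {n})"
  let ?w = "\<lambda>z. if j (snd (fst z)) = j (fst (snd z)) then inverse (?m (j (snd (fst z)))) else 0"
  have "(\<integral>\<^sup>+ z. f (fst z) \<partial>glue j g q1 q2) = (\<integral>\<^sup>+ z. ?w z * f (fst z) \<partial>(q1 \<Otimes>\<^sub>M q2))"
    unfolding glue_def by (rule nn_integral_density) measurable
  also have "\<dots> = (\<integral>\<^sup>+ p. \<integral>\<^sup>+ r. ?w (p, r) * f (fst (p, r)) \<partial>q2 \<partial>q1)"
    by (rule q2.nn_integral_fst[symmetric]) measurable
  also have "\<dots> = (\<integral>\<^sup>+ p. f p \<partial>q1)"
  proof (rule nn_integral_cong_AE)
    have m: "Measurable.pred borel (\<lambda>y. ?m (j y) * inverse (?m (j y)) = 1)"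
      using measurable_compose[OF j, of "\<lambda>n. ?m n * inverse (?m n) = 1" "count_space UNIV"] by simp
    have "AE p in q1. ?m (j (snd p)) * inverse (?m (j (snd p))) = 1"
      using AE_coupling_snd[OF q1 m] AE_cell_pos by simp
    then show "AE p in q1. (\<integral>\<^sup>+ r. ?w (p, r) * f (fst (p, r)) \<partial>q2) = f p"
    proof eventually_elim
      case (elim p)
      have "(\<integral>\<^sup>+ r. ?w (p, r) * f (fst (p, r)) \<partial>q2)
          = (\<integral>\<^sup>+ r. (if j (snd p) = j (fst r) then inverse (?m (j (snd p))) * f p else 0) \<partial>q2)"
        by (rule nn_integral_cong) auto
      also have "\<dots> = f p"
        unfolding cell_mass_snd using elim by (simp add: mult_ac)
      finally show ?case .
    qed
  qed
  finally show ?thesis .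
qed

lemma nn_integral_glue_snd:
  assumes f [measurable]: "f \<in> borel_measurable (borel \<Otimes>\<^sub>M borel)"
  shows "(\<integral>\<^sup>+ z. f (snd z) \<partial>glue j g q1 q2) = (\<integral>\<^sup>+ p. f p \<partial>q2)"
proof -
  let ?m = "\<lambda>n. emeasure g (j -` {n})"
  let ?w = "\<lambda>z. if j (snd (fst z)) = j (fst (snd z)) then inverse (?m (j (snd (fst z)))) else 0"
  have "(\<integral>\<^sup>+ z. f (snd z) \<partial>glue j g q1 q2) = (\<integral>\<^sup>+ z. ?w z * f (snd z) \<partial>(q1 \<Otimes>\<^sub>M q2))"
    unfolding glue_def by (rule nn_integral_density) measurable
  also have "\<dots> = (\<integral>\<^sup>+ r. \<integral>\<^sup>+ p. ?w (p, r) * f (snd (p, r)) \<partial>q1 \<partial>q2)"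
    by (subst nn_integral_snd[symmetric]) (auto intro!: borel_measurable_times_ennreal glue_density_measurable)
  also have "\<dots> = (\<integral>\<^sup>+ p. f p \<partial>q2)"
  proof (rule nn_integral_cong_AE)
    have m: "Measurable.pred borel (\<lambda>y. ?m (j y) * inverse (?m (j y)) = 1)"
      using measurable_compose[OF j, of "\<lambda>n. ?m n * inverse (?m n) = 1" "count_space UNIV"] by simp
    have "AE p in q2. ?m (j (fst p)) * inverse (?m (j (fst p))) = 1"
      using AE_coupling_fst[OF q2 m] AE_cell_pos by simp
    then show "AE r in q2. (\<integral>\<^sup>+ p. ?w (p, r) * f (snd (p, r)) \<partial>q1) = f r"
    proof eventually_elim
      case (elim r)
      have "(\<integral>\<^sup>+ p. ?w (p, r) * f (snd (p, r)) \<partial>q1)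
          = (\<integral>\<^sup>+ p. (if j (snd p) = j (fst r) then inverse (?m (j (fst r))) * f r else 0) \<partial>q1)"
        by (rule nn_integral_cong) auto
      also have "\<dots> = f r"
        unfolding cell_mass_fst using elim by (simp add: mult_ac)
      finally show ?case .
    qed
  qed
  finally show ?thesis .
qed

lemma AE_glue_fst:
  assumes P: "Measurable.pred (borel \<Otimes>\<^sub>M borel) P" and "AE p in q1. P p"
  shows "AE z in glue j g q1 q2. P (fst z)"
proof -
  note [measurable] = P
  note [measurable_cong] = sets_glue
  have "(\<integral>\<^sup>+ z. indicator {p. \<not> P p} (fst z) \<partial>glue j g q1 q2) = (\<integral>\<^sup>+ p. indicator {p. \<not> P p} p \<partial>q1)"
    by (rule nn_integral_glue_fst) measurable
  also have "\<dots> = 0"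
    using assms(2) by (subst nn_integral_0_iff_AE) (auto elim: eventually_mono)
  finally have "AE z in glue j g q1 q2. indicator {p. \<not> P p} (fst z) = (0::ennreal)"
    by (subst (asm) nn_integral_0_iff_AE) auto
  then show ?thesis by eventually_elim (auto simp: indicator_def split: if_splits)
qed

lemma AE_glue_snd:
  assumes P: "Measurable.pred (borel \<Otimes>\<^sub>M borel) P" and "AE p in q2. P p"
  shows "AE z in glue j g q1 q2. P (snd z)"
proof -
  note [measurable] = P
  note [measurable_cong] = sets_glue
  have "(\<integral>\<^sup>+ z. indicator {p. \<not> P p} (snd z) \<partial>glue j g q1 q2) = (\<integral>\<^sup>+ p. indicator {p. \<not> P p} p \<partial>q2)"
    by (rule nn_integral_glue_snd) measurable
  also have "\<dots> = 0"
    using assms(2) by (subst nn_integral_0_iff_AE) (auto elim: eventually_mono)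
  finally have "AE z in glue j g q1 q2. indicator {p. \<not> P p} (snd z) = (0::ennreal)"
    by (subst (asm) nn_integral_0_iff_AE) auto
  then show ?thesis by eventually_elim (auto simp: indicator_def split: if_splits)
qed

lemma AE_glue_same_cell: "AE z in glue j g q1 q2. j (snd (fst z)) = j (fst (snd z))"
  unfolding glue_def by (subst AE_density[OF glue_density_measurable]) (auto intro!: AE_I2)

lemma glue_outer_coupling:
  "distr (glue j g q1 q2) (borel \<Otimes>\<^sub>M borel) (\<lambda>z. (fst (fst z), snd (snd z))) \<in> couplings \<nu>0 \<nu>1"
proof -
  note [measurable_cong] = sets_glue
  have s0: "sets \<nu>0 = sets borel" using couplingsD(2)[OF q1] by (metis sets_distr)
  have s1: "sets \<nu>1 = sets borel" using couplingsD(3)[OF q2] by (metis sets_distr)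
  have 0: "distr (glue j g q1 q2) borel (\<lambda>z. fst (fst z)) = \<nu>0"
  proof (rule measure_eqI)
    fix A assume "A \<in> sets (distr (glue j g q1 q2) borel (\<lambda>z. fst (fst z)))"
    then have A [measurable]: "A \<in> sets borel" by simp
    have "emeasure (distr (glue j g q1 q2) borel (\<lambda>z. fst (fst z))) A
        = (\<integral>\<^sup>+ x. indicator A x \<partial>distr (glue j g q1 q2) borel (\<lambda>z. fst (fst z)))" by simp
    also have "\<dots> = (\<integral>\<^sup>+ z. indicator A (fst (fst z)) \<partial>glue j g q1 q2)"
      by (rule nn_integral_distr) measurable
    also have "\<dots> = (\<integral>\<^sup>+ p. indicator A (fst p) \<partial>q1)"
      by (rule nn_integral_glue_fst) measurable
    also have "\<dots> = (\<integral>\<^sup>+ x. indicator A x \<partial>\<nu>0)" by (rule nn_integral_coupling_fst[OF q1]) measurable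
    finally show "emeasure (distr (glue j g q1 q2) borel (\<lambda>z. fst (fst z))) A = emeasure \<nu>0 A"
      using A s0 by simp
  qed (simp add: s0)
  have 1: "distr (glue j g q1 q2) borel (\<lambda>z. snd (snd z)) = \<nu>1"
  proof (rule measure_eqI)
    fix A assume "A \<in> sets (distr (glue j g q1 q2) borel (\<lambda>z. snd (snd z)))"
    then have A [measurable]: "A \<in> sets borel" by simp
    have "emeasure (distr (glue j g q1 q2) borel (\<lambda>z. snd (snd z))) A
        = (\<integral>\<^sup>+ x. indicator A x \<partial>distr (glue j g q1 q2) borel (\<lambda>z. snd (snd z)))" by simp
    also have "\<dots> = (\<integral>\<^sup>+ z. indicator A (snd (snd z)) \<partial>glue j g q1 q2)"
      by (rule nn_integral_distr) measurable
    also have "\<dots> = (\<integral>\<^sup>+ p. indicator A (snd p) \<partial>q2)"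
      by (rule nn_integral_glue_snd) measurable
    also have "\<dots> = (\<integral>\<^sup>+ x. indicator A x \<partial>\<nu>1)" by (rule nn_integral_coupling_snd[OF q2]) measurable
    finally show "emeasure (distr (glue j g q1 q2) borel (\<lambda>z. snd (snd z))) A = emeasure \<nu>1 A"
      using A s1 by simp
  qed (simp add: s1)
  show ?thesis
    unfolding couplings_def using 0 1 by (simp add: distr_distr comp_def)
qed

end

section \<open>Wasserstein distance and the support of intermediate measures\<close>

lemma W2_le_transport_cost:
  assumes "q \<in> couplings \<nu>0 \<nu>1"
  shows "ennreal ((W2 \<nu>0 \<nu>1)\<^sup>2) \<le> transport_cost q"
proof -
  let ?I = "INF q \<in> couplings \<nu>0 \<nu>1. transport_cost q"
  have "ennreal ((W2 \<nu>0 \<nu>1)\<^sup>2) = ennreal (enn2real ?I)" by (simp add: W2_def)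
  also have "\<dots> \<le> ?I" by (cases ?I) auto
  also have "\<dots> \<le> transport_cost q" using assms by (rule INF_lower)
  finally show ?thesis .
qed

lemma pair_measure_coupling:
  assumes "\<nu>0 \<in> P2" "\<nu>1 \<in> P2"
  shows "\<nu>0 \<Otimes>\<^sub>M \<nu>1 \<in> couplings \<nu>0 \<nu>1"
proof -
  have s [measurable_cong]: "sets \<nu>0 = sets borel" "sets \<nu>1 = sets borel" and "prob_space \<nu>0" "prob_space \<nu>1"
    using assms by (auto simp: P2_def)
  interpret a: prob_space \<nu>0 by fact
  interpret b: prob_space \<nu>1 by fact
  interpret pair_prob_space \<nu>0 \<nu>1 ..
  have "distr (\<nu>0 \<Otimes>\<^sub>M \<nu>1) borel fst = distr (\<nu>0 \<Otimes>\<^sub>M \<nu>1) \<nu>0 fst"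
    by (rule distr_cong) (auto simp: s)
  also have "\<dots> = \<nu>0" by (rule b.distr_pair_fst)
  finally have 0: "distr (\<nu>0 \<Otimes>\<^sub>M \<nu>1) borel fst = \<nu>0" .
  have [measurable]: "snd \<in> borel_measurable (\<nu>0 \<Otimes>\<^sub>M \<nu>1)"
    using measurable_snd[of \<nu>0 \<nu>1] measurable_cong_sets[OF refl s(2)] by blast
  have "distr (\<nu>0 \<Otimes>\<^sub>M \<nu>1) borel snd = \<nu>1"
  proof (rule measure_eqI)
    fix A assume "A \<in> sets (distr (\<nu>0 \<Otimes>\<^sub>M \<nu>1) borel snd)"
    then have A [measurable]: "A \<in> sets borel" by simp
    have "emeasure (distr (\<nu>0 \<Otimes>\<^sub>M \<nu>1) borel snd) A = emeasure (\<nu>0 \<Otimes>\<^sub>M \<nu>1) (UNIV \<times> A)"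
      using s[THEN sets_eq_imp_space_eq]
      by (subst emeasure_distr) (auto intro!: arg_cong[where f="emeasure _"] simp: space_pair_measure)
    also have "\<dots> = emeasure \<nu>0 UNIV * emeasure \<nu>1 A"
      using s by (intro b.emeasure_pair_measure_Times) auto
    also have "\<dots> = emeasure \<nu>1 A" using a.emeasure_space_1 s[THEN sets_eq_imp_space_eq] by simp
    finally show "emeasure (distr (\<nu>0 \<Otimes>\<^sub>M \<nu>1) borel snd) A = emeasure \<nu>1 A" .
  qed (simp add: s)
  moreover have "sets (\<nu>0 \<Otimes>\<^sub>M \<nu>1) = sets (borel \<Otimes>\<^sub>M borel)"
    by (rule sets_pair_measure_cong) (auto simp: s)
  ultimately show ?thesis using 0 by (simp add: couplings_def)
qed

text \<open>Guards the use of \<open>enn2real\<close> in \<open>W2\<close>, which would turn an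
  infinite infimum into 0.\<close>

lemma transport_cost_finite:
  assumes P: "\<nu>0 \<in> P2" "\<nu>1 \<in> P2" and q: "q \<in> couplings \<nu>0 \<nu>1"
  shows "transport_cost q < \<infinity>"
proof -
  obtain a b where a: "(\<integral>\<^sup>+ x. ennreal ((dist x a)\<^sup>2) \<partial>\<nu>0) < \<infinity>" and b: "(\<integral>\<^sup>+ x. ennreal ((dist x b)\<^sup>2) \<partial>\<nu>1) < \<infinity>"
    using P by (auto simp: P2_def)
  have [measurable_cong]: "sets q = sets (borel \<Otimes>\<^sub>M borel)" using couplingsD(1)[OF q] .
  have "(\<lambda>z. ennreal ((dist (fst z) a)\<^sup>2)) \<in> borel_measurable (borel \<Otimes>\<^sub>M borel)"
    "(\<lambda>z. ennreal ((dist (snd z) b)\<^sup>2)) \<in> borel_measurable (borel \<Otimes>\<^sub>M borel)" by measurable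
  then have m [measurable]: "(\<lambda>z. ennreal ((dist (fst z) a)\<^sup>2)) \<in> borel_measurable q"
    "(\<lambda>z. ennreal ((dist (snd z) b)\<^sup>2)) \<in> borel_measurable q"
    unfolding measurable_cong_sets[OF couplingsD(1)[OF q] refl] by auto
  interpret prob_space q using prob_space_coupling[OF q] P by (auto simp: P2_def)
  define c where "c = ennreal 3"
  have "transport_cost q \<le> (\<integral>\<^sup>+ z. ennreal 3 * ennreal ((dist (fst z) a)\<^sup>2) + ennreal 3 * ennreal ((dist (snd z) b)\<^sup>2)
        + ennreal (3 * (dist a b)\<^sup>2) \<partial>q)"
    unfolding transport_cost_def
  proof (rule nn_integral_mono)
    fix z :: "'a \<times> 'a"
    let ?x = "dist (fst z) a" and ?y = "dist (snd z) b" and ?d = "dist a b"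
    have "dist (fst z) (snd z) \<le> ?x + ?y + ?d"
      using dist_triangle[of "fst z" "snd z" a] dist_triangle[of a "snd z" b] by (simp add: dist_commute)
    then have "(dist (fst z) (snd z))\<^sup>2 \<le> (?x + ?y + ?d)\<^sup>2" by (intro power_mono) auto
    also have "\<dots> \<le> 3 * ?x\<^sup>2 + 3 * ?y\<^sup>2 + 3 * ?d\<^sup>2"
      using sum_squares_ge_zero[of "?x - ?y" "?y - ?d"] zero_le_power2[of "?x - ?d"]
      by (simp add: power2_eq_square algebra_simps)
    finally show "ennreal ((dist (fst z) (snd z))\<^sup>2) \<le> ennreal 3 * ennreal (?x\<^sup>2) + ennreal 3 * ennreal (?y\<^sup>2) + ennreal (3 * ?d\<^sup>2)"
      using ennreal_leI by (fastforce simp: ennreal_mult ennreal_plus)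
  qed
  also have "\<dots> = ennreal 3 * (\<integral>\<^sup>+ x. ennreal ((dist x a)\<^sup>2) \<partial>\<nu>0) + ennreal 3 * (\<integral>\<^sup>+ x. ennreal ((dist x b)\<^sup>2) \<partial>\<nu>1)
        + ennreal (3 * (dist a b)\<^sup>2)"
    unfolding c_def[symmetric] using nn_integral_coupling_fst[OF q, of "\<lambda>x. ennreal ((dist x a)\<^sup>2)"]
      nn_integral_coupling_snd[OF q, of "\<lambda>x. ennreal ((dist x b)\<^sup>2)"]
    by (simp add: nn_integral_add nn_integral_cmult[OF m(1)] nn_integral_cmult[OF m(2)] emeasure_space_1)
  also have "\<dots> < \<infinity>" using a b by (simp add: ennreal_mult_less_top)
  finally show ?thesis .
qed

lemma W2_approx_coupling:
  assumes P: "\<nu>0 \<in> P2" "\<nu>1 \<in> P2" and "\<eta> > 0"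
  shows "\<exists>q\<in>couplings \<nu>0 \<nu>1. transport_cost q \<le> ennreal ((W2 \<nu>0 \<nu>1)\<^sup>2 + \<eta>)"
proof -
  let ?I = "INF q \<in> couplings \<nu>0 \<nu>1. transport_cost q"
  have "?I \<le> transport_cost (\<nu>0 \<Otimes>\<^sub>M \<nu>1)" by (rule INF_lower[OF pair_measure_coupling[OF P]])
  also have "\<dots> < \<infinity>" by (rule transport_cost_finite[OF P pair_measure_coupling[OF P]])
  finally have fin: "?I < top" by simp
  then have "?I = ennreal ((W2 \<nu>0 \<nu>1)\<^sup>2)" by (simp add: W2_def)
  also have "\<dots> < ennreal ((W2 \<nu>0 \<nu>1)\<^sup>2 + \<eta>)" using \<open>\<eta> > 0\<close> by (intro ennreal_lessI) (auto intro: add_nonneg_pos)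
  finally show ?thesis unfolding INF_less_iff by (auto intro: less_imp_le)
qed

text \<open>Quantitative strict convexity of the squared distance. With s = a + b, the sum a^2/t +
  b^2/(1-t) exceeds s^2 by the square of b - (1-t) s over t (1-t). If b is too large, then either s
  is at least D + \<rho>/2 and s^2 beats c^2 by D \<rho>, or s is smaller and b differs from (1-t) s
  by at least (1-t) \<rho>/2. The minimum collects both gains; \<delta> is the error made at the
  glued midpoint.\<close>

lemma interpolation_cost_ineq:
  fixes a b c t D \<delta> \<rho> :: real
  assumes "0 \<le> a" "0 \<le> b" "0 \<le> c" "c \<le> a + b + \<delta>" "c \<le> D" "0 < t" "t < 1" "0 \<le> \<delta>" "0 < \<rho>"
  shows "c\<^sup>2 + (if b > (1 - t) * (D + \<rho>) then min (D * \<rho>) ((1 - t) * \<rho>\<^sup>2 / (4 * t)) else 0)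
     \<le> a\<^sup>2 / t + b\<^sup>2 / (1 - t) + 2 * D * \<delta>"
proof -
  define s where "s = a + b"
  have id: "a\<^sup>2 / t + b\<^sup>2 / (1 - t) = s\<^sup>2 + (b - (1 - t) * s)\<^sup>2 / (t * (1 - t))"
    using assms unfolding s_def by (simp add: field_simps power2_eq_square)
  have cs: "c\<^sup>2 \<le> s\<^sup>2 + 2 * D * \<delta>"
  proof (cases "c \<le> s")
    case True
    then have "c\<^sup>2 \<le> s\<^sup>2" using assms by (intro power_mono) auto
    then show ?thesis using assms by (smt (verit) mult_nonneg_nonneg)
  next
    case False
    have "c\<^sup>2 - s\<^sup>2 = (c - s) * (c + s)" by (simp add: power2_eq_square algebra_simps)
    also have "\<dots> \<le> \<delta> * (2 * D)" using False assms by (intro mult_mono) (auto simp: s_def)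
    finally show ?thesis by (simp add: mult_ac)
  qed
  have nn: "0 \<le> (b - (1 - t) * s)\<^sup>2 / (t * (1 - t))" using assms by simp
  show ?thesis
  proof (cases "b > (1 - t) * (D + \<rho>)")
    case False
    then show ?thesis using id cs nn by simp
  next
    case bad: True
    show ?thesis
    proof (cases "s \<ge> D + \<rho> / 2")
      case True
      have "D\<^sup>2 + D * \<rho> \<le> (D + \<rho> / 2)\<^sup>2" by (simp add: power2_eq_square algebra_simps)
      also have "\<dots> \<le> s\<^sup>2" using True assms by (intro power_mono) auto
      finally have "D\<^sup>2 + D * \<rho> \<le> s\<^sup>2" .
      moreover have "c\<^sup>2 \<le> D\<^sup>2" using assms by (intro power_mono) auto
      moreover have "0 \<le> 2 * D * \<delta>" using assms by simp
      ultimately show ?thesis using id nn bad by auto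
    next
      case s: False
      have "(1 - t) * s \<le> (1 - t) * (D + \<rho> / 2)" using s assms by (intro mult_left_mono) auto
      moreover have "(1 - t) * (D + \<rho> / 2) = (1 - t) * D + (1 - t) * (\<rho> / 2)"
        "(1 - t) * (D + \<rho>) = (1 - t) * D + 2 * ((1 - t) * (\<rho> / 2))" by (simp_all add: field_simps)
      ultimately have "(1 - t) * (\<rho> / 2) \<le> b - (1 - t) * s" using bad by linarith
      then have "((1 - t) * (\<rho> / 2))\<^sup>2 \<le> (b - (1 - t) * s)\<^sup>2" using assms by (intro power_mono) auto
      then have "((1 - t) * (\<rho> / 2))\<^sup>2 / (t * (1 - t)) \<le> (b - (1 - t) * s)\<^sup>2 / (t * (1 - t))"
        using assms by (intro divide_right_mono) auto
      also have "((1 - t) * (\<rho> / 2))\<^sup>2 / (t * (1 - t)) = (1 - t) * \<rho>\<^sup>2 / (4 * t)"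
        using assms by (simp add: field_simps power2_eq_square)
      finally show ?thesis using id cs bad by auto
    qed
  qed
qed

text \<open>Glue nearly optimal couplings from \<open>\<nu>0\<close> to \<open>\<gamma>\<close> and
  from \<open>\<gamma>\<close> to \<open>\<nu>1\<close>. The outer points couple
  \<open>\<nu>0\<close> and \<open>\<nu>1\<close>, so their cost is at least W^2. By the two
  interpolation identities the weighted costs of the halves add up to t W^2 + (1-t) W^2 = W^2, up to
  errors. Every far away middle point costs an extra \<open>\<kappa>\<close>, so such points carry
  no mass.\<close>

lemma W2_interpolation_support:
  fixes \<nu>0 \<nu>1 \<gamma> :: "'a::polish_space measure"
  assumes P: "\<nu>0 \<in> P2" "\<nu>1 \<in> P2" "\<gamma> \<in> P2" and t: "0 < t" "t < 1"
    and W0: "W2 \<nu>0 \<gamma> = t * W2 \<nu>0 \<nu>1" and W1: "W2 \<gamma> \<nu>1 = (1 - t) * W2 \<nu>0 \<nu>1"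
    and s0: "AE x in \<nu>0. dist x x0 \<le> r" and s1: "AE z in \<nu>1. dist z x1 \<le> r"
    and D: "dist x0 x1 + 2 * r \<le> D" "D > 0" and \<rho>: "\<rho> > 0"
  shows "AE y in \<gamma>. dist y x1 \<le> (1 - t) * (D + \<rho>) + r"
proof -
  define W where "W = W2 \<nu>0 \<nu>1"
  define \<kappa> where "\<kappa> = min (D * \<rho>) ((1 - t) * \<rho>\<^sup>2 / (4 * t))"
  define L where "L = (1 - t) * (D + \<rho>)"
  define Bad where "Bad = {y. dist y x1 > L + r}"
  have \<kappa>: "\<kappa> > 0" using D \<rho> t by (simp add: \<kappa>_def)
  have pr: "prob_space \<nu>0" "prob_space \<nu>1" "prob_space \<gamma>" and
    sg [measurable_cong]: "sets \<gamma> = sets borel" using P by (auto simp: P2_def)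
  interpret \<gamma>: prob_space \<gamma> by fact
  have Badm [measurable]: "Bad \<in> sets borel" unfolding Bad_def by measurable
  \<comment> \<open>\<open>\<eta>\<close> is both the excess cost allowed to the two couplings and
    the mesh of the partition along which they are glued, so all errors are linear in it.\<close>
  have key: "\<kappa> * measure \<gamma> Bad \<le> \<eta> * (1 / t + 1 / (1 - t) + 2 * D)" if \<eta>: "\<eta> > 0" for \<eta>
  proof -
    obtain q1 where q1: "q1 \<in> couplings \<nu>0 \<gamma>" and c1: "transport_cost q1 \<le> ennreal ((t * W)\<^sup>2 + \<eta>)"
      using W2_approx_coupling[OF P(1,3) \<eta>] W0 unfolding W_def by auto
    obtain q2 where q2: "q2 \<in> couplings \<gamma> \<nu>1" and c2: "transport_cost q2 \<le> ennreal (((1 - t) * W)\<^sup>2 + \<eta>)"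
      using W2_approx_coupling[OF P(3,2) \<eta>] W1 unfolding W_def by auto
    obtain j :: "'a \<Rightarrow> nat" where j [measurable]: "j \<in> measurable borel (count_space UNIV)"
      and jd: "\<And>x y. j x = j y \<Longrightarrow> dist x y < \<eta>" by (rule ex_fine_index[OF \<eta>]) blast
    note G = q1 q2 pr(3) sg pr(1) j
    define \<pi> where "\<pi> = glue j \<gamma> q1 q2"
    have s\<pi> [measurable_cong]: "sets \<pi> = sets ((borel \<Otimes>\<^sub>M borel) \<Otimes>\<^sub>M (borel \<Otimes>\<^sub>M borel))"
      unfolding \<pi>_def by (rule sets_glue[OF G])
    have [measurable_cong]: "sets q1 = sets (borel \<Otimes>\<^sub>M borel)" "sets q2 = sets (borel \<Otimes>\<^sub>M borel)"
      using couplingsD(1)[OF q1] couplingsD(1)[OF q2] by auto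
    have [measurable]: "(\<lambda>z. (fst (fst z), snd (snd z))) \<in> measurable \<pi> (borel \<Otimes>\<^sub>M borel)"
      unfolding measurable_cong_sets[OF s\<pi> refl] by measurable
    let ?a = "\<lambda>z::('a\<times>'a)\<times>('a\<times>'a). dist (fst (fst z)) (snd (fst z))"
    let ?b = "\<lambda>z::('a\<times>'a)\<times>('a\<times>'a). dist (fst (snd z)) (snd (snd z))"
    let ?c = "\<lambda>z::('a\<times>'a)\<times>('a\<times>'a). dist (fst (fst z)) (snd (snd z))"
    have total: "(\<integral>\<^sup>+ z. 1 \<partial>\<pi>) = 1"
      unfolding \<pi>_def using nn_integral_glue_fst[OF G, of "\<lambda>_. 1"] prob_space.emeasure_space_1[OF prob_space_coupling[OF q1 pr(1)]]
      by simp
    have Wc: "ennreal (W\<^sup>2) \<le> (\<integral>\<^sup>+ z. ennreal ((?c z)\<^sup>2) \<partial>\<pi>)"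
    proof -
      have "ennreal (W\<^sup>2) \<le> transport_cost (distr \<pi> (borel \<Otimes>\<^sub>M borel) (\<lambda>z. (fst (fst z), snd (snd z))))"
        unfolding W_def \<pi>_def by (rule W2_le_transport_cost[OF glue_outer_coupling[OF G]])
      also have "\<dots> = (\<integral>\<^sup>+ z. ennreal ((?c z)\<^sup>2) \<partial>\<pi>)"
        unfolding transport_cost_def by (subst nn_integral_distr) auto
      finally show ?thesis .
    qed
    have Bg: "emeasure \<gamma> Bad = (\<integral>\<^sup>+ z. indicator Bad (fst (snd z)) \<partial>\<pi>)"
    proof -
      have "emeasure \<gamma> Bad = (\<integral>\<^sup>+ y. indicator Bad y \<partial>\<gamma>)" using sg by simp
      also have "\<dots> = (\<integral>\<^sup>+ z. indicator Bad (fst z) \<partial>q2)" by (rule nn_integral_coupling_fst[OF q2, symmetric]) measurable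
      also have "\<dots> = (\<integral>\<^sup>+ z. indicator Bad (fst (snd z)) \<partial>\<pi>)"
        unfolding \<pi>_def by (rule nn_integral_glue_snd[OF G, symmetric]) measurable
      finally show ?thesis .
    qed
    have "AE z in \<pi>. dist (fst (fst z)) x0 \<le> r"
      unfolding \<pi>_def using AE_coupling_fst[OF q1, of "\<lambda>x. dist x x0 \<le> r"] s0
      by (intro AE_glue_fst[OF G]) auto
    moreover have "AE z in \<pi>. dist (snd (snd z)) x1 \<le> r"
      unfolding \<pi>_def using AE_coupling_snd[OF q2, of "\<lambda>x. dist x x1 \<le> r"] s1
      by (intro AE_glue_snd[OF G]) auto
    moreover have "AE z in \<pi>. j (snd (fst z)) = j (fst (snd z))"
      unfolding \<pi>_def by (rule AE_glue_same_cell[OF G])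
    ultimately have pw: "AE z in \<pi>. ennreal ((?c z)\<^sup>2) + ennreal \<kappa> * indicator Bad (fst (snd z))
        \<le> ennreal (1 / t) * ennreal ((?a z)\<^sup>2) + ennreal (1 / (1 - t)) * ennreal ((?b z)\<^sup>2) + ennreal (2 * D * \<eta>)"
    proof eventually_elim
      case (elim z)
      have d: "dist (snd (fst z)) (fst (snd z)) < \<eta>" using elim(3) jd by blast
      have c1: "?c z \<le> ?a z + ?b z + \<eta>"
        using d dist_triangle[of "fst (fst z)" "snd (snd z)" "snd (fst z)"]
          dist_triangle[of "snd (fst z)" "snd (snd z)" "fst (snd z)"] by simp
      have c2: "?c z \<le> D"
        using elim(1,2) D dist_triangle[of "fst (fst z)" "snd (snd z)" x0] dist_triangle[of x0 "snd (snd z)" x1]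
        by (simp add: dist_commute)
      have bad: "?b z > L" if "fst (snd z) \<in> Bad"
        using that elim(2) dist_triangle[of "fst (snd z)" x1 "snd (snd z)"] unfolding Bad_def by simp
      have "(?c z)\<^sup>2 + (if ?b z > L then \<kappa> else 0) \<le> (?a z)\<^sup>2 / t + (?b z)\<^sup>2 / (1 - t) + 2 * D * \<eta>"
        unfolding L_def \<kappa>_def by (rule interpolation_cost_ineq) (use c1 c2 t \<eta> \<rho> in auto)
      then have "(?c z)\<^sup>2 + \<kappa> * indicator Bad (fst (snd z)) \<le> (1 / t) * (?a z)\<^sup>2 + (1 / (1 - t)) * (?b z)\<^sup>2 + 2 * D * \<eta>"
        using bad \<kappa> by (auto simp: indicator_def split: if_splits)
      then have "ennreal ((?c z)\<^sup>2 + \<kappa> * indicator Bad (fst (snd z)))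
         \<le> ennreal ((1 / t) * (?a z)\<^sup>2 + (1 / (1 - t)) * (?b z)\<^sup>2 + 2 * D * \<eta>)" by (rule ennreal_leI)
      then show ?case
        using t \<kappa> D \<eta> by (simp add: ennreal_plus ennreal_mult ennreal_indicator del: times_divide_eq_left mult_1)
    qed
    have "ennreal (W\<^sup>2) + ennreal \<kappa> * emeasure \<gamma> Bad
        \<le> (\<integral>\<^sup>+ z. ennreal ((?c z)\<^sup>2) + ennreal \<kappa> * indicator Bad (fst (snd z)) \<partial>\<pi>)"
    proof -
      have "(\<lambda>z. ennreal ((?c z)\<^sup>2)) \<in> borel_measurable \<pi>" "(\<lambda>z. indicator Bad (fst (snd z)) :: ennreal) \<in> borel_measurable \<pi>"
        unfolding measurable_cong_sets[OF s\<pi> refl] by measurable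
      then show ?thesis using Wc by (simp add: nn_integral_add nn_integral_cmult Bg add_mono)
    qed
    also have "\<dots> \<le> (\<integral>\<^sup>+ z. ennreal (1 / t) * ennreal ((?a z)\<^sup>2) + ennreal (1 / (1 - t)) * ennreal ((?b z)\<^sup>2) + ennreal (2 * D * \<eta>) \<partial>\<pi>)"
      by (rule nn_integral_mono_AE[OF pw])
    also have "\<dots> = ennreal (1 / t) * (\<integral>\<^sup>+ z. ennreal ((?a z)\<^sup>2) \<partial>\<pi>) + ennreal (1 / (1 - t)) * (\<integral>\<^sup>+ z. ennreal ((?b z)\<^sup>2) \<partial>\<pi>)
         + ennreal (2 * D * \<eta>)"
    proof -
      have m: "(\<lambda>z. ennreal ((?a z)\<^sup>2)) \<in> borel_measurable \<pi>" "(\<lambda>z. ennreal ((?b z)\<^sup>2)) \<in> borel_measurable \<pi>"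
        unfolding measurable_cong_sets[OF s\<pi> refl] by measurable
      show ?thesis using total m by (simp add: nn_integral_add nn_integral_cmult[OF m(1)] nn_integral_cmult[OF m(2)])
    qed
    also have "(\<integral>\<^sup>+ z. ennreal ((?a z)\<^sup>2) \<partial>\<pi>) = transport_cost q1"
      unfolding \<pi>_def transport_cost_def
      by (rule nn_integral_glue_fst[OF G, of "\<lambda>p. ennreal ((dist (fst p) (snd p))\<^sup>2)"]) measurable
    also have "(\<integral>\<^sup>+ z. ennreal ((?b z)\<^sup>2) \<partial>\<pi>) = transport_cost q2"
      unfolding \<pi>_def transport_cost_def
      by (rule nn_integral_glue_snd[OF G, of "\<lambda>p. ennreal ((dist (fst p) (snd p))\<^sup>2)"]) measurable
    also have "ennreal (1 / t) * transport_cost q1 + ennreal (1 / (1 - t)) * transport_cost q2 + ennreal (2 * D * \<eta>)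
      \<le> ennreal (1 / t) * ennreal ((t * W)\<^sup>2 + \<eta>) + ennreal (1 / (1 - t)) * ennreal (((1 - t) * W)\<^sup>2 + \<eta>) + ennreal (2 * D * \<eta>)"
      using c1 c2 by (intro add_mono mult_left_mono) auto
    also have "\<dots> = ennreal ((1 / t) * ((t * W)\<^sup>2 + \<eta>) + (1 / (1 - t)) * (((1 - t) * W)\<^sup>2 + \<eta>) + 2 * D * \<eta>)"
    proof -
      have nn: "0 \<le> (t * W)\<^sup>2 + \<eta>" "0 \<le> ((1 - t) * W)\<^sup>2 + \<eta>" "0 \<le> 1 / t" "0 \<le> 1 / (1 - t)" "0 \<le> 2 * D * \<eta>"
        using t \<eta> D by (auto intro: add_nonneg_nonneg)
      show ?thesis
        using nn by (simp only: ennreal_plus ennreal_mult mult_nonneg_nonneg add_nonneg_nonneg)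
    qed
    also have "(1 / t) * ((t * W)\<^sup>2 + \<eta>) + (1 / (1 - t)) * (((1 - t) * W)\<^sup>2 + \<eta>) + 2 * D * \<eta>
       = W\<^sup>2 + \<eta> * (1 / t + 1 / (1 - t) + 2 * D)"
    proof -
      have "(1 / t) * (t * W)\<^sup>2 = t * W\<^sup>2" "(1 / (1 - t)) * ((1 - t) * W)\<^sup>2 = (1 - t) * W\<^sup>2"
        using t by (simp_all add: power2_eq_square)
      then show ?thesis unfolding distrib_left by (simp add: algebra_simps)
    qed
    finally have "ennreal (W\<^sup>2 + \<kappa> * measure \<gamma> Bad) \<le> ennreal (W\<^sup>2 + \<eta> * (1 / t + 1 / (1 - t) + 2 * D))"
      using \<kappa> by (simp add: ennreal_plus ennreal_mult \<gamma>.emeasure_eq_measure)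
    then show ?thesis using t \<eta> D by (subst (asm) ennreal_le_iff) (auto intro!: add_nonneg_nonneg)
  qed
  have "\<kappa> * measure \<gamma> Bad \<le> 0"
  proof (rule field_le_epsilon)
    fix e :: real assume "e > 0"
    define S where "S = 1 / t + 1 / (1 - t) + 2 * D"
    have "S > 0" using t D unfolding S_def by (intro add_pos_pos) auto
    then show "\<kappa> * measure \<gamma> Bad \<le> 0 + e" using key[of "e / S"] \<open>e > 0\<close> unfolding S_def[symmetric] by simp
  qed
  then have "measure \<gamma> Bad = 0" using \<kappa> by (simp add: mult_le_0_iff measure_le_0_iff)
  then have "Bad \<in> null_sets \<gamma>" using sg by (auto simp: \<gamma>.emeasure_eq_measure null_sets_def)
  then have "AE y in \<gamma>. y \<notin> Bad" by (rule AE_not_in)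
  then show ?thesis by eventually_elim (auto simp: Bad_def L_def)
qed

section \<open>Properness of CD spaces\<close>

text \<open>By the mean value theorem sinh b = b cosh z for some z between 0 and b, and cosh lies
  between 1 and cosh A in the range concerned.\<close>

lemma sinh_quotient_ge:
  fixes s a A :: real
  assumes "0 < s" "0 < a" "a \<le> A"
  shows "s / cosh A \<le> sinh (s * a) / sinh a"
proof -
  have mvt: "\<exists>z>0. z < b \<and> sinh b = b * cosh z" if "0 < b" for b :: real
  proof -
    have "(sinh has_real_derivative cosh x) (at x)" for x :: real
      by (auto intro!: derivative_eq_intros)
    then show ?thesis using MVT2[of 0 b sinh cosh] that by fastforce
  qed
  obtain z where z: "0 < z" "z < a" "sinh a = a * cosh z" using mvt[OF assms(2)] by blast
  obtain y where y: "0 < y" "sinh (s * a) = s * a * cosh y" using mvt[of "s * a"] assms by auto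
  have "cosh z \<le> cosh A" using z assms by (subst cosh_real_nonneg_le_iff) auto
  then have "sinh a \<le> a * cosh A" using z assms by simp
  moreover have "s * a \<le> sinh (s * a)" using y(2) assms mult_left_mono[OF cosh_real_ge_1[of y], of "s * a"] by simp
  ultimately have "(s * a) / (a * cosh A) \<le> sinh (s * a) / sinh a"
    using assms by (intro frac_le) auto
  then show ?thesis using assms by simp
qed

lemma sin_quotient_ge:
  fixes s a :: real
  assumes "0 < s" "s < 1" "0 < a" "a < pi"
  shows "s \<le> sin (s * a) / sin a"
proof -
  have "convex_on {0..pi} (\<lambda>x::real. - sin x)"
  proof (rule f''_ge0_imp_convex)
    show "((\<lambda>x. - sin x) has_real_derivative - cos x) (at x)" for x :: real
      by (auto intro!: derivative_eq_intros)
    show "((\<lambda>x. - cos x) has_real_derivative sin x) (at x)" for x :: real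
      by (auto intro!: derivative_eq_intros)
  qed (auto intro: sin_ge_zero)
  from convex_onD[OF this, of s 0 a] have "s * sin a \<le> sin (s * a)"
    using assms by simp
  then show ?thesis using assms sin_gt_zero[of a] by (simp add: field_simps)
qed

text \<open>The bound is uniform in the distance up to \<open>D\<close> and covers every sign of
  \<open>K\<close>: concavity of the sine gives a quotient of at least \<open>s\<close>, the flat
  case is \<open>s\<close> itself, and only negative curvature costs the factor cosh. Writing the
  constant as c^(1/N) c^(1-1/N) matches the geometric mean in \<open>tau\<close>.\<close>

lemma tau_ge:
  assumes N: "N > 1" and s: "0 < s" "s < 1" and \<theta>: "0 \<le> \<theta>" "\<theta> \<le> D"
  shows "ennreal (s / cosh (D * sqrt (\<bar>K\<bar> / (N - 1)))) \<le> tau K N s \<theta>"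
proof -
  define A where "A = D * sqrt (\<bar>K\<bar> / (N - 1))"
  define c where "c = s / cosh A"
  have "cosh A \<ge> 1" by (rule cosh_real_ge_1)
  then have c: "0 < c" "c \<le> s" unfolding c_def using s by (auto simp: field_simps)
  have low: "ennreal c \<le> ennreal (s powr (1 / N) * q powr (1 - 1 / N))" if "c \<le> q" for q
  proof -
    have "c = c powr (1 / N) * c powr (1 - 1 / N)" using c by (simp add: powr_add[symmetric])
    also have "\<dots> \<le> s powr (1 / N) * q powr (1 - 1 / N)"
      using N that c by (intro mult_mono powr_mono2) auto
    finally show ?thesis by (rule ennreal_leI)
  qed
  consider "K * \<theta>\<^sup>2 \<ge> (N - 1) * pi\<^sup>2" | "K * \<theta>\<^sup>2 < (N - 1) * pi\<^sup>2" "K * \<theta>\<^sup>2 > 0"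
    | "K * \<theta>\<^sup>2 < (N - 1) * pi\<^sup>2" "K * \<theta>\<^sup>2 = 0" | "K * \<theta>\<^sup>2 < (N - 1) * pi\<^sup>2" "K * \<theta>\<^sup>2 < 0" by linarith
  then have "ennreal c \<le> tau K N s \<theta>"
  proof cases
    case 1
    then show ?thesis by (simp add: tau_def)
  next
    case 2
    have K: "K > 0" "\<theta> > 0" using 2(2) \<theta>(1)
      by (auto simp: zero_less_mult_iff order.order_iff_strict)
    have "(\<theta> * sqrt (K / (N - 1)))\<^sup>2 < pi\<^sup>2"
      using 2(1) N K by (simp add: power_mult_distrib field_simps)
    then have "\<theta> * sqrt (K / (N - 1)) < pi" by (rule power2_less_imp_less) simp
    then have "s \<le> sin (s * (\<theta> * sqrt (K / (N - 1)))) / sin (\<theta> * sqrt (K / (N - 1)))"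
      using s K N by (intro sin_quotient_ge) auto
    then show ?thesis using 2 low c by (simp add: tau_def mult.assoc)
  next
    case 3
    then show ?thesis using c by (auto simp: tau_def ennreal_leI)
  next
    case 4
    have K: "K < 0" "\<theta> > 0" using 4(2) \<theta>(1)
      by (auto simp: mult_less_0_iff order.order_iff_strict)
    have "\<theta> * sqrt (- K / (N - 1)) \<le> A"
      unfolding A_def using K \<theta> N by (intro mult_mono) (auto simp: divide_nonpos_pos)
    then have "c \<le> sinh (s * (\<theta> * sqrt (- K / (N - 1)))) / sinh (\<theta> * sqrt (- K / (N - 1)))"
      unfolding c_def using s K N by (intro sinh_quotient_ge) (auto simp: divide_neg_pos)
    then show ?thesis using 4 K low by (simp add: tau_def mult.assoc)
  qed
  then show ?thesis unfolding c_def A_def .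
qed

section \<open>Masses of balls from the entropy inequality\<close>

lemma metric_measure_space_sigma_finite:
  assumes "metric_measure_space M"
  shows "sigma_finite_measure M"
proof
  fix a :: 'a
  have s: "sets M = sets borel" and f: "\<And>x r. emeasure M (ball x r) < \<infinity>"
    using assms by (auto simp: metric_measure_space_def)
  have sp: "space M = UNIV" using sets_eq_imp_space_eq[OF s] by simp
  show "\<exists>A. countable A \<and> A \<subseteq> sets M \<and> \<Union> A = space M \<and> (\<forall>a\<in>A. emeasure M a \<noteq> \<infinity>)"
  proof (intro exI[of _ "range (\<lambda>n::nat. ball undefined (real n))"] conjI)
    show "\<Union> (range (\<lambda>n. ball undefined (real n))) = space M"
      using reals_Archimedean2 by (auto simp: sp)
    show "\<forall>a\<in>range (\<lambda>n. ball undefined (real n)). emeasure M a \<noteq> \<infinity>" using f by (metis imageE less_irrefl)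
  qed (auto simp: s)
qed

lemma uniform_measure_ball_P2_ac:
  assumes M: "metric_measure_space M" and r: "r > 0"
  shows "uniform_measure M (ball x r) \<in> P2_ac M" "AE y in uniform_measure M (ball x r). dist y x \<le> r"
proof -
  let ?\<nu> = "uniform_measure M (ball x r)"
  have s: "sets M = sets borel" and f: "emeasure M (ball x r) < \<infinity>" "emeasure M (ball x r) > 0"
    using M r by (auto simp: metric_measure_space_def)
  have b [measurable]: "ball x r \<in> sets M" by (simp add: s)
  have p: "prob_space ?\<nu>" using f by (intro prob_space_uniform_measure) auto
  show AE: "AE y in ?\<nu>. dist y x \<le> r"
    by (rule AE_uniform_measureI) (auto simp: dist_commute)
  have "(\<integral>\<^sup>+ y. ennreal ((dist y x)\<^sup>2) \<partial>?\<nu>) \<le> (\<integral>\<^sup>+ y. ennreal (r\<^sup>2) \<partial>?\<nu>)"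
    using AE by (intro nn_integral_mono_AE) (auto elim!: eventually_mono intro!: ennreal_leI power_mono)
  also have "\<dots> < \<infinity>" using prob_space.emeasure_space_1[OF p] by simp
  finally have "(\<integral>\<^sup>+ y. ennreal ((dist y x)\<^sup>2) \<partial>?\<nu>) < \<infinity>" .
  moreover have "absolutely_continuous M ?\<nu>"
    unfolding absolutely_continuous_def uniform_measure_def
  proof
    fix A assume A: "A \<in> null_sets M"
    then have "AE y in M. y \<notin> A" by (rule AE_not_in)
    then show "A \<in> null_sets (density M (\<lambda>y. indicator (ball x r) y / emeasure M (ball x r)))"
      using A by (subst null_sets_density_iff) (auto elim: eventually_mono)
  qed
  ultimately show "?\<nu> \<in> P2_ac M" using p s by (auto simp: P2_ac_def P2_def)
qed

lemma dens_uniform_measure: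
  assumes M: "metric_measure_space M" and r: "r > 0"
  shows "AE y in uniform_measure M (ball x r). dens M (uniform_measure M (ball x r)) y = 1 / measure M (ball x r)"
proof -
  let ?\<nu> = "uniform_measure M (ball x r)"
  interpret sigma_finite_measure M by (rule metric_measure_space_sigma_finite[OF M])
  have s: "sets M = sets borel" and f: "emeasure M (ball x r) < \<infinity>" "emeasure M (ball x r) > 0"
    using M r by (auto simp: metric_measure_space_def)
  have b [measurable]: "ball x r \<in> sets M" by (simp add: s)
  have e: "emeasure M (ball x r) = ennreal (measure M (ball x r))"
    using f by (intro emeasure_eq_ennreal_measure) auto
  have m: "measure M (ball x r) > 0" using f(2) e by (simp add: ennreal_less_zero_iff) 
  have "AE y in M. indicator (ball x r) y / emeasure M (ball x r) = RN_deriv M ?\<nu> y"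
    by (rule RN_deriv_unique) (simp_all add: uniform_measure_def)
  then have "AE y in M. y \<in> ball x r \<longrightarrow> dens M ?\<nu> y = 1 / measure M (ball x r)"
  proof eventually_elim
    case (elim y)
    have "1 / emeasure M (ball x r) = ennreal (1 / measure M (ball x r))"
      unfolding e using m divide_ennreal[of 1 "measure M (ball x r)"] by simp
    then show ?case unfolding dens_def elim[symmetric] by (auto simp: e)
  qed
  then show ?thesis by (intro AE_uniform_measureI) auto
qed

text \<open>Integrates the pointwise bound a^(1-1/N) \<le> u a + u^(1-N), which holds by its first
  term if a^(-1/N) \<le> u and by its second otherwise. The density has total mass 1, and the second
  term is charged only on \<open>S\<close>, where the density lives.\<close>

lemma nn_integral_dens_powr_le:
  assumes M: "metric_measure_space M" and \<gamma>: "\<gamma> \<in> P2_ac M" and S: "S \<in> sets borel" "AE y in \<gamma>. y \<in> S"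
    and N: "N > 1" and u: "u > 0"
  shows "(\<integral>\<^sup>+ x. ennreal (dens M \<gamma> x powr (1 - 1 / N)) \<partial>M) \<le> ennreal u + ennreal (u powr (1 - N)) * emeasure M S"
proof -
  interpret sigma_finite_measure M by (rule metric_measure_space_sigma_finite[OF M])
  have s: "sets M = sets borel" using M by (auto simp: metric_measure_space_def)
  have ac: "absolutely_continuous M \<gamma>" and sg: "sets \<gamma> = sets M" and p: "prob_space \<gamma>"
    using \<gamma> s by (auto simp: P2_ac_def P2_def)
  have sp: "space M = UNIV" "space \<gamma> = UNIV" using sets_eq_imp_space_eq[OF s] sets_eq_imp_space_eq[OF sg] by auto
  have Sm [measurable]: "S \<in> sets M" using S s by simp
  let ?f = "RN_deriv M \<gamma>"
  have d: "density M ?f = \<gamma>" by (rule density_RN_deriv[OF ac sg])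
  have "(\<integral>\<^sup>+ x. ?f x \<partial>M) = emeasure (density M ?f) UNIV"
    by (subst emeasure_density) (auto simp: sp(1)[symmetric] intro!: nn_integral_cong)
  then have f1: "(\<integral>\<^sup>+ x. ?f x \<partial>M) = 1" using d prob_space.emeasure_space_1[OF p] sp by simp
  have "AE y in M. 0 < ?f y \<longrightarrow> y \<in> S"
    using S(2) by (subst (asm) d[symmetric], subst (asm) AE_density) auto
  then have "AE x in M. ennreal (dens M \<gamma> x powr (1 - 1 / N)) \<le> ennreal u * ?f x + ennreal (u powr (1 - N)) * indicator S x"
  proof eventually_elim
    case (elim x)
    \<comment> \<open>\<open>enn2real\<close> sends \<infinity> to 0, so in both degenerate cases
      the left side is 0.\<close>
    consider "?f x = 0" | "?f x = \<infinity>" | a where "?f x = ennreal a" "a > 0" "x \<in> S"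
      using elim by (cases "?f x") (auto simp: ennreal_less_zero_iff less_le)
    then show ?case
    proof cases
      case 3
      have "a powr (1 - 1 / N) \<le> u * a + u powr (1 - N)"
      proof (cases "a powr (- 1 / N) \<le> u")
        case True
        have "a powr (1 - 1 / N) = a * a powr (- 1 / N)" using 3 by (simp add: powr_diff powr_minus field_simps)
        also have "\<dots> \<le> a * u" using True 3 by (intro mult_left_mono) auto
        finally show ?thesis by (smt (verit) mult.commute powr_ge_zero)
      next
        case False
        have "a powr (1 - 1 / N) = (a powr (- 1 / N)) powr (1 - N)"
        proof -
          have "(- 1 / N) * (1 - N) = 1 - 1 / N" using N by (simp add: field_simps)
          then show ?thesis unfolding powr_powr by simp
        qed
        also have "\<dots> \<le> u powr (1 - N)" using False u N by (intro powr_mono2') auto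
        also have "\<dots> \<le> u * a + u powr (1 - N)" using 3 u by simp
        finally show ?thesis .
      qed
      then have "ennreal (a powr (1 - 1 / N)) \<le> ennreal (u * a + u powr (1 - N))" by (rule ennreal_leI)
      then show ?thesis using 3 u by (simp add: dens_def ennreal_mult ennreal_plus)
    qed (use u N in \<open>auto simp: dens_def ennreal_mult_top\<close>)
  qed
  then have "(\<integral>\<^sup>+ x. ennreal (dens M \<gamma> x powr (1 - 1 / N)) \<partial>M)
     \<le> (\<integral>\<^sup>+ x. ennreal u * ?f x + ennreal (u powr (1 - N)) * indicator S x \<partial>M)" by (rule nn_integral_mono_AE)
  also have "\<dots> = ennreal u + ennreal (u powr (1 - N)) * emeasure M S"
    using f1 by (simp add: nn_integral_add nn_integral_cmult nn_integral_cmult_indicator)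
  finally show ?thesis .
qed

text \<open>At a time close to 1 the intermediate measure already sits in the small ball around
  \<open>x1\<close>, while its entropy integral is still bounded below by the contribution of the
  fixed ball around \<open>x0\<close>. A measure on a tiny set cannot have a large entropy integral,
  so the small ball has mass bounded below uniformly in \<open>x1\<close>.\<close>

lemma CD_ball_measure_lower_bound:
  fixes M :: "'a::polish_space measure"
  assumes M: "metric_measure_space M" and CD: "curvature_dimension K N M" and N: "N > 1"
    and \<epsilon>: "\<epsilon> > 0" and R: "R > 0"
  shows "\<exists>c>0. \<forall>x1. dist x0 x1 \<le> R \<longrightarrow> ennreal c \<le> emeasure M (ball x1 \<epsilon>)"
proof -
  define r where "r = \<epsilon> / 4"
  define D where "D = R + 2 * r"
  \<comment> \<open>\<open>s\<close> is the remaining time 1 - t. It is small enough that s (D + 1)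
    \<le> r, which puts the intermediate measure within 2 r < \<epsilon> of \<open>x1\<close>; the 1
    is the margin \<open>\<rho>\<close> of the support lemma.\<close>
  define s where "s = min (1 / 2) (r / (D + 1))"
  define t where "t = 1 - s"
  define c where "c = s / cosh (D * sqrt (\<bar>K\<bar> / (N - 1)))"
  define m where "m = measure M (ball x0 r)"
  define v where "v = m powr (1 / N)"
  \<comment> \<open>Half of the lower entropy bound \<open>c * v\<close>: in the upper bound the
    free term \<open>u\<close> uses up one half, and the ball must account for the other.\<close>
  define u where "u = c * v / 2"
  have r: "r > 0" using \<epsilon> by (simp add: r_def)
  have D: "D > 0" using R r by (simp add: D_def)
  have s: "0 < s" "s < 1" using r D unfolding s_def by (auto simp: min_def)
  have t: "0 < t" "t < 1" "1 - t = s" using s by (auto simp: t_def)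
  have sD: "s * (D + 1) \<le> r" using D unfolding s_def
    by (metis add_pos_pos min.cobounded2 pos_le_divide_eq zero_less_one)
  have c: "c > 0" using s cosh_real_pos by (simp add: c_def)
  have f: "emeasure M (ball x0 r) < \<infinity>" "emeasure M (ball x0 r) > 0"
    using M r by (auto simp: metric_measure_space_def)
  have sM: "sets M = sets borel" using M by (auto simp: metric_measure_space_def)
  have m: "m > 0" unfolding m_def using f by (simp add: measure_def enn2real_positive_iff)
  have v: "v > 0" using m by (simp add: v_def)
  have u: "u > 0" using c v by (simp add: u_def)
  show ?thesis
  proof (intro exI[of _ "u powr N"] conjI allI impI)
    show "u powr N > 0" using u by simp
    fix x1 assume x1: "dist x0 x1 \<le> R"
    define \<nu>0 where "\<nu>0 = uniform_measure M (ball x0 r)"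
    define \<nu>1 where "\<nu>1 = uniform_measure M (ball x1 r)"
    have ac: "\<nu>0 \<in> P2_ac M" "\<nu>1 \<in> P2_ac M" and
      near: "AE y in \<nu>0. dist y x0 \<le> r" "AE y in \<nu>1. dist y x1 \<le> r"
      unfolding \<nu>0_def \<nu>1_def using uniform_measure_ball_P2_ac[OF M r] by auto
    have "\<exists>q \<in> optimal_couplings \<nu>0 \<nu>1. \<exists>\<Gamma> :: real \<Rightarrow> 'a measure.
          (\<forall>t\<in>{0..1}. \<Gamma> t \<in> P2_ac M) \<and> \<Gamma> 0 = \<nu>0 \<and> \<Gamma> 1 = \<nu>1 \<and>
          (\<forall>s\<in>{0..1}. \<forall>t\<in>{0..1}. W2 (\<Gamma> s) (\<Gamma> t) = \<bar>s - t\<bar> * W2 \<nu>0 \<nu>1) \<and>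
          (\<forall>t\<in>{0..1}. \<forall>N'\<ge>N.
             (\<integral>\<^sup>+ x. ennreal (dens M (\<Gamma> t) x powr (1 - 1 / N')) \<partial>M) \<ge>
             (\<integral>\<^sup>+ z. tau K N' (1 - t) (dist (fst z) (snd z)) * ennreal (dens M \<nu>0 (fst z) powr (- 1 / N'))
                   + tau K N' t (dist (fst z) (snd z)) * ennreal (dens M \<nu>1 (snd z) powr (- 1 / N')) \<partial>q))"
      using CD ac unfolding curvature_dimension_def by blast
    then obtain q \<Gamma> where q: "q \<in> couplings \<nu>0 \<nu>1"
      and G: "\<forall>t\<in>{0..1}. \<Gamma> t \<in> P2_ac M" "\<Gamma> 0 = \<nu>0" "\<Gamma> 1 = \<nu>1"
      and GW: "\<forall>s\<in>{0..1}. \<forall>t\<in>{0..1}. W2 (\<Gamma> s) (\<Gamma> t) = \<bar>s - t\<bar> * W2 \<nu>0 \<nu>1"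
      and ent: "\<forall>t\<in>{0..1}. \<forall>N'\<ge>N.
             (\<integral>\<^sup>+ x. ennreal (dens M (\<Gamma> t) x powr (1 - 1 / N')) \<partial>M) \<ge>
             (\<integral>\<^sup>+ z. tau K N' (1 - t) (dist (fst z) (snd z)) * ennreal (dens M \<nu>0 (fst z) powr (- 1 / N'))
                   + tau K N' t (dist (fst z) (snd z)) * ennreal (dens M \<nu>1 (snd z) powr (- 1 / N')) \<partial>q)"
      unfolding optimal_couplings_def by blast
    have P2: "\<nu>0 \<in> P2" "\<nu>1 \<in> P2" "\<Gamma> t \<in> P2" using ac G(1) t by (auto simp: P2_ac_def)
    have "AE y in \<Gamma> t. dist y x1 \<le> (1 - t) * (D + 1) + r"
    proof (rule W2_interpolation_support[OF P2 t(1,2) _ _ near])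
      show "W2 \<nu>0 (\<Gamma> t) = t * W2 \<nu>0 \<nu>1" using GW[rule_format, of 0 t] G t by simp
      show "W2 (\<Gamma> t) \<nu>1 = (1 - t) * W2 \<nu>0 \<nu>1" using GW[rule_format, of t 1] G t by simp
      show "dist x0 x1 + 2 * r \<le> D" using x1 by (simp add: D_def)
    qed (use D in auto)
    then have conc: "AE y in \<Gamma> t. y \<in> ball x1 \<epsilon>"
    proof eventually_elim
      case (elim y)
      then have "dist y x1 \<le> 2 * r" using sD t by simp
      then show ?case using \<epsilon> by (simp add: r_def dist_commute)
    qed
    interpret q: prob_space q using prob_space_coupling[OF q] P2 by (auto simp: P2_def)
    have dm: "Measurable.pred borel (\<lambda>x. dens M \<nu>0 x = 1 / m)"
    proof -
      have "RN_deriv M \<nu>0 \<in> borel_measurable borel"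
        using borel_measurable_RN_deriv[of M \<nu>0] measurable_cong_sets[OF sM refl] by blast
      then show ?thesis unfolding dens_def by measurable
    qed
    have "AE z in q. dens M \<nu>0 (fst z) = 1 / m"
      unfolding AE_coupling_fst[OF q dm] unfolding \<nu>0_def m_def by (rule dens_uniform_measure[OF M r])
    moreover have "AE z in q. dist (fst z) x0 \<le> r"
      using AE_coupling_fst[OF q, of "\<lambda>x. dist x x0 \<le> r"] near by simp
    moreover have "AE z in q. dist (snd z) x1 \<le> r"
      using AE_coupling_snd[OF q, of "\<lambda>x. dist x x1 \<le> r"] near by simp
    ultimately have "AE z in q. ennreal (c * v) \<le> tau K N (1 - t) (dist (fst z) (snd z)) * ennreal (dens M \<nu>0 (fst z) powr (- 1 / N))
                   + tau K N t (dist (fst z) (snd z)) * ennreal (dens M \<nu>1 (snd z) powr (- 1 / N))"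
    proof eventually_elim
      case (elim z)
      have "dist (fst z) (snd z) \<le> D"
        using elim(2,3) x1 dist_triangle[of "fst z" "snd z" x0] dist_triangle[of x0 "snd z" x1]
        by (simp add: D_def dist_commute)
      then have "ennreal c \<le> tau K N (1 - t) (dist (fst z) (snd z))"
        unfolding c_def t(3) by (intro tau_ge N s) auto
      moreover have "dens M \<nu>0 (fst z) powr (- 1 / N) = v"
        unfolding elim(1) v_def using m by (simp add: powr_minus_divide powr_divide)
      ultimately have "ennreal (c * v) \<le> tau K N (1 - t) (dist (fst z) (snd z)) * ennreal (dens M \<nu>0 (fst z) powr (- 1 / N))"
        using c v by (simp add: ennreal_mult mult_right_mono)
      \<comment> \<open>The term of \<open>\<nu>1\<close> is dropped, since its density depends on
        the mass of the ball around \<open>x1\<close>, the quantity to be estimated.\<close>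
      then show ?case by (rule order_trans) simp
    qed
    then have "(\<integral>\<^sup>+ z. ennreal (c * v) \<partial>q) \<le> (\<integral>\<^sup>+ z. tau K N (1 - t) (dist (fst z) (snd z)) * ennreal (dens M \<nu>0 (fst z) powr (- 1 / N))
                   + tau K N t (dist (fst z) (snd z)) * ennreal (dens M \<nu>1 (snd z) powr (- 1 / N)) \<partial>q)"
      by (rule nn_integral_mono_AE)
    also have "\<dots> \<le> (\<integral>\<^sup>+ x. ennreal (dens M (\<Gamma> t) x powr (1 - 1 / N)) \<partial>M)"
      using ent[rule_format, of t N] t(1,2) by simp
    also have "\<dots> \<le> ennreal u + ennreal (u powr (1 - N)) * emeasure M (ball x1 \<epsilon>)"
      using G(1) t conc by (intro nn_integral_dens_powr_le[OF M _ _ _ N u]) auto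
    finally have le: "ennreal (2 * u) \<le> ennreal u + ennreal (u powr (1 - N)) * emeasure M (ball x1 \<epsilon>)"
      by (simp add: q.emeasure_space_1 u_def)
    have "emeasure M (ball x1 \<epsilon>) < \<infinity>" using M by (auto simp: metric_measure_space_def)
    then obtain b where b: "emeasure M (ball x1 \<epsilon>) = ennreal b" "b \<ge> 0"
      by (cases "emeasure M (ball x1 \<epsilon>)") auto
    have "ennreal (2 * u) \<le> ennreal (u + u powr (1 - N) * b)"
      using le b u by (simp add: ennreal_plus ennreal_mult)
    then have "2 * u \<le> u + u powr (1 - N) * b"
      using u b by (subst (asm) ennreal_le_iff) (auto intro!: add_nonneg_nonneg)
    then have "u \<le> u powr (1 - N) * b" by simp
    then have "u powr (N - 1) * u \<le> u powr (N - 1) * (u powr (1 - N) * b)" by (intro mult_left_mono) auto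
    moreover have "u powr (N - 1) * u = u powr N" using u by (simp add: powr_diff)
    moreover have "u powr (N - 1) * (u powr (1 - N) * b) = b"
      using u by (simp add: mult.assoc[symmetric] powr_add[symmetric])
    ultimately show "ennreal (u powr N) \<le> emeasure M (ball x1 \<epsilon>)" using b by (simp add: ennreal_leI)
  qed
qed

text \<open>A packing argument: without total boundedness there are \<open>e\<close>-separated
  subsets of every finite size, and the disjoint balls of radius \<open>e / 2\<close> around their
  points each have mass at least \<open>c\<close> inside one ball of finite mass. Completeness of
  the type then gives compactness.\<close>

theorem CD_space_proper:
  fixes M :: "'a::polish_space measure"
  assumes M: "metric_measure_space M" and CD: "curvature_dimension K N M" and N: "N > 1"
  shows "compact (cball (x0::'a) R)"
proof -
  have "\<exists>k. finite k \<and> cball x0 R \<subseteq> (\<Union>x\<in>k. ball x e)" if e: "e > 0" for e :: real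
  proof (rule ccontr)
    assume no: "\<not> (\<exists>k. finite k \<and> cball x0 R \<subseteq> (\<Union>x\<in>k. ball x e))"
    have sep: "\<exists>F. finite F \<and> card F = n \<and> F \<subseteq> cball x0 R \<and> (\<forall>x\<in>F. \<forall>y\<in>F. x \<noteq> y \<longrightarrow> dist x y \<ge> e)" for n
    proof (induction n)
      case 0
      show ?case by (intro exI[of _ "{}"]) auto
    next
      case (Suc n)
      obtain F where F: "finite F" "card F = n" "F \<subseteq> cball x0 R" "\<forall>x\<in>F. \<forall>y\<in>F. x \<noteq> y \<longrightarrow> dist x y \<ge> e"
        using Suc.IH by (elim exE conjE)
      have "\<not> cball x0 R \<subseteq> (\<Union>x\<in>F. ball x e)" using no F(1) by metis
      then obtain z where z: "z \<in> cball x0 R" "z \<notin> (\<Union>x\<in>F. ball x e)" by (meson subsetI)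
      have z2: "dist x z \<ge> e" if "x \<in> F" for x
      proof -
        have "z \<notin> ball x e" using z(2) that by blast
        then show "dist x z \<ge> e" by simp
      qed
      have zF: "z \<notin> F" using z2[of z] e by auto
      have "dist x y \<ge> e" if "x \<in> insert z F" "y \<in> insert z F" "x \<noteq> y" for x y
      proof (cases "x = z")
        case True
        then have "y \<in> F" using that by blast
        then show ?thesis using z2[of y] True by (simp only: dist_commute)
      next
        case False
        then have "x \<in> F" using that by blast
        then show ?thesis using z2[of x] F(4) that by (cases "y = z") blast+
      qed
      moreover have "card (insert z F) = Suc n" using card_insert_disjoint[OF F(1) zF] F(2) by metis
      moreover have "finite (insert z F)" "insert z F \<subseteq> cball x0 R" using F(1,3) z(1) by blast+
      ultimately show ?case by blast
    qed
    \<comment> \<open>The lower bound wants a positive radius, whereas \<open>R\<close> is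
      arbitrary.\<close>
    define R' where "R' = \<bar>R\<bar> + 1"
    have "\<exists>c>0. \<forall>x1. dist x0 x1 \<le> R' \<longrightarrow> ennreal c \<le> emeasure M (ball x1 (e / 2))"
      by (rule CD_ball_measure_lower_bound[OF M CD N]) (use e in \<open>auto simp: R'_def\<close>)
    then obtain c where c: "c > 0" "\<And>x1. dist x0 x1 \<le> R' \<Longrightarrow> ennreal c \<le> emeasure M (ball x1 (e / 2))"
      by blast
    have fin: "emeasure M (ball x0 (R' + e)) < \<infinity>" and s: "sets M = sets borel"
      using M by (auto simp: metric_measure_space_def)
    have "real n * c \<le> measure M (ball x0 (R' + e))" for n
    proof -
      obtain F where F: "finite F" "card F = n" "F \<subseteq> cball x0 R" "\<forall>x\<in>F. \<forall>y\<in>F. x \<noteq> y \<longrightarrow> dist x y \<ge> e"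
        using sep[of n] by (elim exE conjE)
      have dj: "disjoint_family_on (\<lambda>x. ball x (e / 2)) F"
        unfolding disjoint_family_on_def
      proof (intro ballI impI)
        fix x y assume "x \<in> F" "y \<in> F" "x \<noteq> y"
        then have "dist x y \<ge> e" using F(4) by blast
        then show "ball x (e / 2) \<inter> ball y (e / 2) = {}"
          by (intro disjoint_ballI) simp
      qed
      have "ennreal (real n * c) = (\<Sum>x\<in>F. ennreal c)"
        using c(1) F(2) by (simp add: ennreal_mult ennreal_of_nat_eq_real_of_nat)
      also have "\<dots> \<le> (\<Sum>x\<in>F. emeasure M (ball x (e / 2)))"
      proof (intro sum_mono c(2))
        fix x assume "x \<in> F"
        then have "dist x0 x \<le> R" using F(3) by auto
        then show "dist x0 x \<le> R'" by (simp add: R'_def)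
      qed
      also have "\<dots> = emeasure M (\<Union>x\<in>F. ball x (e / 2))"
      proof (rule sum_emeasure[OF _ dj F(1)])
        show "(\<lambda>x. ball x (e / 2)) ` F \<subseteq> sets M" unfolding s by (intro image_subsetI borel_open open_ball)
      qed
      also have "\<dots> \<le> emeasure M (ball x0 (R' + e))"
      proof (rule emeasure_mono)
        show "(\<Union>x\<in>F. ball x (e / 2)) \<subseteq> ball x0 (R' + e)"
        proof
          fix y assume "y \<in> (\<Union>x\<in>F. ball x (e / 2))"
          then obtain x where "x \<in> F" "dist x y < e / 2" by auto
          moreover have "dist x0 x \<le> R" using F(3) \<open>x \<in> F\<close> by auto
          ultimately show "y \<in> ball x0 (R' + e)"
            using dist_triangle[of x0 y x] e by (simp add: R'_def)
        qed
      qed (simp add: s)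
      also have "\<dots> = ennreal (measure M (ball x0 (R' + e)))"
        using fin by (intro emeasure_eq_ennreal_measure) auto
      finally show ?thesis by simp
    qed
    moreover obtain n where "measure M (ball x0 (R' + e)) < real n * c" using ex_less_of_nat_mult[OF c(1)] by blast
    ultimately show False using not_le by blast
  qed
  then show ?thesis by (simp add: compact_eq_totally_bounded complete_eq_closed)
qed

section \<open>The coarea inequality\<close>

text \<open>The ramps of slope n + 1 at level \<open>r\<close>, composed with \<open>g\<close>, are
  an admissible sequence in the definition of the perimeter; convergence on compact sets is
  dominated convergence, compact sets having finite mass.\<close>

lemma superlevel_perimeter_le:
  fixes g :: "'a::polish_space \<Rightarrow> real"
  assumes M: "metric_measure_space M" and g: "locally_lipschitz g"
  shows "perimeter M {x. r < g x}
     \<le> liminf (\<lambda>n. \<integral>\<^sup>+ x. ennreal (real (Suc n)) * lip g x * indicator {x. r \<le> g x \<and> g x \<le> r + 1 / real (Suc n)} x \<partial>M)"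
proof -
  have s [measurable_cong]: "sets M = sets borel" and ball: "\<And>x r. emeasure M (ball x r) < \<infinity>"
    using M by (auto simp: metric_measure_space_def)
  have cg: "continuous_on UNIV g" by (rule locally_lipschitz_continuous[OF g])
  have gm: "g \<in> borel_measurable borel" using cg by (rule borel_measurable_continuous_onI)
  have [measurable]: "g \<in> borel_measurable M" using gm measurable_cong_sets[OF s refl] by blast
  define f where "f n x = ramp (real (Suc n)) r (g x)" for n x
  let ?A = "{x. r < g x}"
  have fm [measurable]: "f n \<in> borel_measurable M" for n unfolding f_def ramp_def by measurable
  have Am: "?A \<in> sets M"
  proof -
    have "?A = g -` {r<..} \<inter> space M" using sets_eq_imp_space_eq[OF s] by auto
    also have "\<dots> \<in> sets M" by measurable
    finally show ?thesis .
  qed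
  have lim: "(\<lambda>n. f n x) \<longlonglongrightarrow> indicator ?A x" for x
    unfolding f_def using ramp_tendsto_indicator[of r "g x"] by (simp add: indicator_def of_bool_def del: of_nat_Suc)
  have conv: "(\<lambda>n. \<integral>\<^sup>+ x\<in>K. ennreal \<bar>f n x - indicator ?A x\<bar> \<partial>M) \<longlonglongrightarrow> 0" if cK: "compact K" for K
  proof -
    obtain x0 R where K: "K \<subseteq> ball x0 R" using compact_imp_bounded[OF cK] bounded_subset_ballD[where S=K] by blast
    have Km [measurable]: "K \<in> sets M" using compact_imp_closed[OF cK] s by simp
    have "emeasure M K \<le> emeasure M (ball x0 R)" using K s by (intro emeasure_mono) auto
    then have fin: "emeasure M K < \<infinity>" using ball by (rule le_less_trans)
    have "(\<lambda>n. \<integral>\<^sup>+ x. ennreal \<bar>f n x - indicator ?A x\<bar> * indicator K x \<partial>M) \<longlonglongrightarrow> (\<integral>\<^sup>+ x. 0 \<partial>M)"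
    proof (rule nn_integral_dominated_convergence[where w="indicator K"])
      show "(\<lambda>x. ennreal \<bar>f n x - indicator ?A x\<bar> * indicator K x) \<in> borel_measurable M" for n
        using Am by measurable
      show "AE x in M. ennreal \<bar>f n x - indicator ?A x\<bar> * indicator K x \<le> indicator K x" for n
        by (rule AE_I2) (auto simp: f_def ramp_def indicator_def ennreal_le_1)
      show "AE x in M. (\<lambda>n. ennreal \<bar>f n x - indicator ?A x\<bar> * indicator K x) \<longlonglongrightarrow> 0"
      proof (rule AE_I2)
        fix x
        have "(\<lambda>n. \<bar>f n x - indicator ?A x\<bar>) \<longlonglongrightarrow> 0"
          using lim[of x] by (simp add: LIM_zero tendsto_rabs_zero)
        then have "(\<lambda>n. ennreal \<bar>f n x - indicator ?A x\<bar>) \<longlonglongrightarrow> ennreal 0" by (rule tendsto_ennrealI)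
        then show "(\<lambda>n. ennreal \<bar>f n x - indicator ?A x\<bar> * indicator K x) \<longlonglongrightarrow> 0"
          by (cases "x \<in> K") auto
      qed
    qed (use fin in auto)
    then show ?thesis by simp
  qed
  have "perimeter M ?A \<le> liminf (\<lambda>n. \<integral>\<^sup>+ x. lip (f n) x \<partial>M)"
    unfolding perimeter_def
  proof (rule Inf_lower, rule CollectI, intro exI conjI)
    show "\<forall>i. locally_lipschitz (f i)" unfolding f_def using locally_lipschitz_ramp[OF g] by simp
    show "\<forall>K. compact K \<longrightarrow> (\<lambda>i. \<integral>\<^sup>+ x\<in>K. ennreal \<bar>f i x - indicator ?A x\<bar> \<partial>M) \<longlonglongrightarrow> 0" using conv by blast
  qed simp
  also have "\<dots> \<le> liminf (\<lambda>n. \<integral>\<^sup>+ x. ennreal (real (Suc n)) * lip g x * indicator {x. r \<le> g x \<and> g x \<le> r + 1 / real (Suc n)} x \<partial>M)"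
    unfolding f_def by (intro Liminf_mono always_eventually allI nn_integral_mono lip_ramp_le[OF cg]) simp
  finally show ?thesis .
qed

text \<open>
  The weighted coarea inequality. The bounds of the previous lemma are integrated over the level with
  Fatou's lemma, so neither measurability of the perimeter in the level nor differentiation is needed;
  monotonicity of the weight \<open>\<psi>\<close> allows to replace the level by the value of \<open>g\<close>.
\<close>

lemma coarea_inequality:
  fixes g :: "'a::polish_space \<Rightarrow> real" and \<phi> \<psi> :: "real \<Rightarrow> ennreal"
  assumes M: "metric_measure_space M" and g: "locally_lipschitz g"
    and \<phi>: "\<phi> \<in> borel_measurable borel" and \<phi>_le: "\<And>r. a < r \<Longrightarrow> r < b \<Longrightarrow> \<phi> r \<le> perimeter M {x. r < g x}"
    and \<psi>: "\<psi> \<in> borel_measurable borel" and fin: "\<And>r. \<psi> r < \<infinity>" and mono: "\<And>r s. a < r \<Longrightarrow> r \<le> s \<Longrightarrow> s < b \<Longrightarrow> \<psi> r \<le> \<psi> s"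
  shows "(\<integral>\<^sup>+ r\<in>{a<..<b}. \<psi> r * \<phi> r \<partial>lborel) \<le> (\<integral>\<^sup>+ x\<in>{x. a < g x \<and> g x < b}. \<psi> (g x) * lip g x \<partial>M)"
proof -
  have s: "sets M = sets borel" using M by (auto simp: metric_measure_space_def)
  interpret sigma_finite_measure M by (rule metric_measure_space_sigma_finite[OF M])
  interpret pair_sigma_finite lborel M ..
  have cg: "continuous_on UNIV g" by (rule locally_lipschitz_continuous[OF g])
  have gm: "g \<in> borel_measurable borel" using cg by (rule borel_measurable_continuous_onI)
  have gM [measurable]: "g \<in> borel_measurable M" using gm measurable_cong_sets[OF s refl] by blast
  have lM [measurable]: "lip g \<in> borel_measurable M"
    using lip_measurable[OF cg] measurable_cong_sets[OF s refl] by blast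
  note [measurable] = \<phi> \<psi>
  define N where "N n = real (Suc n)" for n
  have N: "N n > 0" for n by (simp add: N_def)
  \<comment> \<open>Levels are cut off at \<open>b - 1 / N n\<close> so that the whole band above
    \<open>r\<close> stays below \<open>b\<close>, where \<open>\<psi>\<close> is monotone. For each
    fixed level below \<open>b\<close> the cut is inactive once \<open>n\<close> is large.\<close>
  define F where "F n r x = (\<psi> r * indicator {a<..<b - 1 / N n} r) * (ennreal (N n) * lip g x * indicator {0..1 / N n} (g x - r))"
    for n :: nat and r x
  define H where "H n r = (\<integral>\<^sup>+ x. F n r x \<partial>M)" for n r
  have Fm [measurable]: "(\<lambda>(r, x). F n r x) \<in> borel_measurable (lborel \<Otimes>\<^sub>M M)" for n
  proof -
    have 1: "(\<lambda>z. fst z) \<in> borel_measurable (lborel \<Otimes>\<^sub>M M)"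
      using measurable_fst[of lborel M] measurable_cong_sets[OF refl sets_lborel] by blast
    have 2: "(\<lambda>z. g (snd z)) \<in> borel_measurable (lborel \<Otimes>\<^sub>M M)" "(\<lambda>z. lip g (snd z)) \<in> borel_measurable (lborel \<Otimes>\<^sub>M M)"
      using measurable_compose[OF measurable_snd gM] measurable_compose[OF measurable_snd lM] by auto
    have 3: "(\<lambda>z. \<psi> (fst z)) \<in> borel_measurable (lborel \<Otimes>\<^sub>M M)" using measurable_compose[OF 1 \<psi>] .
    have 4: "(\<lambda>z. indicator {a<..<b - 1 / N n} (fst z) :: ennreal) \<in> borel_measurable (lborel \<Otimes>\<^sub>M M)"
      by (rule measurable_compose[OF 1]) measurable
    have "(\<lambda>z. g (snd z) - fst z) \<in> borel_measurable (lborel \<Otimes>\<^sub>M M)" using 1 2 by (intro borel_measurable_diff)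
    then have 5: "(\<lambda>z. indicator {0..1 / N n} (g (snd z) - fst z) :: ennreal) \<in> borel_measurable (lborel \<Otimes>\<^sub>M M)"
      by (rule measurable_compose) measurable
    show ?thesis unfolding F_def case_prod_beta
      by (intro borel_measurable_times_ennreal borel_measurable_const 2 3 4 5)
  qed
  have [measurable]: "H n \<in> borel_measurable lborel" for n
    unfolding H_def by measurable
  have Heq: "H n r = (\<psi> r * indicator {a<..<b - 1 / N n} r) *
     (\<integral>\<^sup>+ x. ennreal (N n) * lip g x * indicator {x. r \<le> g x \<and> g x \<le> r + 1 / N n} x \<partial>M)" for n r
  proof -
    have i: "indicator {0..1 / N n} (g x - r) = (indicator {x. r \<le> g x \<and> g x \<le> r + 1 / N n} x :: ennreal)" for x
      by (auto simp: indicator_def)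
    have "(\<lambda>x. ennreal (N n) * lip g x * indicator {0..1 / N n} (g x - r)) \<in> borel_measurable M" by measurable
    then show ?thesis unfolding H_def F_def by (subst nn_integral_cmult) (simp_all add: i)
  qed
  have "(\<integral>\<^sup>+ r\<in>{a<..<b}. \<psi> r * \<phi> r \<partial>lborel) \<le> (\<integral>\<^sup>+ r. liminf (\<lambda>n. H n r) \<partial>lborel)"
  proof (rule nn_integral_mono)
    fix r
    show "\<psi> r * \<phi> r * indicator {a<..<b} r \<le> liminf (\<lambda>n. H n r)"
    proof (cases "a < r \<and> r < b")
      case True
      let ?J = "\<lambda>n. \<integral>\<^sup>+ x. ennreal (N n) * lip g x * indicator {x. r \<le> g x \<and> g x \<le> r + 1 / N n} x \<partial>M"
      obtain k where k: "1 / (b - r) < real k" using reals_Archimedean2 by blast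
      have ev: "eventually (\<lambda>n. H n r = \<psi> r * ?J n) sequentially"
        unfolding eventually_sequentially
      proof (intro exI allI impI)
        fix n assume "k \<le> n"
        then have "1 / (b - r) < N n" using k unfolding N_def by linarith
        then have "1 < N n * (b - r)" using True by (simp add: field_simps)
        then have "1 / N n < b - r" using N[of n] by (simp add: field_simps)
        then show "H n r = \<psi> r * ?J n" unfolding Heq using True by simp
      qed
      have "\<phi> r \<le> liminf ?J"
        using \<phi>_le[of r] True superlevel_perimeter_le[OF M g, of r] unfolding N_def by (meson order_trans)
      then have "\<psi> r * \<phi> r \<le> \<psi> r * liminf ?J" by (intro mult_left_mono) auto
      \<comment> \<open>Finiteness of \<open>\<psi> r\<close> makes multiplication by it continuous
        on \<open>ennreal\<close>.\<close>
      also have "\<dots> = liminf (\<lambda>n. \<psi> r * ?J n)"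
        using fin[of r] by (intro Liminf_compose_continuous_mono[symmetric])
          (auto intro!: ennreal_continuous_on_cmult continuous_on_id monoI mult_left_mono)
      also have "\<dots> = liminf (\<lambda>n. H n r)" using ev by (intro Liminf_eq) (simp add: eventually_mono)
      finally show ?thesis using True by simp
    qed auto
  qed
  also have "\<dots> \<le> liminf (\<lambda>n. \<integral>\<^sup>+ r. H n r \<partial>lborel)" by (rule nn_integral_liminf) measurable
  also have "\<dots> \<le> liminf (\<lambda>n. \<integral>\<^sup>+ x\<in>{x. a < g x \<and> g x < b}. \<psi> (g x) * lip g x \<partial>M)"
  proof (intro Liminf_mono always_eventually allI)
    fix n
    have "(\<integral>\<^sup>+ r. H n r \<partial>lborel) = (\<integral>\<^sup>+ x. \<integral>\<^sup>+ r. F n r x \<partial>lborel \<partial>M)"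
      unfolding H_def by (rule Fubini'[symmetric]) measurable
    also have "\<dots> \<le> (\<integral>\<^sup>+ x\<in>{x. a < g x \<and> g x < b}. \<psi> (g x) * lip g x \<partial>M)"
    proof (rule nn_integral_mono)
      fix x
      \<comment> \<open>For fixed \<open>x\<close> the contributing levels lie in an interval of
        length \<open>1 / N n\<close>, which cancels the factor \<open>N n\<close>.\<close>
      define c where "c = (if a < g x \<and> g x < b then \<psi> (g x) * lip g x else 0)"
      have "(\<integral>\<^sup>+ r. F n r x \<partial>lborel) \<le> (\<integral>\<^sup>+ r. (c * ennreal (N n)) * indicator {g x - 1 / N n..g x} r \<partial>lborel)"
      proof (rule nn_integral_mono)
        fix r
        show "F n r x \<le> (c * ennreal (N n)) * indicator {g x - 1 / N n..g x} r"
        proof (cases "a < r \<and> r < b - 1 / N n \<and> r \<le> g x \<and> g x \<le> r + 1 / N n")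
          case True
          then have "a < g x" "g x < b" "\<psi> r \<le> \<psi> (g x)" using mono[of r "g x"] by auto
          then have "\<psi> r * (ennreal (N n) * lip g x) \<le> c * ennreal (N n)"
            unfolding c_def using mult_right_mono[of "\<psi> r" "\<psi> (g x)" "ennreal (N n) * lip g x"] by (simp add: mult_ac)
          then show ?thesis using True by (simp add: F_def)
        next
          case False
          then have "F n r x = 0" by (auto simp: F_def indicator_def)
          then show ?thesis by simp
        qed
      qed
      also have "\<dots> = c * (ennreal (N n) * ennreal (1 / N n))"
        using N[of n] by (subst nn_integral_cmult_indicator) (auto simp: mult.assoc)
      also have "\<dots> = c" using N[of n] by (simp add: ennreal_mult[symmetric])
      also have "c = \<psi> (g x) * lip g x * indicator {x. a < g x \<and> g x < b} x" by (simp add: c_def)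
      finally show "(\<integral>\<^sup>+ r. F n r x \<partial>lborel) \<le> \<psi> (g x) * lip g x * indicator {x. a < g x \<and> g x < b} x" .
    qed
    finally show "(\<integral>\<^sup>+ r. H n r \<partial>lborel) \<le> (\<integral>\<^sup>+ x\<in>{x. a < g x \<and> g x < b}. \<psi> (g x) * lip g x \<partial>M)" .
  qed
  also have "\<dots> = (\<integral>\<^sup>+ x\<in>{x. a < g x \<and> g x < b}. \<psi> (g x) * lip g x \<partial>M)" by (rule Liminf_const) simp
  finally show ?thesis .
qed

section \<open>Elementary inequalities\<close>

text \<open>As a function of w = x^(-p), ln (1 + x) is convex, and the left side is its tangent at w
  = y^(-p). The proof uses ln z \<le> z - 1 twice: once as weighted arithmetic-geometric mean
  inequality with weight y / (1 + y), once to compare the logarithm of (y/x)^p with 1 -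
  (y/x)^p.\<close>

lemma ln_one_plus_tangent:
  fixes x y :: real
  assumes "0 < x" "0 < y" "0 < p"
  shows "ln (1 + y) + y / (1 + y) / real p * (1 - (y / x) ^ p) \<le> ln (1 + x)"
proof -
  define \<theta> where "\<theta> = y / (1 + y)"
  define r where "r = x / y"
  define z where "z = (1 + x) / (1 + y)"
  have pos: "0 < \<theta>" "0 < r" "0 < z" "\<theta> < 1" using assms by (auto simp: \<theta>_def r_def z_def)
  have z: "z = (1 - \<theta>) + \<theta> * r" using assms by (simp add: z_def \<theta>_def r_def field_simps)
  have "ln (r / z) \<le> r / z - 1" "ln (1 / z) \<le> 1 / z - 1" using pos by (auto intro!: ln_le_minus_one)
  then have "\<theta> * ln (r / z) + (1 - \<theta>) * ln (1 / z) \<le> \<theta> * (r / z - 1) + (1 - \<theta>) * (1 / z - 1)"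
    using pos by (intro add_mono mult_left_mono) auto
  also have "\<dots> = (\<theta> * r + (1 - \<theta>)) / z - 1" by (simp add: algebra_simps add_divide_distrib diff_divide_distrib)
  also have "\<dots> = 0" using pos z by simp
  finally have 1: "\<theta> * ln r \<le> ln z" using pos by (simp add: ln_div algebra_simps)
  have "ln ((y / x) ^ p) \<le> (y / x) ^ p - 1" using assms by (intro ln_le_minus_one) auto
  then have "1 - (y / x) ^ p \<le> real p * ln r"
    using assms by (simp add: ln_realpow r_def ln_div algebra_simps)
  then have "\<theta> / real p * (1 - (y / x) ^ p) \<le> \<theta> / real p * (real p * ln r)"
    using pos by (intro mult_left_mono) auto
  also have "\<dots> = \<theta> * ln r" using assms by simp
  also have "\<dots> \<le> ln (1 + x) - ln (1 + y)" using 1 assms by (simp add: z_def ln_div)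
  finally show ?thesis by (simp add: \<theta>_def)
qed

text \<open>Summing the tangent bounds shows that under the constraint the product is smallest when
  all \<open>x i\<close> equal \<open>y\<close>.\<close>

lemma prod_one_plus_ge:
  fixes x :: "nat \<Rightarrow> real"
  assumes x: "\<And>i. i < k \<Longrightarrow> 0 < x i" and y: "0 < y" and p: "0 < p"
    and s: "(\<Sum>i<k. (y / x i) ^ p) \<le> real k"
  shows "(1 + y) ^ k \<le> (\<Prod>i<k. 1 + x i)"
proof -
  define c where "c = y / (1 + y) / real p"
  have c: "c \<ge> 0" using y by (simp add: c_def)
  have "real k * ln (1 + y) \<le> real k * ln (1 + y) + c * (real k - (\<Sum>i<k. (y / x i) ^ p))"
    using s c by simp
  also have "\<dots> = (\<Sum>i<k. ln (1 + y) + c * (1 - (y / x i) ^ p))"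
    by (simp add: sum.distrib sum_distrib_left sum_subtractf right_diff_distrib)
  also have "\<dots> \<le> (\<Sum>i<k. ln (1 + x i))"
    unfolding c_def using x y p by (intro sum_mono ln_one_plus_tangent) auto
  also have "\<dots> = ln (\<Prod>i<k. 1 + x i)"
    by (subst ln_prod) (auto dest!: x)
  finally have "ln ((1 + y) ^ k) \<le> ln (\<Prod>i<k. 1 + x i)" using y by (simp add: ln_realpow)
  moreover have "0 < (\<Prod>i<k. 1 + x i)" using x by (intro prod_pos) (auto intro: add_pos_pos)
  ultimately show ?thesis using y by simp
qed

text \<open>With x_i = l_i / l_(i+1) - 1 and y = Q / k, where Q is the number multiplied by 1/k in
  the conclusion, the step hypothesis becomes (y / x_i)^p \<le> k e_i / A. These sum to at most k,
  so the preceding product bound applies, and the product of the 1 + x_i telescopes to l_0 /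
  l_k.\<close>

lemma level_decay_step:
  fixes l e :: "nat \<Rightarrow> real"
  assumes k: "k > 0" and lpos: "\<And>i. i \<le> k \<Longrightarrow> 0 < l i" and e: "\<And>i. i < k \<Longrightarrow> 0 \<le> e i"
    and dec: "\<And>i. i < k \<Longrightarrow> l (Suc i) \<le> l i"
    and A: "(\<Sum>i<k. e i) \<le> A" "A > 0" and S: "S > 0" and B: "B > 0" and p: "p > 0"
    and step: "\<And>i. i < k \<Longrightarrow> (S / real k) ^ Suc p * (B * l (Suc i)) ^ p \<le> e i * (l i - l (Suc i)) ^ p"
  shows "(1 + B * root p (S ^ Suc p / A) / real k) ^ k * l k \<le> l 0"
proof -
  define Q where "Q = B * root p (S ^ Suc p / A)"
  define y where "y = Q / real k"
  define x where "x i = l i / l (Suc i) - 1" for i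
  have Qp: "Q ^ p = B ^ p * S ^ Suc p / A" using A S p by (simp add: Q_def power_mult_distrib)
  have Q: "Q > 0" using B A S p by (simp add: Q_def)
  then have y: "y > 0" using k by (simp add: y_def)
  have lhs: "0 < (S / real k) ^ Suc p * (B * l (Suc i)) ^ p" if "i < k" for i
    using that lpos[of "Suc i"] S B k by (intro mult_pos_pos zero_less_power) auto
  have x: "0 < x i" if i: "i < k" for i
  proof -
    have "l i \<noteq> l (Suc i)" using lhs[OF i] step[OF i] p by (auto simp: zero_power)
    then have "l (Suc i) < l i" using dec[OF i] by simp
    then show ?thesis using lpos[of "Suc i"] i by (simp add: x_def)
  qed
  have bound: "(y / x i) ^ p \<le> real k / A * e i" if i: "i < k" for i
  proof -
    let ?b = "l (Suc i)"
    have b: "?b > 0" using lpos i by simp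
    have d: "l i - ?b = x i * ?b" using b by (simp add: x_def field_simps)
    have "(S / real k) ^ Suc p * B ^ p * ?b ^ p \<le> e i * x i ^ p * ?b ^ p"
      using step[OF i] unfolding d power_mult_distrib by (simp add: mult_ac)
    then have 1: "(S / real k) ^ Suc p * B ^ p \<le> e i * x i ^ p"
      by (rule mult_right_le_imp_le) (use b in simp)
    have "y ^ p = (S / real k) ^ Suc p * B ^ p * (real k / A)"
      unfolding y_def power_divide Qp using k A by (simp add: field_simps)
    also have "\<dots> \<le> e i * x i ^ p * (real k / A)" using 1 A by (intro mult_right_mono) auto
    finally have "y ^ p / x i ^ p \<le> real k / A * e i" using x[OF i] by (simp add: field_simps)
    then show ?thesis by (simp add: power_divide)
  qed
  have "(\<Sum>i<k. (y / x i) ^ p) \<le> (\<Sum>i<k. real k / A * e i)" using bound by (intro sum_mono) auto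
  also have "\<dots> = real k / A * (\<Sum>i<k. e i)" by (simp add: sum_distrib_left)
  also have "\<dots> \<le> real k / A * A" using A by (intro mult_left_mono) auto
  finally have "(1 + y) ^ k \<le> (\<Prod>i<k. 1 + x i)"
    using A x y p by (intro prod_one_plus_ge) auto
  also have "(\<Prod>i<k. 1 + x i) = l 0 / l k"
  proof -
    have "j \<le> k \<Longrightarrow> (\<Prod>i<j. 1 + x i) = l 0 / l j" for j
    proof (induction j)
      case 0
      then show ?case using lpos[of 0] by simp
    next
      case (Suc j)
      then show ?case using lpos[of j] by (simp add: x_def)
    qed
    then show ?thesis by simp
  qed
  finally show ?thesis using lpos[of k] by (simp add: y_def Q_def field_simps)
qed

text \<open>Hoelder's inequality for the exponent m, in a form that accepts upper bounds for the
  energy and the mass and a lower bound for the integral. It integrates Bernoulli's inequality, that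
  is, the tangent of z^m at a constant.\<close>

lemma Jensen_power_integral:
  fixes f :: "'a \<Rightarrow> real"
  assumes f: "(\<lambda>x. ennreal (f x)) \<in> borel_measurable M" and nn: "\<And>x. 0 \<le> f x" and S: "S \<in> sets M" and m: "m \<ge> 2"
    and E: "(\<integral>\<^sup>+ x\<in>S. ennreal (f x ^ m) \<partial>M) \<le> ennreal e" "e \<ge> 0"
    and w: "emeasure M S \<le> ennreal w" "w \<ge> 0"
    and l: "ennreal l \<le> (\<integral>\<^sup>+ x\<in>S. ennreal (f x) \<partial>M)" "l \<ge> 0"
  shows "l ^ m \<le> e * w ^ (m - 1)"
proof (cases "w = 0 \<or> l = 0")
  case True
  have "l = 0"
  proof (rule ccontr)
    assume "l \<noteq> 0"
    then have "emeasure M S = 0" using w True by simp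
    then have "AE x in M. x \<notin> S" using S by (intro AE_not_in) auto
    then have "(\<integral>\<^sup>+ x\<in>S. ennreal (f x) \<partial>M) = (\<integral>\<^sup>+ x. 0 \<partial>M)"
      by (intro nn_integral_cong_AE) (auto elim: eventually_mono)
    then show False using l \<open>l \<noteq> 0\<close> by simp
  qed
  then show ?thesis using E w m by (simp add: zero_power)
next
  case False
  then have pos: "w > 0" "l > 0" using w l by auto
  \<comment> \<open>The tangent point is the mean value of \<open>f\<close> on \<open>S\<close> as
    suggested by the two bounds, which makes the inequality sharp for constant
    \<open>f\<close>.\<close>
  define c where "c = l / w"
  have c: "c > 0" using pos by (simp add: c_def)
  have fm: "f \<in> borel_measurable M"
  proof -
    have "(\<lambda>x. enn2real (ennreal (f x))) \<in> borel_measurable M" using f by measurable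
    then show ?thesis using nn by simp
  qed
  note [measurable] = fm S
  have pw: "real m * c ^ (m - 1) * f x \<le> f x ^ m + real (m - 1) * c ^ m" for x
  proof -
    have "1 + real m * (f x / c - 1) \<le> (1 + (f x / c - 1)) ^ m"
      using nn[of x] c by (intro Bernoulli_inequality) auto
    then have "c ^ m * (1 + real m * (f x / c - 1)) \<le> c ^ m * (f x / c) ^ m"
      using c by (intro mult_left_mono) auto
    also have "\<dots> = f x ^ m" using c by (simp add: power_divide)
    finally have "c ^ m * (1 + real m * (f x / c - 1)) \<le> f x ^ m" .
    moreover have "c ^ m = c * c ^ (m - 1)" using m by (cases m) auto
    moreover have "c * c ^ (m - 1) * (1 + real m * (f x / c - 1))
        = real m * c ^ (m - 1) * f x - real (m - 1) * (c * c ^ (m - 1))"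
      using c m by (simp add: field_simps of_nat_diff)
    ultimately show ?thesis by simp
  qed
  have "ennreal (real m * c ^ (m - 1) * l) \<le> ennreal (real m * c ^ (m - 1)) * (\<integral>\<^sup>+ x\<in>S. ennreal (f x) \<partial>M)"
    using c l by (simp add: ennreal_mult mult_left_mono)
  also have "\<dots> = (\<integral>\<^sup>+ x. ennreal (real m * c ^ (m - 1)) * (ennreal (f x) * indicator S x) \<partial>M)"
    by (rule nn_integral_cmult[symmetric]) measurable
  also have "\<dots> \<le> (\<integral>\<^sup>+ x. ennreal (f x ^ m) * indicator S x + ennreal (real (m - 1) * c ^ m) * indicator S x \<partial>M)"
  proof (rule nn_integral_mono)
    fix x
    have "ennreal (real m * c ^ (m - 1)) * ennreal (f x) \<le> ennreal (f x ^ m) + ennreal (real (m - 1) * c ^ m)"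
      using pw[of x] nn[of x] c by (simp add: ennreal_mult[symmetric] ennreal_plus[symmetric] ennreal_leI del: ennreal_plus)
    then show "ennreal (real m * c ^ (m - 1)) * (ennreal (f x) * indicator S x)
      \<le> ennreal (f x ^ m) * indicator S x + ennreal (real (m - 1) * c ^ m) * indicator S x"
      by (simp add: indicator_def)
  qed
  also have "\<dots> = (\<integral>\<^sup>+ x\<in>S. ennreal (f x ^ m) \<partial>M) + ennreal (real (m - 1) * c ^ m) * emeasure M S"
    by (subst nn_integral_add) (auto simp: nn_integral_cmult_indicator)
  also have "\<dots> \<le> ennreal e + ennreal (real (m - 1) * c ^ m) * ennreal w"
    using E w by (intro add_mono mult_left_mono) auto
  also have "\<dots> = ennreal (e + real (m - 1) * c ^ m * w)"
    using E w c by (simp add: ennreal_mult ennreal_plus)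
  finally have "real m * c ^ (m - 1) * l \<le> e + real (m - 1) * c ^ m * w"
    using E w c by (subst (asm) ennreal_le_iff) (auto intro!: add_nonneg_nonneg)
  moreover have "c ^ m * w = c ^ (m - 1) * l"
    using pos m by (cases m) (auto simp: c_def)
  ultimately have "real m * (c ^ (m - 1) * l) \<le> e + (real m - 1) * (c ^ (m - 1) * l)"
    using m by (simp add: of_nat_diff mult.assoc)
  then have "c ^ (m - 1) * l \<le> e" by (simp add: left_diff_distrib)
  then have "c ^ (m - 1) * l * w ^ (m - 1) \<le> e * w ^ (m - 1)" using pos by (intro mult_right_mono) auto
  moreover have "c ^ (m - 1) * w ^ (m - 1) = l ^ (m - 1)" using pos by (simp add: c_def power_divide)
  moreover have "l ^ m = l ^ (m - 1) * l" using m by (cases m) auto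
  ultimately show ?thesis by (simp add: mult_ac)
qed

text \<open>\<open>P_poly m\<close> ends with degree m - 2, so this is the Taylor remainder of order
  m - 1 with the factorial discarded.\<close>

lemma exp_minus_P_poly_le:
  assumes "m \<ge> 2" "0 \<le> t"
  shows "exp t - P_poly m t \<le> t ^ (m - 1) * exp t"
proof -
  have P: "P_poly m t = (\<Sum>j<m - 1. t ^ j / fact j)"
    unfolding P_poly_def using assms(1) by (intro sum.cong) auto
  obtain u where u: "\<bar>u\<bar> \<le> \<bar>t\<bar>" "exp t = (\<Sum>j<m - 1. t ^ j / fact j) + exp u / fact (m - 1) * t ^ (m - 1)"
    using Maclaurin_exp_le by blast
  then have e: "exp t - P_poly m t = exp u / fact (m - 1) * t ^ (m - 1)" using P by simp
  have "exp u / fact (m - 1) \<le> exp t / 1"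
    using u(1) assms(2) by (intro frac_le) auto
  then have "exp u / fact (m - 1) * t ^ (m - 1) \<le> exp t * t ^ (m - 1)" using assms(2) by (intro mult_right_mono) auto
  then show "exp t - P_poly m t \<le> t ^ (m - 1) * exp t" using e by (simp add: mult.commute)
qed

text \<open>The shift s + 1 changes (s + i + 1)^q only by a factor tending to 1, so it is absorbed
  by replacing \<alpha> with the midpoint \<open>\<gamma>\<close> of \<alpha> and \<beta>. As q
  \<ge> 1, what remains is dominated by a geometric series.\<close>

lemma summable_exp_tail:
  fixes \<alpha> \<beta> q s :: real
  assumes "0 < \<alpha>" "\<alpha> < \<beta>" "1 \<le> q" "0 \<le> s"
  shows "summable (\<lambda>i::nat. exp (\<alpha> * (s + real i + 1) powr q) * exp (- \<beta> * real i powr q))"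
proof -
  define \<gamma> where "\<gamma> = (\<alpha> + \<beta>) / 2"
  have g: "\<alpha> < \<gamma>" "\<gamma> < \<beta>" using assms by (auto simp: \<gamma>_def)
  have "((\<lambda>i::nat. (1 + (s + 1) / real i) powr q) \<longlongrightarrow> (1 + 0) powr q) sequentially"
    by (intro tendsto_intros) (auto intro!: tendsto_divide_0[OF tendsto_const] filterlim_real_sequentially filterlim_at_top_imp_at_infinity)
  then have "eventually (\<lambda>i::nat. (1 + (s + 1) / real i) powr q < \<gamma> / \<alpha>) sequentially"
    by (rule order_tendstoD) (use g assms in simp)
  then have "eventually (\<lambda>i::nat. norm (exp (\<alpha> * (s + real i + 1) powr q) * exp (- \<beta> * real i powr q)) \<le> exp (- (\<beta> - \<gamma>)) ^ i) sequentially"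
    using eventually_ge_at_top[of 1]
  proof eventually_elim
    case (elim i)
    have i: "real i \<ge> 1" using elim(2) by simp
    have "(s + real i + 1) powr q = (1 + (s + 1) / real i) powr q * real i powr q"
    proof -
      have "s + real i + 1 = (1 + (s + 1) / real i) * real i" using i by (simp add: field_simps)
      then show ?thesis using powr_mult by simp
    qed
    also have "\<dots> \<le> \<gamma> / \<alpha> * real i powr q" using elim(1) by (intro mult_right_mono) auto
    finally have "\<alpha> * (s + real i + 1) powr q \<le> \<gamma> * real i powr q" using assms by (simp add: field_simps)
    moreover have "real i \<le> real i powr q" using powr_mono[of 1 q "real i"] i assms by simp
    then have "(\<beta> - \<gamma>) * real i \<le> (\<beta> - \<gamma>) * real i powr q" using g by (intro mult_left_mono) auto
    ultimately have "\<alpha> * (s + real i + 1) powr q + (- \<beta> * real i powr q) \<le> real i * (- (\<beta> - \<gamma>))"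
      by (simp add: algebra_simps)
    then have "exp (\<alpha> * (s + real i + 1) powr q + (- \<beta> * real i powr q)) \<le> exp (- (\<beta> - \<gamma>)) ^ i"
      by (simp add: exp_of_nat_mult[symmetric])
    then show ?case by (simp only: exp_add[symmetric] norm_exp real_norm_def abs_exp_cancel)
  qed
  then show ?thesis by (rule summable_comparison_test_ev) (use g in \<open>simp add: summable_geometric\<close>)
qed

section \<open>Functions with compact support\<close>

text \<open>Compact support makes the superlevel sets at levels r \<ge> 0 admissible in the
  isoperimetric inequalities, which concern sets with compact closure.\<close>

definition test_function :: "('a::metric_space \<Rightarrow> real) \<Rightarrow> bool" where
  "test_function g \<longleftrightarrow> locally_lipschitz g \<and> (\<forall>x. 0 \<le> g x) \<and> (\<exists>K. compact K \<and> (\<forall>x. x \<notin> K \<longrightarrow> g x = 0))"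

text \<open>Isolates the isoperimetric input: a linear inequality at all masses, coming from the
  Cheeger constant, and a power inequality at masses below \<open>v0\<close>, coming from the
  behaviour of the profile near 0.\<close>

locale isoperimetric_space =
  fixes M :: "'a::polish_space measure" and h B v0 :: real and m :: nat
  assumes mms: "metric_measure_space M"
    and pos: "0 < h" "0 < B" "0 < v0" and m: "m \<ge> 2"
    and linear_isoperimetry: "\<And>A. A \<in> sets M \<Longrightarrow> compact (closure A) \<Longrightarrow> emeasure M A > 0 \<Longrightarrow>
        ennreal h * emeasure M A \<le> perimeter M A"
    and power_isoperimetry: "\<And>A t. A \<in> sets M \<Longrightarrow> compact (closure A) \<Longrightarrow> 0 < t \<Longrightarrow> t < v0 \<Longrightarrow>
        emeasure M A = ennreal t \<Longrightarrow> ennreal ((B * t) ^ (m - 1)) \<le> perimeter M A ^ m"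
begin

lemma sets_M: "sets M = sets borel"
  using mms by (auto simp: metric_measure_space_def)

lemma space_M: "space M = UNIV"
  using sets_eq_imp_space_eq[OF sets_M] by simp

sublocale sigma_finite_measure M
  by (rule metric_measure_space_sigma_finite[OF mms])

lemma test_functionD:
  assumes "test_function g"
  shows "locally_lipschitz g" "\<And>x. 0 \<le> g x" "g \<in> borel_measurable M" "lip g \<in> borel_measurable M"
    "\<And>x. ennreal (enn2real (lip g x)) = lip g x"
proof -
  show g: "locally_lipschitz g" "\<And>x. 0 \<le> g x" using assms by (auto simp: test_function_def)
  note c = locally_lipschitz_continuous[OF g(1)]
  show "g \<in> borel_measurable M"
    using borel_measurable_continuous_onI[OF c] measurable_cong_sets[OF sets_M refl] by blast
  show "lip g \<in> borel_measurable M"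
    using lip_measurable[OF c] measurable_cong_sets[OF sets_M refl] by blast
  show "ennreal (enn2real (lip g x)) = lip g x" for x using lip_finite[OF g(1), of x] by simp
qed

lemma test_function_bounded:
  fixes g :: "'a \<Rightarrow> real"
  assumes "test_function g"
  obtains b where "b > 0" "\<And>x. g x < b"
proof -
  obtain K where K: "compact K" "\<And>x. x \<notin> K \<Longrightarrow> g x = 0" using assms by (auto simp: test_function_def)
  have "compact (g ` K)"
    using continuous_on_subset[OF locally_lipschitz_continuous[OF test_functionD(1)[OF assms]] subset_UNIV] K(1)
    by (rule compact_continuous_image)
  then have "bounded (g ` K)" by (rule compact_imp_bounded)
  then obtain c where c: "\<And>x. x \<in> K \<Longrightarrow> \<bar>g x\<bar> \<le> c" unfolding bounded_real by blast
  have "g x < \<bar>c\<bar> + 1" for x using c[of x] K(2)[of x] by (cases "x \<in> K") auto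
  then show thesis by (intro that[of "\<bar>c\<bar> + 1"]) auto
qed

lemma superlevel:
  assumes g: "test_function g" and r: "0 \<le> r"
  shows "{x. r < g x} \<in> sets M" "compact (closure {x. r < g x})" "emeasure M {x. r < g x} < \<infinity>"
proof -
  obtain K where K: "compact K" "\<And>x. x \<notin> K \<Longrightarrow> g x = 0" using g by (auto simp: test_function_def)
  have sub: "{x. r < g x} \<subseteq> K"
  proof
    fix x assume "x \<in> {x. r < g x}"
    then show "x \<in> K" using K(2)[of x] r by (cases "x \<in> K") auto
  qed
  then have cl: "closure {x. r < g x} \<subseteq> K" using compact_imp_closed[OF K(1)] by (rule closure_minimal)
  then show "compact (closure {x. r < g x})" 
    using compact_Int_closed[OF K(1) closed_closure, of "{x. r < g x}"] by (simp only: inf.absorb2)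
  have "{x. r < g x} = g -` {r<..} \<inter> space M" by (auto simp: space_M)
  then show "{x. r < g x} \<in> sets M" using test_functionD(3)[OF g] by simp
  obtain x0 R where R: "K \<subseteq> ball x0 R" using compact_imp_bounded[OF K(1)] bounded_subset_ballD[where S=K] by blast
  have "emeasure M {x. r < g x} \<le> emeasure M (ball x0 R)" using sub R by (intro emeasure_mono) (auto simp: sets_M)
  also have "\<dots> < \<infinity>" using mms by (auto simp: metric_measure_space_def)
  finally show "emeasure M {x. r < g x} < \<infinity>" .
qed

definition level_mass :: "('a \<Rightarrow> real) \<Rightarrow> real \<Rightarrow> real" where
  "level_mass g r = measure M {x. r < g x}"

lemma emeasure_level:
  assumes "test_function g" "0 \<le> r"
  shows "emeasure M {x. r < g x} = ennreal (level_mass g r)"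
  unfolding level_mass_def using superlevel(3)[OF assms] by (intro emeasure_eq_ennreal_measure) auto

lemma level_mass_antimono:
  assumes "test_function g" "0 \<le> r" "r \<le> s"
  shows "level_mass g s \<le> level_mass g r"
proof -
  have "emeasure M {x. s < g x} \<le> emeasure M {x. r < g x}"
    by (rule emeasure_mono[OF _ superlevel(1)[OF assms(1,2)]]) (use assms(3) in auto)
  then have "ennreal (level_mass g s) \<le> ennreal (level_mass g r)"
    using emeasure_level[OF assms(1), of r] emeasure_level[OF assms(1), of s] assms(2,3) by simp
  then show ?thesis by (simp add: level_mass_def)
qed

lemma level_indicator_measurable:
  assumes g: "test_function g"
  shows "(\<lambda>(r, x). indicator {0<..} (g x - r) :: ennreal) \<in> borel_measurable (lborel \<Otimes>\<^sub>M M)"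
proof -
  have 1: "fst \<in> borel_measurable (lborel \<Otimes>\<^sub>M M)"
    using measurable_fst[of lborel M] measurable_cong_sets[OF refl sets_lborel] by blast
  have 2: "(\<lambda>z. g (snd z)) \<in> borel_measurable (lborel \<Otimes>\<^sub>M M)"
    using measurable_compose[OF measurable_snd test_functionD(3)[OF g]] by auto
  have "(\<lambda>z. g (snd z) - fst z) \<in> borel_measurable (lborel \<Otimes>\<^sub>M M)" using 1 2 by (intro borel_measurable_diff)
  then have "(\<lambda>z. indicator {0<..} (g (snd z) - fst z) :: ennreal) \<in> borel_measurable (lborel \<Otimes>\<^sub>M M)"
    by (rule measurable_compose) measurable
  then show ?thesis by (simp add: case_prod_beta')
qed

text \<open>The weight is the derivative of r^m and \<open>b\<close> exceeds all values of
  \<open>g\<close>, so Fubini gives the integral of g^m. The left side is shaped as in the coarea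
  inequality, with the linear isoperimetric bound in place of the perimeter.\<close>

lemma layer_cake:
  assumes g: "test_function g" and b: "\<And>x. g x < b"
  shows "(\<integral>\<^sup>+ r\<in>{0<..<b}. ennreal (real m * (max 0 r) ^ (m - 1)) * (ennreal h * (\<integral>\<^sup>+ x. indicator {r<..} (g x) \<partial>M)) \<partial>lborel)
     = ennreal h * (\<integral>\<^sup>+ x. ennreal (g x ^ m) \<partial>M)"
proof -
  interpret pair_sigma_finite lborel M ..
  note [measurable] = test_functionD(3)[OF g]
  let ?\<psi> = "\<lambda>r::real. ennreal (real m * (max 0 r) ^ (m - 1))"
  let ?W = "\<lambda>r x. ?\<psi> r * indicator {0<..<b} r * (ennreal h * indicator {0<..} (g x - r))"
  have Wm: "(\<lambda>(r, x). ?W r x) \<in> borel_measurable (lborel \<Otimes>\<^sub>M M)"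
  proof -
    have 1: "fst \<in> borel_measurable (lborel \<Otimes>\<^sub>M M)"
      using measurable_fst[of lborel M] measurable_cong_sets[OF refl sets_lborel] by blast
    have 2: "(\<lambda>z. ?\<psi> (fst z)) \<in> borel_measurable (lborel \<Otimes>\<^sub>M M)" by (rule measurable_compose[OF 1]) measurable
    have 3: "(\<lambda>z. indicator {0<..<b} (fst z) :: ennreal) \<in> borel_measurable (lborel \<Otimes>\<^sub>M M)"
      by (rule measurable_compose[OF 1]) measurable
    show ?thesis using level_indicator_measurable[OF g] unfolding case_prod_beta
      by (intro borel_measurable_times_ennreal borel_measurable_const 2 3)
  qed
  have i: "indicator {r<..} (g x) = (indicator {0<..} (g x - r) :: ennreal)" for r x by (auto simp: indicator_def)
  have "(\<integral>\<^sup>+ r\<in>{0<..<b}. ?\<psi> r * (ennreal h * (\<integral>\<^sup>+ x. indicator {r<..} (g x) \<partial>M)) \<partial>lborel)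
      = (\<integral>\<^sup>+ r. \<integral>\<^sup>+ x. ?W r x \<partial>M \<partial>lborel)"
  proof (rule nn_integral_cong)
    fix r
    have [measurable]: "(\<lambda>x. indicator {0<..} (g x - r) :: ennreal) \<in> borel_measurable M" by measurable
    have "(\<integral>\<^sup>+ x. ?W r x \<partial>M) = ?\<psi> r * indicator {0<..<b} r * (\<integral>\<^sup>+ x. ennreal h * indicator {0<..} (g x - r) \<partial>M)"
      by (rule nn_integral_cmult) measurable
    also have "(\<integral>\<^sup>+ x. ennreal h * indicator {0<..} (g x - r) \<partial>M) = ennreal h * (\<integral>\<^sup>+ x. indicator {0<..} (g x - r) \<partial>M)"
      by (rule nn_integral_cmult) measurable
    finally show "?\<psi> r * (ennreal h * (\<integral>\<^sup>+ x. indicator {r<..} (g x) \<partial>M)) * indicator {0<..<b} r = (\<integral>\<^sup>+ x. ?W r x \<partial>M)"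
      unfolding i by (simp add: mult_ac)
  qed
  also have "\<dots> = (\<integral>\<^sup>+ x. \<integral>\<^sup>+ r. ?W r x \<partial>lborel \<partial>M)"
    by (rule Fubini'[symmetric, OF Wm])
  also have "\<dots> = (\<integral>\<^sup>+ x. ennreal h * ennreal (g x ^ m) \<partial>M)"
  proof (rule nn_integral_cong)
    fix x
    have gx: "0 \<le> g x" "g x < b" using test_functionD(2)[OF g] b by auto
    have "(\<integral>\<^sup>+ r. ?W r x \<partial>lborel) = (\<integral>\<^sup>+ r. ennreal h * (ennreal (real m * (max 0 r) ^ (m - 1)) * indicator {0..g x} r) \<partial>lborel)"
    proof (rule nn_integral_cong_AE)
      show "AE r in lborel. ?W r x = ennreal h * (ennreal (real m * (max 0 r) ^ (m - 1)) * indicator {0..g x} r)"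
        using AE_lborel_singleton[of "0::real"] AE_lborel_singleton[of "g x"]
        by eventually_elim (use gx in \<open>auto simp: indicator_def mult_ac\<close>)
    qed
    also have "\<dots> = ennreal h * (\<integral>\<^sup>+ r. ennreal (real m * (max 0 r) ^ (m - 1)) * indicator {0..g x} r \<partial>lborel)"
    proof -
      have "(\<lambda>r. ennreal (real m * (max 0 r) ^ (m - 1)) * indicator {0..g x} r) \<in> borel_measurable borel" by measurable
      then show ?thesis by (intro nn_integral_cmult) simp
    qed
    also have "(\<integral>\<^sup>+ r. ennreal (real m * (max 0 r) ^ (m - 1)) * indicator {0..g x} r \<partial>lborel) = g x ^ m - 0 ^ m"
    proof (rule nn_integral_FTC_Icc)
      fix r assume r: "r \<in> {0..g x}"
      have "((\<lambda>r. r ^ m) has_real_derivative real m * r ^ (m - 1)) (at r)"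
        by (auto intro!: derivative_eq_intros)
      then show "((\<lambda>r. r ^ m) has_real_derivative real m * (max 0 r) ^ (m - 1)) (at r)"
        using r by (simp add: max_def)
    qed (use gx in auto)
    also have "g x ^ m - 0 ^ m = g x ^ m" using m by (simp add: zero_power)
    finally show "(\<integral>\<^sup>+ r. ?W r x \<partial>lborel) = ennreal h * ennreal (g x ^ m)" .
  qed
  also have "\<dots> = ennreal h * (\<integral>\<^sup>+ x. ennreal (g x ^ m) \<partial>M)" by (rule nn_integral_cmult) measurable
  finally show ?thesis .
qed

text \<open>A Poincare inequality of Cheeger type. The coarea inequality yields h times the integral
  of g^m on the left and the integral of m g^(m-1) lip g on the right; a Young type splitting bounds
  the latter by half of the left side plus a multiple of the energy, and the half is
  absorbed.\<close>

lemma test_function_norm_bound: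
  assumes g: "test_function g" and A: "(\<integral>\<^sup>+ x. lip g x ^ m \<partial>M) \<le> ennreal A" "A > 0"
  shows "(\<integral>\<^sup>+ x. ennreal (g x ^ m) \<partial>M) \<le> ennreal (2 * real m * (2 * real m / h) ^ (m - 1) / h * A)"
proof -
  note D = test_functionD[OF g]
  note [measurable] = D(3,4)
  obtain b where b: "b > 0" "\<And>x. g x < b" using test_function_bounded[OF g] by blast
  define C where "C = real m * (2 * real m / h) ^ (m - 1)"
  have C: "C > 0" using pos m by (simp add: C_def)
  let ?\<phi> = "\<lambda>r. ennreal h * (\<integral>\<^sup>+ x. indicator {r<..} (g x) \<partial>M)"
  let ?\<psi> = "\<lambda>r::real. ennreal (real m * (max 0 r) ^ (m - 1))"
  let ?I = "\<integral>\<^sup>+ x. ennreal (g x ^ m) \<partial>M"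
  have lev: "(\<integral>\<^sup>+ x. indicator {r<..} (g x) \<partial>M) = emeasure M {x. r < g x}" for r
  proof -
    have "(\<integral>\<^sup>+ x. indicator {r<..} (g x) \<partial>M) = (\<integral>\<^sup>+ x. indicator {x. r < g x} x \<partial>M)"
      by (rule nn_integral_cong) (auto simp: indicator_def)
    also have "\<dots> = emeasure M {x. r < g x}"
    proof (rule nn_integral_indicator)
      have "{x. r < g x} = g -` {r<..} \<inter> space M" by (auto simp: space_M)
      then show "{x. r < g x} \<in> sets M" by simp
    qed
    finally show ?thesis .
  qed
  \<comment> \<open>Absorption is a subtraction and is legitimate only because this integral is
    finite.\<close>
  have fin: "?I < \<infinity>"
  proof -
    have S: "{x. 0 < g x} \<in> sets M" "emeasure M {x. 0 < g x} < \<infinity>" using superlevel[OF g, of 0] by auto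
    have "?I \<le> (\<integral>\<^sup>+ x. ennreal (b ^ m) * indicator {x. 0 < g x} x \<partial>M)"
    proof (rule nn_integral_mono)
      fix x
      show "ennreal (g x ^ m) \<le> ennreal (b ^ m) * indicator {x. 0 < g x} x"
      proof (cases "0 < g x")
        case True
        then show ?thesis using b(2)[of x] by (auto intro!: ennreal_leI power_mono)
      next
        case False
        then have "g x = 0" using D(2)[of x] by simp
        then show ?thesis using m by (simp add: zero_power)
      qed
    qed
    also have "\<dots> = ennreal (b ^ m) * emeasure M {x. 0 < g x}" using S by (simp add: nn_integral_cmult_indicator)
    also have "\<dots> < \<infinity>" using S by (simp add: ennreal_mult_less_top)
    finally show ?thesis .
  qed
  then obtain i where i: "?I = ennreal i" "i \<ge> 0" by (cases ?I) auto
  have "ennreal h * ?I = (\<integral>\<^sup>+ r\<in>{0<..<b}. ?\<psi> r * ?\<phi> r \<partial>lborel)" by (rule layer_cake[OF g b(2), symmetric])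
  also have "\<dots> \<le> (\<integral>\<^sup>+ x\<in>{x. 0 < g x \<and> g x < b}. ?\<psi> (g x) * lip g x \<partial>M)"
  proof (rule coarea_inequality[OF mms D(1)])
    have ind: "indicator {r<..} (g x) = (indicator {0<..} (g x - r) :: ennreal)" for r x by (auto simp: indicator_def)
    have "(\<lambda>r. \<integral>\<^sup>+ x. indicator {0<..} (g x - r) \<partial>M) \<in> borel_measurable lborel"
      by (rule borel_measurable_nn_integral[OF level_indicator_measurable[OF g]])
    then show "?\<phi> \<in> borel_measurable borel" unfolding ind by simp
    show "?\<phi> r \<le> perimeter M {x. r < g x}" if "0 < r" "r < b" for r
      unfolding lev using linear_isoperimetry superlevel(1,2)[OF g, of r] that
      by (cases "emeasure M {x. r < g x} = 0") (auto simp: zero_less_iff_neq_zero)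
    show "?\<psi> r \<le> ?\<psi> s" if "0 < r" "r \<le> s" "s < b" for r s
      using that by (intro ennreal_leI mult_left_mono power_mono) auto
  qed auto
  also have "\<dots> \<le> (\<integral>\<^sup>+ x. ennreal (h / 2) * ennreal (g x ^ m) + ennreal C * lip g x ^ m \<partial>M)"
  proof (rule nn_integral_mono)
    fix x
    define L where "L = enn2real (lip g x)"
    have L: "L \<ge> 0" "lip g x = ennreal L" unfolding L_def using D(5)[of x] by auto
    have G: "g x \<ge> 0" by (rule D(2))
    have "real m * g x ^ (m - 1) * L \<le> h / 2 * g x ^ m + C * L ^ m"
    \<comment> \<open>If m L \<le> (h/2) g the first summand suffices; otherwise g \<le> (2 m / h)
      L, and inserting this into g^(m-1) produces the constant \<open>C\<close>.\<close>
    proof (cases "real m * L \<le> h / 2 * g x")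
      case True
      have "real m * g x ^ (m - 1) * L = g x ^ (m - 1) * (real m * L)" by simp
      also have "\<dots> \<le> g x ^ (m - 1) * (h / 2 * g x)" using True G by (intro mult_left_mono) auto
      also have "\<dots> = h / 2 * g x ^ m" using m by (cases m) auto
      finally show ?thesis using C L by (simp add: add_increasing2)
    next
      case False
      then have "g x \<le> 2 * real m / h * L" using pos by (simp add: field_simps)
      then have "g x ^ (m - 1) \<le> (2 * real m / h * L) ^ (m - 1)" using G by (intro power_mono) auto
      then have "real m * g x ^ (m - 1) * L \<le> real m * (2 * real m / h * L) ^ (m - 1) * L"
        using L by (intro mult_right_mono mult_left_mono) auto
      also have "\<dots> = C * L ^ m" 
        unfolding C_def power_mult_distrib[of "2 * real m / h" L] using m by (cases m) auto
      finally show ?thesis using G pos by (simp add: add_increasing)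
    qed
    then have "ennreal (real m * g x ^ (m - 1) * L) \<le> ennreal (h / 2 * g x ^ m + C * L ^ m)" by (rule ennreal_leI)
    also have "ennreal (h / 2 * g x ^ m + C * L ^ m) = ennreal (h / 2 * g x ^ m) + ennreal (C * L ^ m)"
      using G L C pos by (intro ennreal_plus) auto
    also have "\<dots> = ennreal (h / 2) * ennreal (g x ^ m) + ennreal C * lip g x ^ m"
    proof -
      have "0 \<le> h / 2" "0 \<le> g x ^ m" "0 \<le> C" "0 \<le> L ^ m" using G L C pos by auto
      then show ?thesis unfolding L(2) ennreal_power[OF L(1)] by (metis ennreal_mult)
    qed
    also have "ennreal (real m * g x ^ (m - 1) * L) = ?\<psi> (g x) * lip g x"
      using G L by (simp add: ennreal_mult max_def)
    finally have "?\<psi> (g x) * lip g x \<le> ennreal (h / 2) * ennreal (g x ^ m) + ennreal C * lip g x ^ m" .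
    then show "?\<psi> (g x) * lip g x * indicator {x. 0 < g x \<and> g x < b} x \<le> ennreal (h / 2) * ennreal (g x ^ m) + ennreal C * lip g x ^ m"
      by (auto simp: indicator_def)
  qed
  also have "\<dots> = ennreal (h / 2) * ?I + ennreal C * (\<integral>\<^sup>+ x. lip g x ^ m \<partial>M)"
    by (simp add: nn_integral_add nn_integral_cmult)
  also have "\<dots> \<le> ennreal (h / 2) * ?I + ennreal C * ennreal A"
    using A by (intro add_mono mult_left_mono) auto
  also have "\<dots> = ennreal (h / 2 * i) + ennreal (C * A)"
  proof -
    have "0 \<le> h / 2" "0 \<le> C" "0 \<le> A" using pos C A by auto
    then show ?thesis unfolding i(1) using i(2) by (metis ennreal_mult)
  qed
  also have "\<dots> = ennreal (h / 2 * i + C * A)"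
    using i pos C A by (intro ennreal_plus[symmetric]) auto
  finally have "ennreal (h * i) \<le> ennreal (h / 2 * i + C * A)"
    using i pos by (simp add: ennreal_mult)
  then have "h * i \<le> h / 2 * i + C * A"
    using i pos C A by (subst (asm) ennreal_le_iff) (auto intro!: add_nonneg_nonneg)
  then have "i \<le> 2 * C / h * A" using pos by (simp add: field_simps)
  also have "2 * C / h * A = 2 * real m * (2 * real m / h) ^ (m - 1) / h * A" by (simp add: C_def)
  finally show ?thesis using i by (simp add: ennreal_leI)
qed


text \<open>Every superlevel set inside the slab has mass between those at \<open>t\<close> and at
  \<open>s\<close>, hence below \<open>v0\<close> and of perimeter at least a common constant
  \<open>c\<close>. The coarea inequality with weight 1 gives (t - s) c as lower bound for the
  integral of the slope over the slab, and Hoelder's inequality turns this into the energy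
  estimate.\<close>

lemma slab_estimate:
  assumes g: "test_function g" and st: "0 \<le> s" "s < t" and lev: "level_mass g s < v0" "0 < level_mass g t"
    and e: "(\<integral>\<^sup>+ x\<in>{x. s < g x \<and> g x < t}. lip g x ^ m \<partial>M) \<le> ennreal e" "e \<ge> 0"
  shows "(t - s) ^ m * (B * level_mass g t) ^ (m - 1) \<le> e * (level_mass g s - level_mass g t) ^ (m - 1)"
proof -
  note D = test_functionD[OF g]
  note [measurable] = D(3,4)
  define c where "c = root m ((B * level_mass g t) ^ (m - 1))"
  have cm: "c ^ m = (B * level_mass g t) ^ (m - 1)" "c \<ge> 0"
    unfolding c_def using m pos lev by auto
  let ?S = "{x. s < g x \<and> g x < t}"
  have Sm: "?S \<in> sets M"
  proof -
    have "?S = g -` {s<..<t} \<inter> space M" by (auto simp: space_M)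
    then show ?thesis by simp
  qed
  have "ennreal ((t - s) * c) = (\<integral>\<^sup>+ r\<in>{s<..<t}. 1 * ennreal c \<partial>lborel)"
    using st cm by (subst mult.commute) (simp add: nn_integral_cmult_indicator ennreal_mult)
  also have "\<dots> \<le> (\<integral>\<^sup>+ x\<in>?S. 1 * lip g x \<partial>M)"
  proof (rule coarea_inequality[OF mms D(1)])
    fix r assume r: "s < r" "r < t"
    have lr: "level_mass g t \<le> level_mass g r" "level_mass g r \<le> level_mass g s"
      using r st by (auto intro!: level_mass_antimono[OF g])
    have "ennreal (c ^ m) \<le> ennreal ((B * level_mass g r) ^ (m - 1))"
      unfolding cm using lr lev pos by (intro ennreal_leI power_mono mult_left_mono) auto
    also have "\<dots> \<le> perimeter M {x. r < g x} ^ m"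
      using superlevel[OF g, of r] emeasure_level[OF g, of r] r st lr lev
      by (intro power_isoperimetry) auto
    finally have pw: "ennreal c ^ m \<le> perimeter M {x. r < g x} ^ m" using cm by (simp add: ennreal_power)
    show "ennreal c \<le> perimeter M {x. r < g x}"
    proof (rule ccontr)
      assume "\<not> ennreal c \<le> perimeter M {x. r < g x}"
      then have lt: "perimeter M {x. r < g x} < ennreal c" by simp
      then obtain p where p: "perimeter M {x. r < g x} = ennreal p" "p \<ge> 0"
        by (cases "perimeter M {x. r < g x}") auto
      then have "p < c" using lt by (simp add: ennreal_less_iff)
      then have "p ^ m < c ^ m" using p m by (intro power_strict_mono) auto
      then show False using pw p cm by (simp add: ennreal_power)
    qed
  qed auto
  finally have L: "ennreal ((t - s) * c) \<le> (\<integral>\<^sup>+ x\<in>?S. ennreal (enn2real (lip g x)) \<partial>M)" by (simp add: D(5))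
  have w: "emeasure M ?S \<le> ennreal (level_mass g s - level_mass g t)"
  proof -
    have t0: "0 \<le> t" using st by simp
    have "emeasure M ?S \<le> emeasure M ({x. s < g x} - {x. t < g x})"
      by (rule emeasure_mono[OF _ sets.Diff[OF superlevel(1)[OF g st(1)] superlevel(1)[OF g t0]]]) auto
    also have "\<dots> = emeasure M {x. s < g x} - emeasure M {x. t < g x}"
    proof (rule emeasure_Diff[OF _ superlevel(1)[OF g st(1)] superlevel(1)[OF g t0]])
      show "emeasure M {x. t < g x} \<noteq> \<infinity>" using superlevel(3)[OF g t0] by simp
      show "{x. t < g x} \<subseteq> {x. s < g x}" using st(2) by fastforce
    qed
    also have "\<dots> = ennreal (level_mass g s - level_mass g t)"
      unfolding emeasure_level[OF g st(1)] emeasure_level[OF g t0] using lev(2) by (intro ennreal_minus) simp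
    finally show ?thesis .
  qed
  have "((t - s) * c) ^ m \<le> e * (level_mass g s - level_mass g t) ^ (m - 1)"
  proof (rule Jensen_power_integral[OF _ _ Sm m _ e(2) w _ L])
    show "(\<integral>\<^sup>+ x\<in>?S. ennreal (enn2real (lip g x) ^ m) \<partial>M) \<le> ennreal e"
      using e(1) D(5) by (simp add: ennreal_power[symmetric])
    show "0 \<le> level_mass g s - level_mass g t" using level_mass_antimono[OF g, of s t] st by simp
  qed (use st cm in auto)
  then show ?thesis by (simp add: power_mult_distrib cm)
qed


text \<open>Divides the range of levels into k equal slabs whose energies add up to at most
  \<open>A\<close>, applies the discrete decay estimate, and lets k tend to infinity. A zero mass at
  the upper level is treated apart, since the discrete estimate divides by the masses.\<close>

lemma level_mass_decay:
  assumes g: "test_function g" and A: "(\<integral>\<^sup>+ x. lip g x ^ m \<partial>M) \<le> ennreal A" "A > 0"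
    and s: "0 \<le> s" "level_mass g s < v0" and S: "S > 0"
  shows "exp (B * root (m - 1) (S ^ m / A)) * level_mass g (s + S) \<le> level_mass g s"
proof (cases "level_mass g (s + S) = 0")
  case True
  then show ?thesis by (simp add: level_mass_def)
next
  case False
  then have lk: "0 < level_mass g (s + S)" by (simp add: level_mass_def less_le)
  note D = test_functionD[OF g]
  note [measurable] = D(3,4)
  define Q where "Q = B * root (m - 1) (S ^ m / A)"
  have est: "(1 + Q / real k) ^ k * level_mass g (s + S) \<le> level_mass g s" if k: "k > 0" for k
  proof -
    define t where "t i = s + real i * (S / real k)" for i
    \<comment> \<open>Slabs open at both ends are pairwise disjoint, so their energies sum to at
      most the total; the energy on the level sets g = t i is discarded.\<close>
    define Z where "Z i = {x. t i < g x \<and> g x < t (Suc i)}" for i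
    define e where "e i = enn2real (\<integral>\<^sup>+ x\<in>Z i. lip g x ^ m \<partial>M)" for i
    have tmono: "t i \<le> t j" if "i \<le> j" for i j
      using that S k by (auto simp: t_def intro!: mult_right_mono divide_right_mono)
    have t0: "t 0 = s" and tk: "t k = s + S" using k by (auto simp: t_def)
    have tpos: "t i \<ge> 0" for i using s S k by (simp add: t_def)
    have Zm [measurable]: "Z i \<in> sets M" for i
    proof -
      have "Z i = g -` {t i<..<t (Suc i)} \<inter> space M" by (auto simp: space_M Z_def)
      then show ?thesis by simp
    qed
    have fin: "(\<integral>\<^sup>+ x\<in>Z i. lip g x ^ m \<partial>M) < \<infinity>" for i
    proof -
      have "(\<integral>\<^sup>+ x\<in>Z i. lip g x ^ m \<partial>M) \<le> (\<integral>\<^sup>+ x. lip g x ^ m \<partial>M)"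
        by (rule nn_integral_mono) (simp add: indicator_def)
      also have "\<dots> < \<infinity>" using A(1) by (rule le_less_trans) simp
      finally show ?thesis .
    qed
    have ee: "ennreal (e i) = (\<integral>\<^sup>+ x\<in>Z i. lip g x ^ m \<partial>M)" for i using fin[of i] by (simp add: e_def)
    have "ennreal (\<Sum>i<k. e i) = (\<Sum>i<k. \<integral>\<^sup>+ x\<in>Z i. lip g x ^ m \<partial>M)"
      unfolding ee[symmetric] by (rule sum_ennreal[symmetric]) (simp add: e_def)
    also have "\<dots> = (\<integral>\<^sup>+ x. (\<Sum>i<k. lip g x ^ m * indicator (Z i) x) \<partial>M)"
      by (rule nn_integral_sum[symmetric]) measurable
    also have "\<dots> \<le> (\<integral>\<^sup>+ x. lip g x ^ m \<partial>M)"
    proof (rule nn_integral_mono)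
      fix x
      have "(\<Sum>i<k. indicator (Z i) x :: ennreal) \<le> 1"
      proof (cases "\<exists>i<k. x \<in> Z i")
        case True
        then obtain i where i: "i < k" "x \<in> Z i" by blast
        have "x \<notin> Z j" if "j \<noteq> i" for j
        proof (cases "i < j")
          case True
          then have "t (Suc i) \<le> t j" by (intro tmono) simp
          then show ?thesis using i(2) unfolding Z_def by simp
        next
          case False
          then have "t (Suc j) \<le> t i" using that by (intro tmono) simp
          then show ?thesis using i(2) unfolding Z_def by simp
        qed
        then have "(indicator (Z j) x :: ennreal) = (if j = i then 1 else 0)" for j using i(2) by simp
        then have "(\<Sum>j<k. indicator (Z j) x :: ennreal) = (\<Sum>j<k. if j = i then 1 else 0)" by simp
        also have "\<dots> = 1" using i(1) by simp
        finally show ?thesis by simp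
      next
        case False
        then show ?thesis by (simp add: indicator_def)
      qed
      then have "lip g x ^ m * (\<Sum>i<k. indicator (Z i) x) \<le> lip g x ^ m * 1" by (intro mult_left_mono) auto
      then show "(\<Sum>i<k. lip g x ^ m * indicator (Z i) x) \<le> lip g x ^ m" by (simp add: sum_distrib_left)
    qed
    also have "\<dots> \<le> ennreal A" by fact
    finally have sumA: "(\<Sum>i<k. e i) \<le> A" using A(2) by (subst (asm) ennreal_le_iff) auto
    have "(1 + B * root (m - 1) (S ^ Suc (m - 1) / A) / real k) ^ k * level_mass g (t k) \<le> level_mass g (t 0)"
    proof (rule level_decay_step[where e=e, OF k _ _ _ sumA A(2) S pos(2)])
      show "0 < level_mass g (t i)" if "i \<le> k" for i
        using lk level_mass_antimono[OF g tpos[of i], of "t k"] tmono[OF that] tk by simp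
      show "level_mass g (t (Suc i)) \<le> level_mass g (t i)" if "i < k" for i
        using tmono[of i "Suc i"] by (intro level_mass_antimono[OF g tpos]) auto
      fix i assume i: "i < k"
      have d: "t (Suc i) - t i = S / real k" by (simp add: t_def algebra_simps add_divide_distrib)
      have "level_mass g (t i) \<le> level_mass g s"
        using tmono[of 0 i] t0 s by (intro level_mass_antimono[OF g]) auto
      then have "level_mass g (t i) < v0" using s(2) by simp
      moreover have "0 < level_mass g (t (Suc i))"
        using lk level_mass_antimono[OF g tpos[of "Suc i"], of "t k"] tmono[of "Suc i" k] i tk by simp
      moreover have "t i < t (Suc i)" using d divide_pos_pos[of S "real k"] S k by linarith
      moreover have "(\<integral>\<^sup>+ x\<in>{x. t i < g x \<and> g x < t (Suc i)}. lip g x ^ m \<partial>M) \<le> ennreal (e i)"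
        unfolding ee Z_def by simp
      ultimately have "(t (Suc i) - t i) ^ m * (B * level_mass g (t (Suc i))) ^ (m - 1)
          \<le> e i * (level_mass g (t i) - level_mass g (t (Suc i))) ^ (m - 1)"
        by (intro slab_estimate[OF g tpos]) (assumption+, simp only: e_def enn2real_nonneg)
      then show "(S / real k) ^ Suc (m - 1) * (B * level_mass g (t (Suc i))) ^ (m - 1)
          \<le> e i * (level_mass g (t i) - level_mass g (t (Suc i))) ^ (m - 1)"
        unfolding d using m by simp
    qed (use m in \<open>auto simp: e_def\<close>)
    then show ?thesis using t0 tk m by (simp add: Q_def)
  qed
  have "(\<lambda>k. (1 + Q / real k) ^ k * level_mass g (s + S)) \<longlonglongrightarrow> exp Q * level_mass g (s + S)"
    by (intro tendsto_mult tendsto_exp_limit_sequentially tendsto_const)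
  then have "exp Q * level_mass g (s + S) \<le> level_mass g s"
  proof (rule LIMSEQ_le_const2, intro exI allI impI)
    fix k :: nat assume "1 \<le> k"
    then show "(1 + Q / real k) ^ k * level_mass g (s + S) \<le> level_mass g s" by (intro est) simp
  qed
  then show ?thesis by (simp add: Q_def)
qed

end

section \<open>The Moser-Trudinger integrand and its integral for test functions\<close>

definition moser_integrand :: "nat \<Rightarrow> real \<Rightarrow> real \<Rightarrow> real" where
  "moser_integrand m \<alpha> v = exp (\<alpha> * \<bar>v\<bar> powr (real m / (real m - 1))) - P_poly m (\<alpha> * \<bar>v\<bar> powr (real m / (real m - 1)))"

lemma moser_integrand_le_exp:
  assumes "\<alpha> > 0"
  shows "moser_integrand m \<alpha> v \<le> exp (\<alpha> * \<bar>v\<bar> powr (real m / (real m - 1)))"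
  unfolding moser_integrand_def P_poly_def using assms by (auto intro!: sum_nonneg)

text \<open>Removing the polynomial leaves a factor t^(m-1) with t = \<alpha> |v|^q, and q (m - 1) =
  m. So on bounded values the integrand is controlled by |v|^m, that is, by the L^m norm.\<close>

lemma moser_integrand_le_power:
  assumes m: "m \<ge> 2" and \<alpha>: "\<alpha> > 0" and v: "\<bar>v\<bar> \<le> s"
  shows "moser_integrand m \<alpha> v \<le> \<alpha> ^ (m - 1) * exp (\<alpha> * s powr (real m / (real m - 1))) * \<bar>v\<bar> ^ m"
proof -
  define q where "q = real m / (real m - 1)"
  have q: "q > 0" "q * real (m - 1) = real m" using m by (auto simp: q_def of_nat_diff)
  define t where "t = \<alpha> * \<bar>v\<bar> powr q"
  have tp: "t ^ (m - 1) = \<alpha> ^ (m - 1) * \<bar>v\<bar> ^ m"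
  proof (cases "v = 0")
    case True
    then show ?thesis using m by (simp add: t_def zero_power)
  next
    case False
    then have "(\<bar>v\<bar> powr q) ^ (m - 1) = \<bar>v\<bar> ^ m"
      using q(2) by (simp add: powr_realpow[symmetric] powr_powr)
    then show ?thesis by (simp add: t_def power_mult_distrib)
  qed
  have "moser_integrand m \<alpha> v \<le> t ^ (m - 1) * exp t"
    unfolding moser_integrand_def q_def[symmetric] t_def using m \<alpha> by (intro exp_minus_P_poly_le) auto
  also have "\<dots> \<le> t ^ (m - 1) * exp (\<alpha> * s powr q)"
    unfolding t_def using v q \<alpha> by (intro mult_left_mono) (auto intro!: powr_mono2)
  finally show ?thesis unfolding tp q_def by (simp add: mult_ac)
qed

lemma moser_integrand_continuous:
  assumes m: "m \<ge> 2"
  shows "continuous_on UNIV (moser_integrand m \<alpha>)"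
  unfolding moser_integrand_def P_poly_def
  using m by (intro continuous_intros continuous_on_powr') auto

context isoperimetric_space begin

lemma level_mass_exp_bound:
  assumes g: "test_function g" and A: "(\<integral>\<^sup>+ x. lip g x ^ m \<partial>M) \<le> ennreal A" "A > 0"
    and s: "0 \<le> s" "level_mass g s < v0" and S: "S \<ge> 0"
  shows "level_mass g (s + S) \<le> v0 * exp (- (B * root (m - 1) (1 / A)) * S powr (real m / (real m - 1)))"
proof (cases "S = 0")
  case True
  then show ?thesis using s by simp
next
  case False
  define Q where "Q = B * root (m - 1) (S ^ m / A)"
  have Sp: "S > 0" using S False by simp
  have "root (m - 1) (S ^ m) = (S ^ m) powr (1 / real (m - 1))"
    using m Sp by (intro root_powr_inverse) auto
  also have "\<dots> = S powr (real m / (real m - 1))"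
    using Sp m by (simp add: powr_realpow[symmetric] powr_powr of_nat_diff)
  finally have "root (m - 1) (S ^ m / A) = root (m - 1) (1 / A) * S powr (real m / (real m - 1))"
    using m by (simp add: real_root_divide real_root_one)
  then have Q: "Q = B * root (m - 1) (1 / A) * S powr (real m / (real m - 1))" by (simp add: Q_def)
  have "exp Q * level_mass g (s + S) \<le> level_mass g s"
    unfolding Q_def by (rule level_mass_decay[OF g A s Sp])
  then have "exp Q * level_mass g (s + S) \<le> v0" using s by simp
  then have "exp (- Q) * (exp Q * level_mass g (s + S)) \<le> exp (- Q) * v0" by (intro mult_left_mono) auto
  then have "level_mass g (s + S) \<le> v0 * exp (- Q)" by (simp add: mult.assoc[symmetric] exp_add[symmetric] mult.commute)
  then show ?thesis by (simp add: Q)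
qed

text \<open>Splits at the level \<open>s0\<close>. Below it the integrand is at most a multiple of
  g^m; above it, unit layers contribute the exponential at their upper end times the mass above
  their lower end, and \<alpha> < \<beta> makes the series converge. All constants depend on
  \<open>A\<close>, not on \<open>g\<close>.\<close>

proposition test_function_moser_bound:
  assumes A: "A > 0" and \<alpha>: "0 < \<alpha>" "\<alpha> < B * root (m - 1) (1 / A)"
  shows "\<exists>C>0. \<forall>g. test_function g \<longrightarrow> (\<integral>\<^sup>+ x. lip g x ^ m \<partial>M) \<le> ennreal A \<longrightarrow>
           (\<integral>\<^sup>+ x. ennreal (moser_integrand m \<alpha> (g x)) \<partial>M) \<le> ennreal C"
proof -
  define q where "q = real m / (real m - 1)"
  define \<beta> where "\<beta> = B * root (m - 1) (1 / A)"
  define C1 where "C1 = 2 * real m * (2 * real m / h) ^ (m - 1) / h * A"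
  \<comment> \<open>Chosen for Chebyshev's inequality: s0^m times the mass above \<open>s0\<close>
    is at most C1 < C1 + 1 = s0^m v0, which is the strict bound that starts the decay.\<close>
  define s0 where "s0 = root m ((C1 + 1) / v0)"
  define a where "a i = exp (\<alpha> * (s0 + real i + 1) powr q) * exp (- \<beta> * real i powr q)" for i :: nat
  define c1 where "c1 = \<alpha> ^ (m - 1) * exp (\<alpha> * s0 powr q)"
  have q: "q \<ge> 1" using m by (simp add: q_def field_simps)
  have C1: "C1 > 0" unfolding C1_def using m pos A by (intro mult_pos_pos divide_pos_pos zero_less_power) auto
  have s0: "s0 > 0" "s0 ^ m = (C1 + 1) / v0" unfolding s0_def using m pos C1 by auto
  have c1: "c1 > 0" using \<alpha> by (simp add: c1_def)
  have sm: "summable a" unfolding a_def using \<alpha> q s0 by (intro summable_exp_tail) (auto simp: \<beta>_def)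
  have a0: "a i \<ge> 0" for i by (simp add: a_def)
  have T: "suminf a \<ge> 0" using sm a0 by (intro suminf_nonneg) auto
  show ?thesis
  proof (intro exI[of _ "c1 * C1 + v0 * suminf a"] conjI allI impI)
    show "0 < c1 * C1 + v0 * suminf a" using c1 C1 pos T by (intro add_pos_nonneg) auto
    fix g assume g: "test_function g" and E: "(\<integral>\<^sup>+ x. lip g x ^ m \<partial>M) \<le> ennreal A"
    note D = test_functionD[OF g]
    note [measurable] = D(3)
    have nb: "(\<integral>\<^sup>+ x. ennreal (g x ^ m) \<partial>M) \<le> ennreal C1"
      unfolding C1_def by (rule test_function_norm_bound[OF g E A])
    have lev: "level_mass g s0 < v0"
    proof -
      note S = superlevel(1)[OF g less_imp_le[OF s0(1)]]
      have "ennreal (s0 ^ m * level_mass g s0) = ennreal (s0 ^ m) * emeasure M {x. s0 < g x}"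
        using s0(1) emeasure_level[OF g, of s0] by (simp add: ennreal_mult level_mass_def)
      also have "\<dots> = (\<integral>\<^sup>+ x. ennreal (s0 ^ m) * indicator {x. s0 < g x} x \<partial>M)"
        by (rule nn_integral_cmult_indicator[OF S, symmetric])
      also have "\<dots> \<le> (\<integral>\<^sup>+ x. ennreal (g x ^ m) \<partial>M)"
        by (rule nn_integral_mono) (use s0(1) in \<open>auto simp: indicator_def intro!: ennreal_leI power_mono\<close>)
      also have "\<dots> \<le> ennreal C1" by (rule nb)
      finally have "s0 ^ m * level_mass g s0 \<le> C1" using C1 by (subst (asm) ennreal_le_iff) auto
      then have "(C1 + 1) / v0 * level_mass g s0 < C1 + 1" by (simp add: s0(2))
      then have "(C1 + 1) * level_mass g s0 < (C1 + 1) * v0" using pos by (simp add: field_simps)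
      then show ?thesis using C1 by simp
    qed
    let ?b = "\<lambda>i::nat. exp (\<alpha> * (s0 + real i + 1) powr q)"
    have pw: "ennreal (moser_integrand m \<alpha> (g x)) \<le> ennreal c1 * ennreal (g x ^ m) + (\<Sum>i. ennreal (?b i) * indicator {x. s0 + real i < g x} x)" for x
    proof (cases "g x \<le> s0")
      case True
      have "moser_integrand m \<alpha> (g x) \<le> c1 * g x ^ m"
        using moser_integrand_le_power[OF m \<alpha>(1), of "g x" s0] True D(2)[of x] by (simp add: c1_def q_def)
      then have "ennreal (moser_integrand m \<alpha> (g x)) \<le> ennreal (c1 * g x ^ m)" by (rule ennreal_leI)
      also have "\<dots> = ennreal c1 * ennreal (g x ^ m)" using c1 D(2)[of x] by (simp add: ennreal_mult)
      finally show ?thesis by (rule order_trans) simp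
    next
      case False
      \<comment> \<open>Ceiling minus one instead of floor: superlevel sets are strict, so each
        layer is open below and closed above.\<close>
      define i where "i = nat (\<lceil>g x - s0\<rceil> - 1)"
      have i: "s0 + real i < g x" "g x \<le> s0 + real i + 1" using False unfolding i_def by linarith+
      have "moser_integrand m \<alpha> (g x) \<le> exp (\<alpha> * \<bar>g x\<bar> powr q)"
        unfolding q_def by (rule moser_integrand_le_exp[OF \<alpha>(1)])
      also have "\<dots> \<le> ?b i" using i D(2)[of x] q \<alpha>(1) by (auto intro!: powr_mono2)
      finally have "ennreal (moser_integrand m \<alpha> (g x)) \<le> ennreal (?b i)" by (rule ennreal_leI)
      also have "\<dots> = (\<Sum>j\<in>{i}. ennreal (?b j) * indicator {x. s0 + real j < g x} x)" using i by simp
      also have "\<dots> \<le> (\<Sum>j. ennreal (?b j) * indicator {x. s0 + real j < g x} x)"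
        by (intro sum_le_suminf summableI) auto
      finally show ?thesis by (rule order_trans) simp
    qed
    have lm: "{x. s0 + real i < g x} \<in> sets M" for i using superlevel(1)[OF g, of "s0 + real i"] s0(1) by simp
    have "(\<integral>\<^sup>+ x. ennreal (moser_integrand m \<alpha> (g x)) \<partial>M)
      \<le> (\<integral>\<^sup>+ x. ennreal c1 * ennreal (g x ^ m) + (\<Sum>i. ennreal (?b i) * indicator {x. s0 + real i < g x} x) \<partial>M)"
      by (rule nn_integral_mono) (rule pw)
    also have "\<dots> = ennreal c1 * (\<integral>\<^sup>+ x. ennreal (g x ^ m) \<partial>M) + (\<Sum>i. ennreal (?b i) * emeasure M {x. s0 + real i < g x})"
      using lm by (simp add: nn_integral_add nn_integral_cmult nn_integral_suminf nn_integral_cmult_indicator)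
    also have "\<dots> \<le> ennreal c1 * ennreal C1 + (\<Sum>i. ennreal (v0 * a i))"
    proof (intro add_mono mult_left_mono nb suminf_le summableI)
      fix i :: nat
      have "level_mass g (s0 + real i) \<le> v0 * exp (- \<beta> * real i powr q)"
        unfolding \<beta>_def q_def using s0 lev by (intro level_mass_exp_bound[OF g E A]) auto
      then have "?b i * level_mass g (s0 + real i) \<le> ?b i * (v0 * exp (- \<beta> * real i powr q))" by (intro mult_left_mono) auto
      also have "\<dots> = v0 * a i" by (simp add: a_def)
      finally have "ennreal (?b i * level_mass g (s0 + real i)) \<le> ennreal (v0 * a i)" by (rule ennreal_leI)
      then show "ennreal (?b i) * emeasure M {x. s0 + real i < g x} \<le> ennreal (v0 * a i)"
        using emeasure_level[OF g, of "s0 + real i"] s0(1) by (simp add: ennreal_mult level_mass_def)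
    qed simp
    also have "(\<Sum>i. ennreal (v0 * a i)) = ennreal (v0 * suminf a)"
      using a0 pos sm by (intro suminf_ennreal_eq sums_mult summable_sums) auto
    also have "ennreal c1 * ennreal C1 + ennreal (v0 * suminf a) = ennreal (c1 * C1 + v0 * suminf a)"
      using c1 C1 pos T by (simp add: ennreal_mult ennreal_plus)
    finally show "(\<integral>\<^sup>+ x. ennreal (moser_integrand m \<alpha> (g x)) \<partial>M) \<le> ennreal (c1 * C1 + v0 * suminf a)" .
  qed
qed

end

section \<open>Approximation and the main theorem\<close>

text \<open>The coefficient of a^m can be brought as close to 1 as desired while the loss falls on
  c^m. In the cutoff estimate \<open>c\<close> tends to 0, whereas \<open>a\<close> carries an
  energy that may grow only slightly.\<close>

lemma power_add_le:
  fixes a c \<epsilon> :: real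
  assumes "a \<ge> 0" "c \<ge> 0" "\<epsilon> > 0"
  shows "(a + c) ^ m \<le> (1 + \<epsilon>) ^ m * a ^ m + (1 + 1 / \<epsilon>) ^ m * c ^ m"
proof (cases "c \<le> \<epsilon> * a")
  case True
  then have "(a + c) ^ m \<le> ((1 + \<epsilon>) * a) ^ m" using assms by (intro power_mono) (auto simp: algebra_simps)
  then show ?thesis using assms by (simp add: power_mult_distrib add_increasing2)
next
  case False
  then have "a \<le> c / \<epsilon>" using assms by (simp add: field_simps)
  then have "(a + c) ^ m \<le> ((1 + 1 / \<epsilon>) * c) ^ m" using assms by (intro power_mono) (auto simp: algebra_simps)
  then show ?thesis using assms by (simp add: power_mult_distrib add_increasing)
qed

definition cutoff :: "'a::metric_space \<Rightarrow> real \<Rightarrow> 'a \<Rightarrow> real" where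
  "cutoff x0 R x = max 0 (min 1 (2 - dist x x0 / R))"

lemma cutoff_range: "0 \<le> cutoff x0 R x" "cutoff x0 R x \<le> 1"
  by (auto simp: cutoff_def)

lemma cutoff_lipschitz:
  assumes "R > 0"
  shows "\<bar>cutoff x0 R x - cutoff x0 R y\<bar> \<le> dist x y / R"
proof -
  have "\<bar>cutoff x0 R x - cutoff x0 R y\<bar> \<le> \<bar>dist x x0 / R - dist y x0 / R\<bar>" unfolding cutoff_def by linarith
  also have "\<dots> = \<bar>dist x x0 - dist y x0\<bar> / R" using assms by (simp add: diff_divide_distrib[symmetric])
  also have "\<dots> \<le> dist x y / R"
    using assms abs_dist_diff_le[of x x0 y] by (intro divide_right_mono) (auto simp: dist_commute)
  finally show ?thesis .
qed

text \<open>The product rule in the affine form required by \<open>lip_le_affine\<close>. The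
  coefficient 1 in front of the increment of \<open>g\<close> matters, since it keeps the energy of
  the product close to that of \<open>g\<close>.\<close>

lemma cutoff_product_le:
  assumes "R > 0"
  shows "\<bar>\<bar>g x\<bar> * cutoff x0 R x - \<bar>g y\<bar> * cutoff x0 R y\<bar> \<le> 1 * \<bar>g x - g y\<bar> + \<bar>g x\<bar> / R * dist x y"
proof -
  have "\<bar>g x\<bar> * cutoff x0 R x - \<bar>g y\<bar> * cutoff x0 R y
      = (\<bar>g x\<bar> - \<bar>g y\<bar>) * cutoff x0 R y + \<bar>g x\<bar> * (cutoff x0 R x - cutoff x0 R y)" by (simp add: algebra_simps)
  also have "\<bar>\<dots>\<bar> \<le> \<bar>(\<bar>g x\<bar> - \<bar>g y\<bar>) * cutoff x0 R y\<bar> + \<bar>\<bar>g x\<bar> * (cutoff x0 R x - cutoff x0 R y)\<bar>"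
    by (rule abs_triangle_ineq)
  also have "\<dots> \<le> 1 * \<bar>g x - g y\<bar> + \<bar>g x\<bar> * (dist x y / R)"
  proof (rule add_mono)
    have "\<bar>(\<bar>g x\<bar> - \<bar>g y\<bar>) * cutoff x0 R y\<bar> \<le> \<bar>g x - g y\<bar> * 1"
      unfolding abs_mult using cutoff_range[of x0 R y] by (intro mult_mono) auto
    then show "\<bar>(\<bar>g x\<bar> - \<bar>g y\<bar>) * cutoff x0 R y\<bar> \<le> 1 * \<bar>g x - g y\<bar>" by simp
    show "\<bar>\<bar>g x\<bar> * (cutoff x0 R x - cutoff x0 R y)\<bar> \<le> \<bar>g x\<bar> * (dist x y / R)"
      using mult_left_mono[OF cutoff_lipschitz[OF assms, of x0 x y], of "\<bar>g x\<bar>"] by (simp add: abs_mult)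
  qed
  finally show ?thesis by simp
qed

text \<open>The absolute value makes the function nonnegative without changing the Moser-Trudinger
  integrand, which depends on |v| only.\<close>

lemma test_function_cutoff:
  fixes g :: "'a::metric_space \<Rightarrow> real"
  assumes g: "locally_lipschitz g" and R: "R > 0" and proper: "compact (cball x0 (2 * R))"
  shows "test_function (\<lambda>x. \<bar>g x\<bar> * cutoff x0 R x)"
  unfolding test_function_def
proof (intro conjI allI exI)
  show "locally_lipschitz (\<lambda>x. \<bar>g x\<bar> * cutoff x0 R x)"
  proof (rule locally_lipschitzI)
    fix x
    obtain d L where d: "d > 0" "L \<ge> 0" "\<And>y z. y \<in> ball x d \<Longrightarrow> z \<in> ball x d \<Longrightarrow> \<bar>g y - g z\<bar> \<le> L * dist y z"
      using locally_lipschitzE[OF g, of x] by blast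
    define G where "G = \<bar>g x\<bar> + L * d"
    have "\<bar>\<bar>g y\<bar> * cutoff x0 R y - \<bar>g z\<bar> * cutoff x0 R z\<bar> \<le> (L + G / R) * dist y z"
      if y: "y \<in> ball x d" and z: "z \<in> ball x d" for y z
    proof -
      have "\<bar>g x - g y\<bar> \<le> L * dist x y" using d y by (intro d(3)) auto
      also have "\<dots> \<le> L * d" using y d by (intro mult_left_mono) auto
      finally have G: "\<bar>g y\<bar> \<le> G" by (simp add: G_def)
      have "\<bar>\<bar>g y\<bar> * cutoff x0 R y - \<bar>g z\<bar> * cutoff x0 R z\<bar> \<le> 1 * \<bar>g y - g z\<bar> + \<bar>g y\<bar> / R * dist y z"
        by (rule cutoff_product_le[OF R])
      also have "\<dots> \<le> L * dist y z + G / R * dist y z"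
        using d(3)[OF y z] G R by (intro add_mono mult_right_mono divide_right_mono) auto
      finally show ?thesis by (simp add: algebra_simps)
    qed
    then show "\<exists>d>0. \<exists>L. \<forall>y\<in>ball x d. \<forall>z\<in>ball x d. \<bar>\<bar>g y\<bar> * cutoff x0 R y - \<bar>g z\<bar> * cutoff x0 R z\<bar> \<le> L * dist y z"
      using d(1) by blast
  qed
  show "0 \<le> \<bar>g x\<bar> * cutoff x0 R x" for x using cutoff_range(1)[of x0 R x] by simp
  show "compact (cball x0 (2 * R))" by fact
  show "x \<notin> cball x0 (2 * R) \<longrightarrow> \<bar>g x\<bar> * cutoff x0 R x = 0" for x
  proof
    assume "x \<notin> cball x0 (2 * R)"
    then have "2 < dist x x0 / R" using R by (simp add: field_simps dist_commute)
    then show "\<bar>g x\<bar> * cutoff x0 R x = 0" by (simp add: cutoff_def)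
  qed
qed

context isoperimetric_space begin

lemma cutoff_energy:
  assumes g: "locally_lipschitz g" and R: "R > 0" and \<epsilon>: "\<epsilon> > 0"
    and E: "(\<integral>\<^sup>+ x. lip g x ^ m \<partial>M) \<le> ennreal a" "a \<ge> 0"
    and G: "(\<integral>\<^sup>+ x. ennreal (\<bar>g x\<bar> ^ m) \<partial>M) \<le> ennreal b" "b \<ge> 0"
  shows "(\<integral>\<^sup>+ x. lip (\<lambda>x. \<bar>g x\<bar> * cutoff x0 R x) x ^ m \<partial>M)
     \<le> ennreal ((1 + \<epsilon>) ^ m * a + (1 + 1 / \<epsilon>) ^ m * b / R ^ m)"
proof -
  note c = locally_lipschitz_continuous[OF g]
  have [measurable]: "g \<in> borel_measurable M" "lip g \<in> borel_measurable M"
    using borel_measurable_continuous_onI[OF c] lip_measurable[OF c] measurable_cong_sets[OF sets_M refl] by blast+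
  define k1 where "k1 = (1 + \<epsilon>) ^ m"
  define k2 where "k2 = (1 + 1 / \<epsilon>) ^ m / R ^ m"
  have k: "k1 \<ge> 0" "k2 \<ge> 0" using \<epsilon> R by (auto simp: k1_def k2_def)
  have pw: "lip (\<lambda>x. \<bar>g x\<bar> * cutoff x0 R x) x ^ m \<le> ennreal k1 * lip g x ^ m + ennreal k2 * ennreal (\<bar>g x\<bar> ^ m)" for x
  proof -
    define L where "L = enn2real (lip g x)"
    have L: "L \<ge> 0" "lip g x = ennreal L" unfolding L_def using lip_finite[OF g, of x] by auto
    have "lip (\<lambda>x. \<bar>g x\<bar> * cutoff x0 R x) x \<le> ennreal 1 * lip g x + ennreal (\<bar>g x\<bar> / R)"
      using R cutoff_product_le[OF R, of g x x0] by (intro lip_le_affine always_eventually allI) auto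
    also have "\<dots> = ennreal (L + \<bar>g x\<bar> / R)" using L R by (simp add: ennreal_plus)
    finally have "lip (\<lambda>x. \<bar>g x\<bar> * cutoff x0 R x) x ^ m \<le> ennreal (L + \<bar>g x\<bar> / R) ^ m" by (intro power_mono) auto
    also have "\<dots> = ennreal ((L + \<bar>g x\<bar> / R) ^ m)" using L R by (intro ennreal_power) auto
    also have "\<dots> \<le> ennreal (k1 * L ^ m + k2 * \<bar>g x\<bar> ^ m)"
      using power_add_le[of L "\<bar>g x\<bar> / R" \<epsilon> m] L R \<epsilon> by (intro ennreal_leI) (simp add: k1_def k2_def power_divide)
    also have "\<dots> = ennreal k1 * lip g x ^ m + ennreal k2 * ennreal (\<bar>g x\<bar> ^ m)"
      using k L by (simp add: ennreal_plus ennreal_mult ennreal_power)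
    finally show ?thesis .
  qed
  have "(\<integral>\<^sup>+ x. lip (\<lambda>x. \<bar>g x\<bar> * cutoff x0 R x) x ^ m \<partial>M)
     \<le> (\<integral>\<^sup>+ x. ennreal k1 * lip g x ^ m + ennreal k2 * ennreal (\<bar>g x\<bar> ^ m) \<partial>M)"
    by (rule nn_integral_mono) (rule pw)
  also have "\<dots> = ennreal k1 * (\<integral>\<^sup>+ x. lip g x ^ m \<partial>M) + ennreal k2 * (\<integral>\<^sup>+ x. ennreal (\<bar>g x\<bar> ^ m) \<partial>M)"
    by (simp add: nn_integral_add nn_integral_cmult)
  also have "\<dots> \<le> ennreal k1 * ennreal a + ennreal k2 * ennreal b"
    using E G by (intro add_mono mult_left_mono) auto
  also have "\<dots> = ennreal (k1 * a + k2 * b)" using k E G by (simp add: ennreal_plus ennreal_mult)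
  finally show ?thesis by (simp add: k1_def k2_def)
qed

lemma moser_integrand_Fatou:
  assumes f: "\<And>n. f n \<in> borel_measurable M" and lim: "AE x in M. (\<lambda>n. f n x) \<longlonglongrightarrow> u x"
    and bound: "\<And>n. (\<integral>\<^sup>+ x. ennreal (moser_integrand m \<alpha> (f n x)) \<partial>M) \<le> C"
  shows "(\<integral>\<^sup>+ x. ennreal (moser_integrand m \<alpha> (u x)) \<partial>M) \<le> C"
proof -
  have c: "isCont (moser_integrand m \<alpha>) y" for y
    using moser_integrand_continuous[OF m] by (simp add: continuous_on_eq_continuous_at)
  have [measurable]: "(\<lambda>x. ennreal (moser_integrand m \<alpha> (f n x))) \<in> borel_measurable M" for n
    using measurable_compose[OF f borel_measurable_continuous_onI[OF moser_integrand_continuous[OF m]]] by simp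
  have "AE x in M. ennreal (moser_integrand m \<alpha> (u x)) = liminf (\<lambda>n. ennreal (moser_integrand m \<alpha> (f n x)))"
    using lim
  proof eventually_elim
    case (elim x)
    have "(\<lambda>n. ennreal (moser_integrand m \<alpha> (f n x))) \<longlonglongrightarrow> ennreal (moser_integrand m \<alpha> (u x))"
      by (intro tendsto_ennrealI isCont_tendsto_compose[OF c elim])
    then show ?case by (simp add: lim_imp_Liminf)
  qed
  then have "(\<integral>\<^sup>+ x. ennreal (moser_integrand m \<alpha> (u x)) \<partial>M) = (\<integral>\<^sup>+ x. liminf (\<lambda>n. ennreal (moser_integrand m \<alpha> (f n x))) \<partial>M)"
    by (rule nn_integral_cong_AE)
  also have "\<dots> \<le> liminf (\<lambda>n. \<integral>\<^sup>+ x. ennreal (moser_integrand m \<alpha> (f n x)) \<partial>M)"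
    by (rule nn_integral_liminf) measurable
  also have "\<dots> \<le> liminf (\<lambda>n. C)" using bound by (intro Liminf_mono always_eventually allI)
  also have "\<dots> = C" by (rule Liminf_const) simp
  finally show ?thesis .
qed

text \<open>Cutoffs at growing radii eventually agree with |g| at every point, and their energy fits
  into the gap between \<open>a\<close> and \<open>A\<close>, so Fatou's lemma transfers the
  bound.\<close>

lemma locally_lipschitz_moser_bound:
  assumes proper: "\<And>(x::'a) R. compact (cball x R)"
    and A: "0 < a" "a < A"
    and C: "\<And>g. test_function g \<Longrightarrow> (\<integral>\<^sup>+ x. lip g x ^ m \<partial>M) \<le> ennreal A \<Longrightarrow>
           (\<integral>\<^sup>+ x. ennreal (moser_integrand m \<alpha> (g x)) \<partial>M) \<le> C"
    and g: "locally_lipschitz g" and E: "(\<integral>\<^sup>+ x. lip g x ^ m \<partial>M) \<le> ennreal a"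
    and G: "(\<integral>\<^sup>+ x. ennreal (\<bar>g x\<bar> ^ m) \<partial>M) < \<infinity>"
  shows "(\<integral>\<^sup>+ x. ennreal (moser_integrand m \<alpha> (g x)) \<partial>M) \<le> C"
proof -
  obtain b where b: "(\<integral>\<^sup>+ x. ennreal (\<bar>g x\<bar> ^ m) \<partial>M) = ennreal b" "b \<ge> 0"
    using G by (cases "\<integral>\<^sup>+ x. ennreal (\<bar>g x\<bar> ^ m) \<partial>M") auto
  note c = locally_lipschitz_continuous[OF g]
  define x0 :: 'a where "x0 = undefined"
  \<comment> \<open>\<open>\<epsilon>\<close> is fixed first, using a < A; the radius is then taken
    large in terms of \<open>\<epsilon>\<close> and the L^m norm \<open>b\<close>, to absorb the
    cutoff error. Neither choice affects \<open>C\<close>.\<close>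
  have "((\<lambda>\<epsilon>. (1 + \<epsilon>) ^ m * a) \<longlongrightarrow> (1 + 0) ^ m * a) (at_right 0)"
    by (intro tendsto_intros)
  then have "eventually (\<lambda>\<epsilon>. (1 + \<epsilon>) ^ m * a < A) (at_right 0)"
    by (rule order_tendstoD) (use A in simp)
  then have "eventually (\<lambda>\<epsilon>. (1 + \<epsilon>) ^ m * a < A \<and> \<epsilon> > 0) (at_right (0::real))"
    using eventually_at_right_less by (rule eventually_conj)
  then obtain \<epsilon> where \<epsilon>: "\<epsilon> > 0" "(1 + \<epsilon>) ^ m * a < A"
    using eventually_happens'[OF trivial_limit_at_right_real] by blast
  have "((\<lambda>n::nat. (1 + \<epsilon>) ^ m * a + (1 + 1 / \<epsilon>) ^ m * b * (1 / real (Suc n)) ^ m) \<longlongrightarrow>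
      (1 + \<epsilon>) ^ m * a + (1 + 1 / \<epsilon>) ^ m * b * 0 ^ m) sequentially"
    by (intro tendsto_intros LIMSEQ_Suc[OF lim_1_over_n])
  then have "eventually (\<lambda>n. (1 + \<epsilon>) ^ m * a + (1 + 1 / \<epsilon>) ^ m * b * (1 / real (Suc n)) ^ m < A) sequentially"
    by (rule order_tendstoD) (use \<epsilon> m in \<open>simp add: zero_power\<close>)
  then obtain N where N: "\<And>n. n \<ge> N \<Longrightarrow> (1 + \<epsilon>) ^ m * a + (1 + 1 / \<epsilon>) ^ m * b * (1 / real (Suc n)) ^ m < A"
    unfolding eventually_sequentially by blast
  define f where "f n x = \<bar>g x\<bar> * cutoff x0 (real (Suc (n + N))) x" for n x
  have tf: "test_function (f n)" for n
    unfolding f_def by (rule test_function_cutoff[OF g _ proper]) simp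
  have "(\<integral>\<^sup>+ x. ennreal (moser_integrand m \<alpha> \<bar>g x\<bar>) \<partial>M) \<le> C"
  proof (rule moser_integrand_Fatou[where f=f])
    show "f n \<in> borel_measurable M" for n by (rule test_functionD(3)[OF tf])
    show "AE x in M. (\<lambda>n. f n x) \<longlonglongrightarrow> \<bar>g x\<bar>"
    proof (rule AE_I2)
      fix x
      obtain k where k: "dist x x0 < real k" using reals_Archimedean2 by blast
      have "f n x = \<bar>g x\<bar>" if "n \<ge> k" for n
      proof -
        have "dist x x0 \<le> real (Suc (n + N))" using k that by linarith
        then have "dist x x0 / real (Suc (n + N)) \<le> 1" by simp
        then have "cutoff x0 (real (Suc (n + N))) x = 1" unfolding cutoff_def by linarith
        then show ?thesis by (simp add: f_def)
      qed
      then have "eventually (\<lambda>n. f n x = \<bar>g x\<bar>) sequentially" by (auto simp: eventually_sequentially)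
      then show "(\<lambda>n. f n x) \<longlonglongrightarrow> \<bar>g x\<bar>" by (rule tendsto_eventually)
    qed
    fix n
    have "(\<integral>\<^sup>+ x. lip (f n) x ^ m \<partial>M) \<le> ennreal ((1 + \<epsilon>) ^ m * a + (1 + 1 / \<epsilon>) ^ m * b / (real (Suc (n + N))) ^ m)"
      unfolding f_def using A b E by (intro cutoff_energy[OF g _ \<epsilon>(1)]) auto
    also have "\<dots> \<le> ennreal A" using N[of "n + N"] by (intro ennreal_leI) (simp add: power_divide)
    finally show "(\<integral>\<^sup>+ x. ennreal (moser_integrand m \<alpha> (f n x)) \<partial>M) \<le> C" by (rule C[OF tf])
  qed
  then show ?thesis by (simp add: moser_integrand_def)
qed

text \<open>The relaxed energy only provides locally Lipschitz approximants whose energies come near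
  it, hence the strict bound by \<open>a\<close>. Their convergence in L^m yields almost everywhere
  convergence along a subsequence, and Fatou's lemma applies.\<close>

lemma sobolev_moser_bound:
  assumes C: "\<And>g. locally_lipschitz g \<Longrightarrow> (\<integral>\<^sup>+ x. lip g x ^ m \<partial>M) \<le> ennreal a \<Longrightarrow>
       (\<integral>\<^sup>+ x. ennreal (\<bar>g x\<bar> ^ m) \<partial>M) < \<infinity> \<Longrightarrow> (\<integral>\<^sup>+ x. ennreal (moser_integrand m \<alpha> (g x)) \<partial>M) \<le> C"
    and u: "u \<in> sobolev_W1 M (real m)" and E: "cheeger_energy M (real m) u < ennreal a"
  shows "(\<integral>\<^sup>+ x. ennreal (moser_integrand m \<alpha> (u x)) \<partial>M) \<le> C"
proof -
  have m0: "m > 0" using m by simp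
  have um [measurable]: "u \<in> borel_measurable M" and uL: "(\<integral>\<^sup>+ x. ennreal (\<bar>u x\<bar> ^ m) \<partial>M) < \<infinity>"
    using u m0 by (auto simp: sobolev_W1_def powr_realpow' )
  obtain g where g: "\<And>i. locally_lipschitz (g i)"
    and conv: "(\<lambda>i. \<integral>\<^sup>+ x. ennreal (\<bar>g i x - u x\<bar> powr real m) \<partial>M) \<longlonglongrightarrow> 0"
    and li: "liminf (\<lambda>i. slope_integral M (real m) (g i)) < ennreal a"
    using E unfolding cheeger_energy_def Inf_less_iff by blast
  have gm [measurable]: "g i \<in> borel_measurable M" for i
    using borel_measurable_continuous_onI[OF locally_lipschitz_continuous[OF g]] measurable_cong_sets[OF sets_M refl] by blast
  have si: "slope_integral M (real m) (g i) = (\<integral>\<^sup>+ x. lip (g i) x ^ m \<partial>M)" for i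
    unfolding slope_integral_def by (simp add: ennreal_powr_of_nat[OF m0])
  define d where "d i x = \<bar>g i x - u x\<bar> ^ m" for i x
  have dm [measurable]: "d i \<in> borel_measurable M" for i unfolding d_def by measurable
  have d0: "d i x \<ge> 0" for i x by (simp add: d_def)
  have conv': "(\<lambda>i. \<integral>\<^sup>+ x. ennreal (d i x) \<partial>M) \<longlonglongrightarrow> 0"
    using conv m0 by (simp add: d_def powr_realpow')
  \<comment> \<open>Two extractions: \<open>r\<close> realises the liminf of the energies, and
    \<open>k\<close> below gives almost everywhere convergence. In between, a shift by
    \<open>N\<close> makes the energy bound and finiteness of the distance to \<open>u\<close> valid
    for all indices.\<close>
  obtain r where r: "strict_mono r" "(\<lambda>i. slope_integral M (real m) (g (r i))) \<longlonglongrightarrow> liminf (\<lambda>i. slope_integral M (real m) (g i))"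
    using liminf_subseq_lim[of "\<lambda>i. slope_integral M (real m) (g i)"] by (auto simp: comp_def)
  have "eventually (\<lambda>i. slope_integral M (real m) (g (r i)) < ennreal a) sequentially"
    using r(2) li by (rule order_tendstoD)
  moreover have dr: "(\<lambda>i. \<integral>\<^sup>+ x. ennreal (d (r i) x) \<partial>M) \<longlonglongrightarrow> 0"
    using LIMSEQ_subseq_LIMSEQ[OF conv' r(1)] by (simp add: comp_def)
  then have "eventually (\<lambda>i. (\<integral>\<^sup>+ x. ennreal (d (r i) x) \<partial>M) < 1) sequentially"
    by (rule order_tendstoD) simp
  ultimately have "eventually (\<lambda>i. slope_integral M (real m) (g (r i)) < ennreal a \<and> (\<integral>\<^sup>+ x. ennreal (d (r i) x) \<partial>M) < 1) sequentially"
    by (rule eventually_conj)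
  then obtain N where N: "\<And>i. i \<ge> N \<Longrightarrow> slope_integral M (real m) (g (r i)) < ennreal a"
    "\<And>i. i \<ge> N \<Longrightarrow> (\<integral>\<^sup>+ x. ennreal (d (r i) x) \<partial>M) < 1" unfolding eventually_sequentially by blast
  define s where "s i = r (i + N)" for i
  have sE: "(\<integral>\<^sup>+ x. lip (g (s i)) x ^ m \<partial>M) \<le> ennreal a" and sd: "(\<integral>\<^sup>+ x. ennreal (d (s i) x) \<partial>M) < 1" for i
    using N(1)[of "i + N"] N(2)[of "i + N"] si[of "r (i + N)"] by (auto simp: s_def)
  have int: "integrable M (d (s i))" for i
  proof (rule integrableI_bounded)
    show "(\<integral>\<^sup>+ x. ennreal (norm (d (s i) x)) \<partial>M) < \<infinity>"
      using order_less_trans[OF sd[of i] ennreal_one_less_top] d0 by simp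
  qed measurable
  have "(\<lambda>i. \<integral>\<^sup>+ x. ennreal (d (s i) x) \<partial>M) \<longlonglongrightarrow> 0"
    unfolding s_def using dr by (rule LIMSEQ_ignore_initial_segment)
  then have "(\<lambda>i. enn2real (\<integral>\<^sup>+ x. ennreal (d (s i) x) \<partial>M)) \<longlonglongrightarrow> enn2real 0"
    by (intro tendsto_enn2real) auto
  moreover have "(\<integral>x. norm (d (s i) x) \<partial>M) = enn2real (\<integral>\<^sup>+ x. ennreal (d (s i) x) \<partial>M)" for i
    using d0 by (simp add: integral_eq_nn_integral)
  ultimately have "(\<lambda>i. \<integral>x. norm (d (s i) x) \<partial>M) \<longlonglongrightarrow> 0" by simp
  from tendsto_L1_AE_subseq[OF int this]
  obtain k where k: "strict_mono k" "AE x in M. (\<lambda>i. d (s (k i)) x) \<longlonglongrightarrow> 0" by blast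
  show ?thesis
  proof (rule moser_integrand_Fatou[where f="\<lambda>i. g (s (k i))"])
    show "AE x in M. (\<lambda>i. g (s (k i)) x) \<longlonglongrightarrow> u x"
      using k(2)
    proof eventually_elim
      case (elim x)
      have "(\<lambda>i. root m (d (s (k i)) x)) \<longlonglongrightarrow> root m 0" by (intro tendsto_real_root elim)
      then have "(\<lambda>i. \<bar>g (s (k i)) x - u x\<bar>) \<longlonglongrightarrow> 0" using m0 by (simp add: d_def real_root_power_cancel)
      then have "(\<lambda>i. g (s (k i)) x - u x) \<longlonglongrightarrow> 0" by (rule tendsto_rabs_zero_cancel)
      then show ?case by (rule LIM_zero_cancel)
    qed
    fix i
    let ?j = "s (k i)"
    have "(\<integral>\<^sup>+ x. ennreal (\<bar>g ?j x\<bar> ^ m) \<partial>M) \<le> (\<integral>\<^sup>+ x. ennreal (2 ^ m) * ennreal (d ?j x) + ennreal (2 ^ m) * ennreal (\<bar>u x\<bar> ^ m) \<partial>M)"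
    proof (rule nn_integral_mono)
      fix x
      have "\<bar>g ?j x\<bar> ^ m \<le> (\<bar>g ?j x - u x\<bar> + \<bar>u x\<bar>) ^ m" by (intro power_mono) auto
      also have "\<dots> \<le> 2 ^ m * d ?j x + 2 ^ m * \<bar>u x\<bar> ^ m"
        using power_add_le[of "\<bar>g ?j x - u x\<bar>" "\<bar>u x\<bar>" 1 m] by (simp add: d_def)
      finally have "ennreal (\<bar>g ?j x\<bar> ^ m) \<le> ennreal (2 ^ m * d ?j x + 2 ^ m * \<bar>u x\<bar> ^ m)" by (rule ennreal_leI)
      then show "ennreal (\<bar>g ?j x\<bar> ^ m) \<le> ennreal (2 ^ m) * ennreal (d ?j x) + ennreal (2 ^ m) * ennreal (\<bar>u x\<bar> ^ m)"
        using d0[of ?j x] by (simp only: ennreal_plus ennreal_mult zero_le_power abs_ge_zero mult_nonneg_nonneg zero_le_numeral)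
    qed
    also have "\<dots> = ennreal (2 ^ m) * (\<integral>\<^sup>+ x. ennreal (d ?j x) \<partial>M) + ennreal (2 ^ m) * (\<integral>\<^sup>+ x. ennreal (\<bar>u x\<bar> ^ m) \<partial>M)"
      by (subst nn_integral_add) (auto simp: nn_integral_cmult)
    also have "\<dots> < \<infinity>"
      using uL order_less_trans[OF sd[of "k i"] ennreal_one_less_top] by (simp add: ennreal_mult_less_top)
    finally show "(\<integral>\<^sup>+ x. ennreal (moser_integrand m \<alpha> (g ?j x)) \<partial>M) \<le> C"
      by (intro C g sE)
  qed measurable
qed

end

section \<open>Constants and isoperimetric inequalities from the hypotheses\<close>

text \<open>Geometrically, the equatorial disc has smaller area than the sphere. The proof uses the
  recurrence \<omega>_(x+2) = 2 pi / (x + 2) \<omega>_x, so the induction moves in steps of two from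
  the base cases m = 2 and m = 3.\<close>

lemma unit_ball_vol_less:
  assumes "m \<ge> 2"
  shows "unit_ball_vol (real m - 1) < real m * unit_ball_vol (real m)"
  using assms
proof (induction m rule: less_induct)
  case (less m)
  have rec: "unit_ball_vol (x + 2) = 2 * pi / (x + 2) * unit_ball_vol x" if "x \<ge> 0" for x :: real
  proof -
    have "Gamma ((x + 2) / 2 + 1) = ((x + 2) / 2) * Gamma (x / 2 + 1)"
      using Gamma_plus1[of "x / 2 + 1"] that by (auto simp: nonpos_Ints_def field_simps)
    moreover have "pi powr ((x + 2) / 2) = pi powr (x / 2) * pi" by (simp add: add_divide_distrib powr_add)
    ultimately have "unit_ball_vol (x + 2) = pi powr (x / 2) * pi / ((x + 2) / 2 * Gamma (x / 2 + 1))"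
      unfolding unit_ball_vol_def by (simp only:)
    also have "\<dots> = 2 * pi / (x + 2) * (pi powr (x / 2) / Gamma (x / 2 + 1))" by simp
    finally show ?thesis unfolding unit_ball_vol_def .
  qed
  show ?case
  proof (cases "m < 4")
    case True
    then have "m = 2 \<or> m = 3" using less.prems by auto
    then show ?thesis
    proof
      assume "m = 2"
      then show ?thesis using rec[of 0] pi_gt3 by simp
    next
      assume "m = 3"
      then show ?thesis using rec[of 0] rec[of 1] pi_gt3 by simp
    qed
  next
    case False
    define k where "k = m - 2"
    have k: "m = k + 2" "k \<ge> 2" "k < m" using False by (auto simp: k_def)
    have IH: "unit_ball_vol (real k - 1) < real k * unit_ball_vol (real k)" using less.IH[OF k(3,2)] .
    have "unit_ball_vol (real m - 1) = 2 * pi / (real k + 1) * unit_ball_vol (real k - 1)"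
      using rec[of "real k - 1"] k by (simp add: algebra_simps)
    also have "\<dots> < 2 * pi / (real k + 1) * (real k * unit_ball_vol (real k))"
      using IH by (intro mult_strict_left_mono) (auto intro!: divide_pos_pos)
    also have "\<dots> \<le> 2 * pi * unit_ball_vol (real k)"
      using unit_ball_vol_pos[of "real k"] by (simp add: field_simps)
    also have "\<dots> = real m * unit_ball_vol (real m)"
      using rec[of "real k"] k by (simp add: add.commute)
    finally show ?thesis .
  qed
qed

text \<open>Infinite total volume makes the constraint 2 \<mu>(A) \<le> \<mu>(X) automatic; a
  positive finite mass allows the quotient to be multiplied out.\<close>

lemma cheeger_constant_lower:
  assumes inf: "emeasure M UNIV = \<infinity>" and h: "ennreal h \<le> cheeger_constant M"
    and A: "A \<in> sets M" "compact (closure A)" "emeasure M A > 0" "emeasure M A < \<infinity>"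
  shows "ennreal h * emeasure M A \<le> perimeter M A"
proof -
  have "cheeger_constant M \<le> perimeter M A / emeasure M A"
    unfolding cheeger_constant_def using A inf by (intro Inf_lower) auto
  then have "ennreal h * emeasure M A \<le> perimeter M A / emeasure M A * emeasure M A"
    using h by (intro mult_right_mono) auto
  also have "\<dots> = perimeter M A * emeasure M A / emeasure M A"
    by (simp add: ennreal_times_divide mult.commute)
  also have "\<dots> = perimeter M A"
    using A by (intro ennreal_mult_divide_eq) auto
  finally show ?thesis .
qed

text \<open>A constant strictly below the liminf is a lower bound on a whole interval to the right
  of 0. The equation for \<open>B\<close> gathers all factors, so that the bound reads (B
  t)^(m-1).\<close>

lemma profile_lower_near_0:
  assumes m: "m \<ge> 2" and l: "ennreal l < l_infty M m" "l > 0" and B: "B \<ge> 0" "B ^ (m - 1) = l * unit_ball_vol (real m) * real m ^ m"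
  shows "\<exists>v>0. \<forall>A t. A \<in> sets M \<longrightarrow> compact (closure A) \<longrightarrow> 0 < t \<longrightarrow> t < v \<longrightarrow> emeasure M A = ennreal t \<longrightarrow>
     ennreal ((B * t) ^ (m - 1)) \<le> perimeter M A ^ m"
proof -
  let ?w = "unit_ball_vol (real m)"
  have w: "?w > 0" by (rule unit_ball_vol_pos) simp
  have "eventually (\<lambda>t. ennreal l < ennreal (1 / ?w) *
       (isoperimetric_profile M t ^ m / ennreal (real m ^ m * t ^ (m - 1)))) (at_right 0)"
    using l(1) unfolding l_infty_def by (rule less_LiminfD)
  then obtain v where v: "v > 0" "\<And>t. 0 < t \<Longrightarrow> t < v \<Longrightarrow> ennreal l < ennreal (1 / ?w) *
       (isoperimetric_profile M t ^ m / ennreal (real m ^ m * t ^ (m - 1)))"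
    unfolding eventually_at_right_field by blast
  show ?thesis
  proof (intro exI[of _ v] conjI allI impI v(1))
    fix A t assume A: "A \<in> sets M" "compact (closure A)" "0 < t" "t < v" "emeasure M A = ennreal t"
    define c where "c = real m ^ m * t ^ (m - 1)"
    have c: "c > 0" using A m by (simp add: c_def)
    let ?P = "isoperimetric_profile M t ^ m"
    have "(B * t) ^ (m - 1) = ?w * c * l" unfolding power_mult_distrib B(2) c_def by (simp only: mult_ac)
    then have "ennreal ((B * t) ^ (m - 1)) = ennreal (?w * c) * ennreal l"
      using w c l by (simp add: ennreal_mult)
    also have "\<dots> \<le> ennreal (?w * c) * (ennreal (1 / ?w) * (?P / ennreal c))"
      using v(2)[OF A(3,4)] unfolding c_def by (intro mult_left_mono) auto
    also have "\<dots> = (ennreal (?w * c) * ennreal (1 / ?w)) * (?P / ennreal c)" by (simp add: mult.assoc)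
    also have "ennreal (?w * c) * ennreal (1 / ?w) = ennreal c"
      using w c by (simp add: ennreal_mult[symmetric] less_imp_neq[symmetric] del: unit_ball_vol_pos)
    also have "ennreal c * (?P / ennreal c) = ?P * ennreal c / ennreal c"
      by (simp add: ennreal_times_divide mult.commute)
    also have "\<dots> = ?P" using c by (intro ennreal_mult_divide_eq) auto
    also have "\<dots> \<le> perimeter M A ^ m"
      unfolding isoperimetric_profile_def using A by (intro power_mono Inf_lower) auto
    finally show "ennreal ((B * t) ^ (m - 1)) \<le> perimeter M A ^ m" .
  qed
qed

text \<open>The bound on \<alpha> says (\<alpha>/m)^(m-1) \<le> L \<omega>_(m-1), which is strictly
  below L m \<omega>_m when \<open>L\<close> is finite. This leaves room for some l < L with
  (\<alpha>/m)^(m-1) < l m \<omega>_m, and that inequality is \<alpha> < B.\<close>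

lemma subcritical_constant:
  fixes \<alpha> :: real
  assumes m: "m \<ge> 2" and l: "L > 0" and \<alpha>: "\<alpha> > 0"
    and le: "L \<noteq> \<infinity> \<Longrightarrow> \<alpha> \<le> real m * (enn2real L * unit_ball_vol (real m - 1)) powr (1 / (real m - 1))"
  shows "\<exists>l B. l > 0 \<and> ennreal l < L \<and> \<alpha> < B \<and> B ^ (m - 1) = l * unit_ball_vol (real m) * real m ^ m"
proof -
  define p where "p = m - 1"
  define w where "w = unit_ball_vol (real m)"
  define w' where "w' = unit_ball_vol (real m - 1)"
  have p: "p > 0" "m = Suc p" "real m - 1 = real p" using m by (auto simp: p_def of_nat_diff)
  have w: "w > 0" "w' > 0" "w' < real m * w"
    using unit_ball_vol_less[OF m] m by (auto simp: w_def w'_def)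
  have wit: "\<exists>l B. l > 0 \<and> ennreal l < L \<and> \<alpha> < B \<and> B ^ (m - 1) = l * unit_ball_vol (real m) * real m ^ m"
    if "l > 0" "ennreal l < L" "(\<alpha> / real m) ^ p < l * real m * w" for l
  proof -
    define B where "B = real m * root p (l * real m * w)"
    have "root p ((\<alpha> / real m) ^ p) < root p (l * real m * w)" using p that by simp
    then have "\<alpha> / real m < root p (l * real m * w)" using p(1) \<alpha> by (simp add: real_root_power_cancel)
    then have "\<alpha> < B" using m by (simp add: B_def field_simps)
    moreover have "B ^ p = real m ^ p * (l * real m * w)" using p w that by (simp add: B_def power_mult_distrib)
    then have "B ^ (m - 1) = l * unit_ball_vol (real m) * real m ^ m"
      unfolding p_def[symmetric] w_def by (simp add: p(2) mult_ac)
    ultimately show ?thesis using that(1,2) by blast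
  qed
  show ?thesis
  proof (cases "L = \<infinity>")
    case True
    \<comment> \<open>With \<open>L\<close> infinite, \<open>l\<close> is free; the 1 makes the
      inequality for \<alpha> strict.\<close>
    define l where "l = ((\<alpha> / real m) ^ p + 1) / (real m * w)"
    have "l > 0" using \<alpha> w m by (auto simp: l_def intro!: divide_pos_pos add_nonneg_pos)
    moreover have "l * real m * w = (\<alpha> / real m) ^ p + 1" using w m by (simp add: l_def)
    ultimately show ?thesis using True by (intro wit) auto
  next
    case False
    define l0 where "l0 = enn2real L"
    have L: "L = ennreal l0" "l0 > 0" using False l by (auto simp: l0_def enn2real_positive_iff less_top)
    have "\<alpha> / real m \<le> (l0 * w') powr (1 / real p)" using le[OF False] m p(3) by (simp add: l0_def w'_def field_simps)
    then have "(\<alpha> / real m) ^ p \<le> ((l0 * w') powr (1 / real p)) ^ p" using \<alpha> by (intro power_mono) auto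
    also have "\<dots> = l0 * w'" using p L w by (simp add: powr_realpow[symmetric] powr_powr)
    finally have le': "(\<alpha> / real m) ^ p \<le> l0 * w'" .
    \<comment> \<open>Solved from the requirement that \<open>l * real m * w\<close> be the midpoint
      of \<open>l0 * w'\<close> and \<open>l0 * (real m * w)\<close>.\<close>
    define l where "l = l0 * (w' + real m * w) / (2 * (real m * w))"
    have rw: "real m * w > 0" using w m by simp
    have "l > 0" unfolding l_def using L w rw m by (intro divide_pos_pos mult_pos_pos add_pos_pos) auto
    moreover have "l < l0" using L w rw by (simp add: l_def field_simps)
    moreover have "l * real m * w = l0 * (w' + real m * w) / 2"
    proof -
      have "a / (2 * x) * x = a / 2" if "x > 0" for a x :: real using that by simp
      from this[OF rw] show ?thesis by (simp only: l_def mult.assoc)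
    qed
    moreover have "l0 * w' < l0 * (w' + real m * w) / 2" using w L by (simp add: field_simps)
    ultimately have "0 < l" "l < l0" "(\<alpha> / real m) ^ p < l * real m * w" using le' by linarith+
    then show ?thesis using L by (intro wit) (auto simp: ennreal_less_iff)
  qed
qed

theorem theorem1p1:
  fixes M :: "'a::polish_space measure"
    and k n \<alpha> :: real
    and m :: nat
  assumes "n > 1"
    and "CD_space k n M"
    and "emeasure M UNIV = \<infinity>"
    and "cheeger_constant M \<noteq> 0"
    and "(INF x. emeasure M (ball x 1)) > 0"
    and "m \<ge> 2"
    and "l_infty M m > 0"
    and "\<alpha> > 0"
    and "l_infty M m \<noteq> \<infinity> \<Longrightarrow>
           \<alpha> \<le> real m * (enn2real (l_infty M m) * unit_ball_vol (real m - 1)) powr (1 / (real m - 1))"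
  shows "\<exists>C::real. C > 0 \<and>
           (\<forall>u \<in> sobolev_W1 M (real m). slope_norm M (real m) u \<le> 1 \<longrightarrow>
              (\<integral>\<^sup>+ x. ennreal (exp (\<alpha> * \<bar>u x\<bar> powr (real m / (real m - 1)))
                      - P_poly m (\<alpha> * \<bar>u x\<bar> powr (real m / (real m - 1)))) \<partial>M) \<le> ennreal C)"
proof -
  note m = \<open>m \<ge> 2\<close> and \<alpha> = \<open>\<alpha> > 0\<close>
  have mms: "metric_measure_space M" and CD: "curvature_dimension k n M"
    using assms(2) by (auto simp: CD_space_def)
  have proper: "compact (cball (x::'a) R)" for x R by (rule CD_space_proper[OF mms CD \<open>n > 1\<close>])
  \<comment> \<open>A real \<open>h\<close> is wanted, but the Cheeger constant may be infinite, in
    which case any positive number serves.\<close>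
  obtain h where h: "h > 0" "ennreal h \<le> cheeger_constant M"
  proof (cases "cheeger_constant M")
    case (real r)
    then show thesis using assms(4) that[of r] by (cases "r = 0") auto
  next
    case top
    then show thesis using that[of 1] by simp
  qed
  obtain l B where l: "l > 0" "ennreal l < l_infty M m" and B: "\<alpha> < B" "B ^ (m - 1) = l * unit_ball_vol (real m) * real m ^ m"
    using subcritical_constant[OF m assms(7) \<alpha> assms(9)] by blast
  obtain v where v: "v > 0" "\<And>A t. A \<in> sets M \<Longrightarrow> compact (closure A) \<Longrightarrow> 0 < t \<Longrightarrow> t < v \<Longrightarrow> emeasure M A = ennreal t \<Longrightarrow>
     ennreal ((B * t) ^ (m - 1)) \<le> perimeter M A ^ m"
    using profile_lower_near_0[OF m l(2,1) _ B(2)] B(1) \<alpha> by (smt (verit, best))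
  have finite_mass: "emeasure M A < \<infinity>" if A: "A \<in> sets M" "compact (closure A)" for A
  proof -
    obtain x r where "closure A \<subseteq> ball x r" using bounded_subset_ballD[OF compact_imp_bounded[OF A(2)]] by blast
    then have "A \<subseteq> ball x r" using closure_subset by blast
    then have "emeasure M A \<le> emeasure M (ball x r)"
      using mms by (intro emeasure_mono) (auto simp: metric_measure_space_def)
    also have "\<dots> < \<infinity>" using mms by (auto simp: metric_measure_space_def)
    finally show ?thesis .
  qed
  interpret isoperimetric_space M h B v m
  proof
    show "ennreal h * emeasure M A \<le> perimeter M A"
      if "A \<in> sets M" "compact (closure A)" "0 < emeasure M A" for A
      by (rule cheeger_constant_lower[OF assms(3) h(2) that finite_mass[OF that(1,2)]])
  qed (use mms h m B \<alpha> v in auto)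
  \<comment> \<open>The condition \<alpha> < B A^(-1/(m-1)) reads \<theta> < 1 / A. Taking 1 / A as
    the midpoint of \<theta> and 1 satisfies it with A > 1.\<close>
  define \<theta> where "\<theta> = (\<alpha> / B) ^ (m - 1)"
  have \<theta>: "0 < \<theta>" "\<theta> < 1" unfolding \<theta>_def using B \<alpha> m by (auto intro!: power_less_one_iff[THEN iffD2])
  define A where "A = 2 / (1 + \<theta>)"
  have A: "A > 1" using \<theta> by (simp add: A_def field_simps)
  have "\<alpha> / B = root (m - 1) \<theta>" unfolding \<theta>_def using m B \<alpha> by (simp add: real_root_power_cancel)
  also have "\<dots> < root (m - 1) (1 / A)" using \<theta> m by (simp add: A_def field_simps)
  finally have \<alpha>B: "\<alpha> < B * root (m - 1) (1 / A)" using B \<alpha> by (simp add: field_simps)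
  obtain C where C: "C > 0" "\<And>g. test_function g \<Longrightarrow> (\<integral>\<^sup>+ x. lip g x ^ m \<partial>M) \<le> ennreal A \<Longrightarrow>
           (\<integral>\<^sup>+ x. ennreal (moser_integrand m \<alpha> (g x)) \<partial>M) \<le> ennreal C"
    using test_function_moser_bound[OF _ \<alpha> \<alpha>B] A by auto
  \<comment> \<open>1 < a gives the strict energy bound needed for the relaxation, and a < A leaves
    room for the cutoffs.\<close>
  define a where "a = (1 + A) / 2"
  have a: "1 < a" "a < A" using A by (auto simp: a_def)
  have "(\<integral>\<^sup>+ x. ennreal (moser_integrand m \<alpha> (u x)) \<partial>M) \<le> ennreal C"
    if u: "u \<in> sobolev_W1 M (real m)" and n1: "slope_norm M (real m) u \<le> 1" for u
  proof (rule sobolev_moser_bound[OF _ u])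
    show "cheeger_energy M (real m) u < ennreal a"
    proof (cases "cheeger_energy M (real m) u")
      case (real r)
      have "r powr (1 / real m) \<le> 1" using n1 real by (simp add: slope_norm_def ennreal_powr_def)
      then have "(r powr (1 / real m)) powr real m \<le> 1" using powr_mono2[of "real m" "r powr (1 / real m)" 1] by simp
      then have "r \<le> 1" using real m by (simp add: powr_powr)
      then show ?thesis using a real by (simp add: ennreal_less_iff)
    next
      case top
      then show ?thesis using n1 by (simp add: slope_norm_def ennreal_powr_def top_unique)
    qed
    show "(\<integral>\<^sup>+ x. ennreal (moser_integrand m \<alpha> (g x)) \<partial>M) \<le> ennreal C"
      if "locally_lipschitz g" "(\<integral>\<^sup>+ x. lip g x ^ m \<partial>M) \<le> ennreal a" "(\<integral>\<^sup>+ x. ennreal (\<bar>g x\<bar> ^ m) \<partial>M) < \<infinity>" for g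
      using a by (intro locally_lipschitz_moser_bound[OF proper _ a(2) C(2) that]) auto
  qed
  then show ?thesis using C(1) unfolding moser_integrand_def by blast
qed

end
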